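(* Let $1<\alpha<2$, $0\le r\le 1$, and let $\beta\in[\alpha-1,1]$ be determined by $r=\frac{\sin(\pi\beta)}{\sin(\pi(\alpha-\beta))+\sin(\pi\beta)}$. Let $0<K_m\le K(x)\le K_M$ on $(0,1)$ (with $K_m,K_M$ constants). Then there is a constant $C>0$ (independent of $f$) such that for every $f\in L^2_{\omega^{(\beta,\alpha-\beta)}}(0,1)$ the solution $u$ of $$L_r^\alpha u(x)=f_1(x)-A f_2(x),\quad x\in(0,1),\qquad u(0)=u(1)=0,$$ with $f_1(x)=\frac1{K(x)}\int_0^xf(y)\,dy$ and $f_2(x)=\frac1{K(x)}$, satisfies $$\|u\|_{\omega^{(-(\alpha-\beta),-\beta)}}\le C\,\|f\|_{\omega^{(\beta,\alpha-\beta)}}.$$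
   Context: Weights and spaces: $\omega^{(a,b)}(x)=(1-x)^a x^b$ on $(0,1)$; $\|g\|_\omega=(\int_0^1\omega g^2dx)^{1/2}$, $L^2_\omega(0,1)=\{g:\|g\|_\omega<\infty\}$. Fractional integrals for $0<\sigma<1$: ${}_0I_x^\sigma w(x)=\frac1{\Gamma(\sigma)}\int_0^x w(s)(x-s)^{\sigma-1}ds$ and ${}_xI_1^\sigma w(x)=\frac1{\Gamma(\sigma)}\int_x^1 w(s)(s-x)^{\sigma-1}ds$. $D$ is the first derivative. Operator: $L_r^\alpha u=-\big(r\,{}_0I_x^{2-\alpha}+(1-r)\,{}_xI_1^{2-\alpha}\big)Du$. In the problem, $A$ is the constant (depending on $u$) $A=K(0)\big[\big(r\,{}_0I_x^{2-\alpha}+(1-r)\,{}_xI_1^{2-\alpha}\big)Du(x)\big]\big|_{x=0}$, which is formally what the equation gives when multiplied by $K$ and evaluated at $x=0$; thus one seeks $u$ together with the constant $A$. "The solution" is the unique solution $u\in L^2_{\omega^{(-(\alpha-\beta),-\beta)}}(0,1)$; for it, $A=\dfrac{\int_0^1\omega^{(\beta-1,\alpha-\beta-1)}f_1\,dx}{\int_0^1\omega^{(\beta-1,\alpha-\beta-1)}f_2\,dx}$. Jacobi polynomials on $(0,1)$: $G_n^{(a,b)}(x)=P_n^{(a,b)}(2x-1)$, with $P_n^{(a,b)}$ the standard Jacobi polynomials on $[-1,1]$ (orthogonal for $(1-x)^a(1+x)^b$). Sense of solution: every $u\in L^2_{\omega^{(-(\alpha-\beta),-\beta)}}(0,1)$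 has a unique expansion $u=\omega^{(\alpha-\beta,\beta)}\sum_{j\ge0}c_jG_j^{(\alpha-\beta,\beta)}$ converging in that space. With $u_N=\omega^{(\alpha-\beta,\beta)}\sum_{j=0}^N c_jG_j^{(\alpha-\beta,\beta)}$, $L_r^\alpha u$ is the limit of $L_r^\alpha u_N$ in $L^2_{\omega^{(\beta-1,\alpha-\beta-1)}}(0,1)$ when this limit exists; the homogeneous boundary conditions are understood as those carried by the truncations $u_N$ (each vanishing at $0$ and $1$). *)

theory Defs
  imports "HOL-Analysis.Analysis"
begin

definition jac_weight :: "real \<Rightarrow> real \<Rightarrow> real \<Rightarrow> real" where
  "jac_weight a b x = (1 - x) powr a * x powr b"

definition wL2 :: "(real \<Rightarrow> real) \<Rightarrow> (real \<Rightarrow> real) set" where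
  "wL2 w = {g. g \<in> borel_measurable (lebesgue_on {0<..<1}) \<and>
               set_integrable lebesgue {0<..<1} (\<lambda>x. w x * (g x)\<^sup>2)}"

text \<open>Meaningful on \<open>wL2 w\<close> only: the Bochner integral of a non-integrable function is 0.\<close>
definition wnorm :: "(real \<Rightarrow> real) \<Rightarrow> (real \<Rightarrow> real) \<Rightarrow> real" where
  "wnorm w g = sqrt (LINT x:{0<..<1}|lebesgue. w x * (g x)\<^sup>2)"

text \<open>Elements of the space are functions rather than classes modulo null sets, so limits
  are unique only up to a null set. The membership conditions keep \<open>wnorm\<close> meaningful.\<close>
definition wL2_tendsto ::
  "(real \<Rightarrow> real) \<Rightarrow> (nat \<Rightarrow> real \<Rightarrow> real) \<Rightarrow> (real \<Rightarrow> real) \<Rightarrow> bool" where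
  "wL2_tendsto w gs g \<longleftrightarrow> g \<in> wL2 w \<and> (\<forall>N. gs N \<in> wL2 w) \<and>
     (\<lambda>N. wnorm w (\<lambda>x. gs N x - g x)) \<longlonglongrightarrow> 0"

definition left_frac_int :: "real \<Rightarrow> (real \<Rightarrow> real) \<Rightarrow> real \<Rightarrow> real" where
  "left_frac_int \<sigma> w x =
     1 / Gamma \<sigma> * (LINT s:{0<..<x}|lebesgue. w s * (x - s) powr (\<sigma> - 1))"

definition right_frac_int :: "real \<Rightarrow> (real \<Rightarrow> real) \<Rightarrow> real \<Rightarrow> real" where
  "right_frac_int \<sigma> w x =
     1 / Gamma \<sigma> * (LINT s:{x<..<1}|lebesgue. w s * (s - x) powr (\<sigma> - 1))"

definition frac_op :: "real \<Rightarrow> real \<Rightarrow> (real \<Rightarrow> real) \<Rightarrow> real \<Rightarrow> real" where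
  "frac_op \<alpha> r u x =
     - (r * left_frac_int (2 - \<alpha>) (deriv u) x + (1 - r) * right_frac_int (2 - \<alpha>) (deriv u) x)"

text \<open>The explicit formula in Szego, Orthogonal Polynomials, (4.3.2), normalised by
  \<open>P\<^sub>n(1) = (n + a gchoose n)\<close>.\<close>
definition jacobi_poly :: "nat \<Rightarrow> real \<Rightarrow> real \<Rightarrow> real \<Rightarrow> real" where
  "jacobi_poly n a b t =
     (\<Sum>m\<le>n. ((real n + a) gchoose m) * ((real n + b) gchoose (n - m)) *
            ((t - 1) / 2) ^ (n - m) * ((t + 1) / 2) ^ m)"

definition jacobi_G :: "nat \<Rightarrow> real \<Rightarrow> real \<Rightarrow> real \<Rightarrow> real" where
  "jacobi_G n a b x = jacobi_poly n a b (2 * x - 1)"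

definition jacobi_trunc ::
  "real \<Rightarrow> real \<Rightarrow> (nat \<Rightarrow> real) \<Rightarrow> nat \<Rightarrow> real \<Rightarrow> real" where
  "jacobi_trunc \<alpha> \<beta> c N x =
     jac_weight (\<alpha> - \<beta>) \<beta> x * (\<Sum>j\<le>N. c j * jacobi_G j (\<alpha> - \<beta>) \<beta> x)"

text \<open>\<open>(u, A)\<close> solves \<open>L u = f\<^sub>1 - A f\<^sub>2\<close>, \<open>u(0) = u(1) = 0\<close>. The constant \<open>A\<close> is an unknown: its
  defining expression \<open>K(0) [(r I + (1 - r) I\<^sup>*) D u](0)\<close> is formal (neither factor need exist)
  and is what the equation gives when multiplied by \<open>K\<close> and evaluated at 0. \<open>L u\<close> is the
  weighted limit of \<open>L u\<^sub>N\<close>, hence a class modulo null sets; the boundary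
  conditions are those of the truncations.\<close>
definition is_solution ::
  "real \<Rightarrow> real \<Rightarrow> real \<Rightarrow> (real \<Rightarrow> real) \<Rightarrow> (real \<Rightarrow> real) \<Rightarrow> (real \<Rightarrow> real) \<Rightarrow> real \<Rightarrow> bool"
where
  "is_solution \<alpha> r \<beta> f\<^sub>1 f\<^sub>2 u A \<longleftrightarrow>
     (\<exists>c. wL2_tendsto (jac_weight (- (\<alpha> - \<beta>)) (- \<beta>)) (jacobi_trunc \<alpha> \<beta> c) u \<and>
          (\<forall>N. jacobi_trunc \<alpha> \<beta> c N 0 = 0 \<and> jacobi_trunc \<alpha> \<beta> c N 1 = 0) \<and>
          wL2_tendsto (jac_weight (\<beta> - 1) (\<alpha> - \<beta> - 1))
            (\<lambda>N. frac_op \<alpha> r (jacobi_trunc \<alpha> \<beta> c N))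
            (\<lambda>x. f\<^sub>1 x - A * f\<^sub>2 x))"

text \<open>If \<open>f\<close> is not integrable near 0 (possible for \<open>f\<close> in the weighted space only when
  \<open>\<alpha> - \<beta> = 1\<close>, i.e. \<open>r = 1\<close>), the inner integral takes the default value 0.\<close>
definition rhs1 :: "(real \<Rightarrow> real) \<Rightarrow> (real \<Rightarrow> real) \<Rightarrow> real \<Rightarrow> real" where
  "rhs1 K f x = 1 / K x * (LINT y:{0<..<x}|lebesgue. f y)"

definition rhs2 :: "(real \<Rightarrow> real) \<Rightarrow> real \<Rightarrow> real" where
  "rhs2 K x = 1 / K x"

end

theory Submission
  imports Defs "HOL-Computational_Algebra.Polynomial"
begin

text \<open>
  Put \<open>a = \<alpha> - \<beta>\<close>, \<open>b = \<beta>\<close> and \<open>c = 2 - \<alpha>\<close>. If \<open>u = \<omega>\<^bsup>(a,b)\<^esup> p\<close> with a polynomial \<open>p\<close>, then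
  \<open>u' = \<omega>\<^bsup>(a-1,b-1)\<^esup> q\<close> with a polynomial \<open>q\<close> of one degree more, and \<open>L u\<close> is \<open>- T q / \<Gamma>(c)\<close>, where
  \<open>T q\<close> integrates \<open>\<omega>\<^bsup>(a-1,b-1)\<^esup> q\<close> against \<open>r |x - s|\<^bsup>c-1\<^esup>\<close> on the left of \<open>x\<close> and
  \<open>(1 - r) |x - s|\<^bsup>c-1\<^esup>\<close> on the right. The proof shows that \<open>L\<close> is diagonal between two orthogonal
  systems, with eigenvalues bounded away from 0.

  \<^item> \<open>T\<close> maps polynomials of degree \<open>n\<close> to polynomials of degree \<open>n\<close> (\<open>T_poly\<close>). The key is that
    \<open>T 1\<close> is constant: the left and right contributions have derivatives proportional to
    \<open>x\<^bsup>-a\<^esup> (1 - x)\<^bsup>-b\<^esup>\<close>, and the relation between \<open>r\<close> and \<open>\<beta>\<close> is, by the reflection formula for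
    \<open>\<Gamma>\<close>, exactly the one under which they cancel (\<open>T_one_const\<close>). Higher powers follow from a
    three-term recurrence, which also gives the leading coefficients.

  \<^item> The adjoint of \<open>T\<close> is the operator of the same kind with \<open>a\<close>, \<open>b\<close> and \<open>r\<close>, \<open>1 - r\<close> exchanged
    (\<open>T_duality\<close>). Integrating by parts, the scalar product of \<open>L (\<omega>\<^bsup>(a,b)\<^esup> G\<^sub>n)\<close> with a polynomial in the
    space with weight \<open>\<omega>\<^bsup>(b-1,a-1)\<^esup>\<close> is a scalar product of \<open>G\<^sub>n\<close> with a polynomial of smaller degree. Hence
    the images of the \<open>\<omega>\<^bsup>(a,b)\<^esup> G\<^sub>n\<close> are polynomials of degree \<open>n + 1\<close> orthogonal to all lower degrees,
    and the ratio of the norms, read off from leading coefficients, is bounded below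
    (\<open>image_orthogonal\<close>, \<open>image_norm_ge\<close>).

  \<^item> Together with the constant 1 these images form a complete orthogonal system. So \<open>L u = h\<close> is
    solvable exactly when \<open>h\<close> has weighted mean 0, then uniquely and with
    \<open>\<parallel>u\<parallel> \<le> \<delta>\<^bsup>-1/2\<^esup> \<parallel>h\<parallel>\<close> (\<open>solves_exists\<close>, \<open>solves_coeff\<close>, \<open>solves_unique\<close>). The mean-value condition
    determines \<open>A\<close>.

  \<^item> It remains to bound \<open>h = (g - A) / K\<close> with \<open>g\<close> the primitive of \<open>f\<close>. The primitive itself is
    not controlled by \<open>f\<close> when \<open>r = 1\<close>, where \<open>f\<close> may fail to be integrable at 0; but \<open>g\<close> is controlled up
    to an additive constant (\<open>primitive_estimate\<close>), and since \<open>A\<close> is the mean of \<open>g\<close> for the weight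
    \<open>\<omega>\<^bsup>(b-1,a-1)\<^esup> / K\<close>, that constant is irrelevant (\<open>weighted_mean_decomposition\<close>).
\<close>

section \<open>Square-integrable functions\<close>

definition square_integrable :: "'a measure \<Rightarrow> ('a \<Rightarrow> real) \<Rightarrow> bool" where
  "square_integrable M f \<longleftrightarrow> f \<in> borel_measurable M \<and> integrable M (\<lambda>x. (f x)\<^sup>2)"

lemma square_integrable_mult:
  assumes "square_integrable M f" "square_integrable M g"
  shows "integrable M (\<lambda>x. f x * g x)"
proof (rule Bochner_Integration.integrable_bound)
  show "integrable M (\<lambda>x. (f x)\<^sup>2 + (g x)\<^sup>2)"
    using assms by (simp add: square_integrable_def)
  show "(\<lambda>x. f x * g x) \<in> borel_measurable M"
    using assms by (auto simp: square_integrable_def)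
  have "\<bar>p * q\<bar> \<le> p\<^sup>2 + q\<^sup>2" for p q :: real
  proof -
    have "2 * \<bar>p\<bar> * \<bar>q\<bar> \<le> p\<^sup>2 + q\<^sup>2"
      using sum_squares_bound[of "\<bar>p\<bar>" "\<bar>q\<bar>"] by simp
    moreover have "0 \<le> \<bar>p\<bar> * \<bar>q\<bar>" by simp
    ultimately show ?thesis unfolding abs_mult by linarith
  qed
  then show "AE x in M. norm (f x * g x) \<le> norm ((f x)\<^sup>2 + (g x)\<^sup>2)"
    by simp
qed

lemma square_integrable_add:
  assumes "square_integrable M f" "square_integrable M g"
  shows "square_integrable M (\<lambda>x. f x + g x)"
  using assms square_integrable_mult[OF assms]
  by (auto simp: square_integrable_def power2_sum mult.assoc)

lemma square_integrable_scale:
  assumes "square_integrable M f"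
  shows "square_integrable M (\<lambda>x. c * f x)"
  using assms by (auto simp: square_integrable_def power_mult_distrib)

lemma square_integrable_diff:
  assumes "square_integrable M f" "square_integrable M g"
  shows "square_integrable M (\<lambda>x. f x - g x)"
  using square_integrable_add[OF assms(1) square_integrable_scale[OF assms(2), of "-1"]] by simp

lemma square_integrable_sum:
  assumes "\<And>i. i \<in> I \<Longrightarrow> square_integrable M (f i)"
  shows "square_integrable M (\<lambda>x. \<Sum>i\<in>I. f i x)"
  using assms
proof (induction I rule: infinite_finite_induct)
  case (insert i I)
  then show ?case by (simp add: square_integrable_add)
qed (simp_all add: square_integrable_def)

lemma Cauchy_Schwarz_integral:
  assumes f: "square_integrable M f" and g: "square_integrable M g"
  shows "(LINT x|M. f x * g x)\<^sup>2 \<le> (LINT x|M. (f x)\<^sup>2) * (LINT x|M. (g x)\<^sup>2)"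
proof -
  define F G P where "F = (LINT x|M. (f x)\<^sup>2)" and "G = (LINT x|M. (g x)\<^sup>2)"
    and "P = (LINT x|M. f x * g x)"
  have if2: "integrable M (\<lambda>x. (f x)\<^sup>2)" and ig2: "integrable M (\<lambda>x. (g x)\<^sup>2)"
    using f g by (auto simp: square_integrable_def)
  have ifg: "integrable M (\<lambda>x. f x * g x)" by (rule square_integrable_mult[OF f g])
  have quad: "0 \<le> s\<^sup>2 * F + 2 * (s * t) * P + t\<^sup>2 * G" for s t
  proof -
    have "0 \<le> (LINT x|M. (s * f x + t * g x)\<^sup>2)" by simp
    also have "(\<lambda>x. (s * f x + t * g x)\<^sup>2) =
        (\<lambda>x. s\<^sup>2 * (f x)\<^sup>2 + 2 * (s * t) * (f x * g x) + t\<^sup>2 * (g x)\<^sup>2)"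
      by (rule ext) (simp add: power2_eq_square algebra_simps)
    also have "(LINT x|M. s\<^sup>2 * (f x)\<^sup>2 + 2 * (s * t) * (f x * g x) + t\<^sup>2 * (g x)\<^sup>2) =
        s\<^sup>2 * F + 2 * (s * t) * P + t\<^sup>2 * G"
      using if2 ig2 ifg by (simp add: F_def G_def P_def)
    finally show ?thesis .
  qed
  have F0: "0 \<le> F" and G0: "0 \<le> G" unfolding F_def G_def by simp_all
  have "P\<^sup>2 \<le> F * G"
  proof (cases "G = 0")
    case True
    have "P = 0"
    proof (rule ccontr)
      assume "P \<noteq> 0"
      have "0 \<le> F + 2 * (- (F + 1) / (2 * P)) * P"
        using quad[of 1 "- (F + 1) / (2 * P)"] True by simp
      then show False using \<open>P \<noteq> 0\<close> F0 by (simp add: field_simps)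
    qed
    then show ?thesis using True by simp
  next
    case False
    then have "0 < G" using G0 by simp
    have "0 \<le> G\<^sup>2 * F + 2 * (G * (- P)) * P + (- P)\<^sup>2 * G" by (rule quad)
    also have "\<dots> = G * (F * G - P\<^sup>2)" by (simp add: power2_eq_square algebra_simps)
    finally show ?thesis using \<open>0 < G\<close> by (simp add: zero_le_mult_iff)
  qed
  then show ?thesis by (simp add: F_def G_def P_def)
qed

text \<open>A triangle inequality for squared norms; all limits below are expressed by squared norms.\<close>
lemma square_norm_sum_le:
  assumes f: "square_integrable M f" and g: "square_integrable M g"
  shows "(LINT x|M. (f x + g x)\<^sup>2) \<le> 2 * (LINT x|M. (f x)\<^sup>2) + 2 * (LINT x|M. (g x)\<^sup>2)"
proof -
  have "(p + q)\<^sup>2 \<le> 2 * p\<^sup>2 + 2 * q\<^sup>2" for p q :: real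
    using sum_squares_bound[of p q] by (simp add: power2_sum)
  then have "(LINT x|M. (f x + g x)\<^sup>2) \<le> (LINT x|M. 2 * (f x)\<^sup>2 + 2 * (g x)\<^sup>2)"
    using f g square_integrable_add[OF f g]
    by (intro integral_mono) (auto simp: square_integrable_def)
  then show ?thesis using f g by (simp add: square_integrable_def)
qed

lemma integral_mult_tendsto:
  assumes S: "\<And>n. square_integrable M (S n)" and u: "square_integrable M u"
    and g: "square_integrable M g"
    and lim: "(\<lambda>n. LINT x|M. (S n x - u x)\<^sup>2) \<longlonglongrightarrow> 0"
  shows "(\<lambda>n. LINT x|M. S n x * g x) \<longlonglongrightarrow> (LINT x|M. u x * g x)"
proof (rule Lim_transform2[OF tendsto_const], rule tendsto_norm_zero_cancel, rule Lim_null_comparison)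
  show "\<forall>\<^sub>F n in sequentially. norm (norm ((LINT x|M. u x * g x) - (LINT x|M. S n x * g x)))
     \<le> sqrt ((LINT x|M. (S n x - u x)\<^sup>2) * (LINT x|M. (g x)\<^sup>2))"
  proof (rule always_eventually, rule allI)
    fix n
    have d: "square_integrable M (\<lambda>x. S n x - u x)" by (rule square_integrable_diff[OF S u])
    have "(LINT x|M. S n x * g x) - (LINT x|M. u x * g x) = (LINT x|M. (S n x - u x) * g x)"
      using square_integrable_mult[OF S g] square_integrable_mult[OF u g]
      by (simp add: left_diff_distrib)
    then have "((LINT x|M. S n x * g x) - (LINT x|M. u x * g x))\<^sup>2
        \<le> (LINT x|M. (S n x - u x)\<^sup>2) * (LINT x|M. (g x)\<^sup>2)"
      using Cauchy_Schwarz_integral[OF d g] by simp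
    then have "\<bar>(LINT x|M. S n x * g x) - (LINT x|M. u x * g x)\<bar>
        \<le> sqrt ((LINT x|M. (S n x - u x)\<^sup>2) * (LINT x|M. (g x)\<^sup>2))"
      by (rule real_le_rsqrt[of "\<bar>_\<bar>", simplified])
    then show "norm (norm ((LINT x|M. u x * g x) - (LINT x|M. S n x * g x)))
     \<le> sqrt ((LINT x|M. (S n x - u x)\<^sup>2) * (LINT x|M. (g x)\<^sup>2))"
      by (simp add: abs_minus_commute)
  qed
  have "(\<lambda>n. sqrt ((LINT x|M. (S n x - u x)\<^sup>2) * (LINT x|M. (g x)\<^sup>2))) \<longlonglongrightarrow>
      sqrt (0 * (LINT x|M. (g x)\<^sup>2))"
    by (intro tendsto_intros lim)
  then show "(\<lambda>n. sqrt ((LINT x|M. (S n x - u x)\<^sup>2) * (LINT x|M. (g x)\<^sup>2))) \<longlonglongrightarrow> 0" by simp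
qed

lemma square_norm_zero_AE:
  assumes u: "square_integrable M u" and "(LINT x|M. (u x)\<^sup>2) \<le> 0"
  shows "AE x in M. u x = 0"
proof -
  have "(LINT x|M. (u x)\<^sup>2) = 0"
    using assms(2) by (simp add: order_antisym)
  then have "AE x in M. (u x)\<^sup>2 = 0"
    using u by (subst (asm) integral_nonneg_eq_0_iff_AE) (auto simp: square_integrable_def)
  then show ?thesis by simp
qed

lemma L2_limit_unique:
  assumes S: "\<And>n. square_integrable M (S n)"
    and u: "square_integrable M u" and v: "square_integrable M v"
    and lu: "(\<lambda>n. LINT x|M. (S n x - u x)\<^sup>2) \<longlonglongrightarrow> 0"
    and lv: "(\<lambda>n. LINT x|M. (S n x - v x)\<^sup>2) \<longlonglongrightarrow> 0"
  shows "AE x in M. v x = u x"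
proof -
  have vu: "square_integrable M (\<lambda>x. v x - u x)" by (rule square_integrable_diff[OF v u])
  have le: "(LINT x|M. (v x - u x)\<^sup>2) \<le>
     2 * (LINT x|M. (S n x - u x)\<^sup>2) + 2 * (LINT x|M. (S n x - v x)\<^sup>2)" for n
    using square_norm_sum_le[OF square_integrable_diff[OF S u] square_integrable_diff[OF v S], of n n]
    by (simp add: power2_commute)
  have "(\<lambda>n. 2 * (LINT x|M. (S n x - u x)\<^sup>2) + 2 * (LINT x|M. (S n x - v x)\<^sup>2)) \<longlonglongrightarrow> 2 * 0 + 2 * 0"
    by (intro tendsto_intros lu lv)
  then have "(LINT x|M. (v x - u x)\<^sup>2) \<le> 2 * 0 + 2 * 0"
    by (rule LIMSEQ_le_const) (use le in auto)
  then have "AE x in M. v x - u x = 0"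
    by (intro square_norm_zero_AE vu) simp
  then show ?thesis by simp
qed

text \<open>Along a subsequence with \<open>\<parallel>S\<^bsub>n(k+1)\<^esub> - S\<^bsub>n(k)\<^esub>\<parallel>\<^sup>2 \<le> 4\<^bsup>-k\<^esup>\<close> the series of \<open>2\<^bsup>k\<^esup> |S\<^bsub>n(k+1)\<^esub> - S\<^bsub>n(k)\<^esub>|\<^sup>2\<close> has
  finite integral, so almost everywhere its terms are bounded and the increments are dominated by
  a geometric series. The pointwise limit is the limit in mean square by Fatou's lemma.\<close>
lemma L2_complete:
  assumes S: "\<And>n. square_integrable M (S n)"
    and Cauchy: "\<And>e. 0 < e \<Longrightarrow> \<exists>N. \<forall>m\<ge>N. \<forall>n\<ge>N. (LINT x|M. (S m x - S n x)\<^sup>2) \<le> e"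
  obtains u where "square_integrable M u" "(\<lambda>n. LINT x|M. (S n x - u x)\<^sup>2) \<longlonglongrightarrow> 0"
proof -
  let ?d = "\<lambda>m n. LINT x|M. (S m x - S n x)\<^sup>2" and ?I = "\<lambda>f. \<integral>\<^sup>+x. ennreal (f x) \<partial>M"
  have meas [measurable]: "S n \<in> borel_measurable M" for n
    using S by (simp add: square_integrable_def)
  have int2: "integrable M (\<lambda>x. (S m x - S n x)\<^sup>2)" for m n
    using square_integrable_diff[OF S S] by (simp add: square_integrable_def)
  obtain N where N: "\<And>k m n. N k \<le> m \<Longrightarrow> N k \<le> n \<Longrightarrow> ?d m n \<le> (1/4) ^ k"
  proof -
    have "\<forall>k. \<exists>N. \<forall>m\<ge>N. \<forall>n\<ge>N. ?d m n \<le> (1/4::real) ^ k"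
      by (intro allI Cauchy) simp
    then show thesis using that by metis
  qed
  \<comment> \<open>summing the thresholds makes \<open>n l\<close> exceed \<open>N k\<close> for every \<open>k \<le> l\<close>, whether or not \<open>N\<close> is monotone\<close>
  define n where "n k = (\<Sum>i\<le>k. N i)" for k
  have nN: "N k \<le> n l" if "k \<le> l" for k l
  proof -
    have "N k \<le> (\<Sum>i\<le>l. N i)" using that by (intro member_le_sum) auto
    then show ?thesis by (simp add: n_def)
  qed
  define g where "g k x = \<bar>S (n (Suc k)) x - S (n k) x\<bar>" for k x
  have gm [measurable]: "g k \<in> borel_measurable M" for k unfolding g_def by measurable
  have g2: "?I (\<lambda>x. 2 ^ k * (g k x)\<^sup>2) \<le> ennreal ((1/2) ^ k)" for k
  proof -
    have "(LINT x|M. (g k x)\<^sup>2) \<le> (1/4) ^ k"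
      unfolding g_def power2_abs by (rule N) (simp_all add: nN)
    then have "(LINT x|M. 2 ^ k * (g k x)\<^sup>2) \<le> 2 ^ k * (1/4) ^ k" by simp
    also have "\<dots> = (1/2::real) ^ k" by (simp flip: power_mult_distrib)
    finally have "(LINT x|M. 2 ^ k * (g k x)\<^sup>2) \<le> (1/2) ^ k" .
    moreover have "?I (\<lambda>x. 2 ^ k * (g k x)\<^sup>2) = ennreal (LINT x|M. 2 ^ k * (g k x)\<^sup>2)"
      by (rule nn_integral_eq_integral) (auto simp: g_def int2)
    ultimately show ?thesis by (simp add: ennreal_leI)
  qed
  have "(\<integral>\<^sup>+x. (\<Sum>k. ennreal (2 ^ k * (g k x)\<^sup>2)) \<partial>M) = (\<Sum>k. \<integral>\<^sup>+x. ennreal (2 ^ k * (g k x)\<^sup>2) \<partial>M)"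
    by (rule nn_integral_suminf) measurable
  also have "\<dots> \<le> (\<Sum>k. ennreal ((1/2) ^ k))"
    by (intro suminf_le g2) auto
  also have "\<dots> = ennreal (\<Sum>k. (1/2) ^ k)"
    by (rule suminf_ennreal2) (auto intro: summable_geometric)
  finally have fin: "(\<integral>\<^sup>+x. (\<Sum>k. ennreal (2 ^ k * (g k x)\<^sup>2)) \<partial>M) < \<infinity>"
    by (rule order_le_less_trans) simp
  have ae: "AE x in M. (\<Sum>k. ennreal (2 ^ k * (g k x)\<^sup>2)) \<noteq> \<infinity>"
    by (rule nn_integral_PInf_AE) (use fin in auto)
  define u where "u x = lim (\<lambda>k. S (n k) x)" for x
  have um [measurable]: "u \<in> borel_measurable M"
    unfolding u_def by (rule borel_measurable_lim_metric) measurable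
  have conv: "AE x in M. (\<lambda>k. S (n k) x) \<longlonglongrightarrow> u x"
    using ae
  proof eventually_elim
    case (elim x)
    have "summable (\<lambda>k. 2 ^ k * (g k x)\<^sup>2)"
      by (rule summable_suminf_not_top) (use elim in auto)
    then obtain C where C: "\<And>k. 2 ^ k * (g k x)\<^sup>2 \<le> C"
    proof -
      assume *: "\<And>C. (\<And>k. 2 ^ k * (g k x)\<^sup>2 \<le> C) \<Longrightarrow> thesis" and "summable (\<lambda>k. 2 ^ k * (g k x)\<^sup>2)"
      then have "Bseq (\<lambda>k. 2 ^ k * (g k x)\<^sup>2)"
        using summable_LIMSEQ_zero convergentI convergent_imp_Bseq by blast
      then obtain B where "\<And>k. norm (2 ^ k * (g k x)\<^sup>2) \<le> B" unfolding Bseq_def by blast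
      then show thesis by (intro *[of B]) (simp add: abs_mult)
    qed
    have C0: "0 \<le> C" using C[of 0] by (rule order_trans[rotated]) simp
    have gb: "g k x \<le> sqrt C * (1 / sqrt 2) ^ k" for k
    proof (rule power2_le_imp_le)
      have "(g k x)\<^sup>2 \<le> C * (1/2) ^ k" using C[of k] by (simp add: field_simps)
      also have "\<dots> = (sqrt C * (1 / sqrt 2) ^ k)\<^sup>2"
        using C0 by (simp add: power_mult_distrib power_divide real_sqrt_power[symmetric] flip: power_mult)
          (simp add: power_mult mult.commute)
      finally show "(g k x)\<^sup>2 \<le> (sqrt C * (1 / sqrt 2) ^ k)\<^sup>2" .
    qed (simp add: C0)
    have "summable (\<lambda>k. sqrt C * (1 / sqrt 2) ^ k)"
      by (intro summable_mult summable_geometric) simp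
    then have "summable (\<lambda>k. S (n (Suc k)) x - S (n k) x)"
      by (rule summable_comparison_test') (use gb in \<open>simp add: g_def\<close>)
    then have "convergent (\<lambda>m. \<Sum>k<m. S (n (Suc k)) x - S (n k) x)"
      by (simp add: summable_iff_convergent)
    moreover have "(\<Sum>k<m. S (n (Suc k)) x - S (n k) x) = S (n m) x - S (n 0) x" for m
      by (rule sum_lessThan_telescope)
    ultimately have "convergent (\<lambda>m. S (n m) x - S (n 0) x)"
      by simp
    then have "convergent (\<lambda>m. S (n m) x)"
      by (simp add: convergent_diff_const_right_iff)
    then show ?case unfolding u_def by (simp add: convergent_LIMSEQ_iff)
  qed
  have fatou: "?I (\<lambda>x. (S m x - u x)\<^sup>2) \<le> ennreal ((1/4) ^ k)" if "N k \<le> m" for m k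
  proof -
    have "?I (\<lambda>x. (S m x - u x)\<^sup>2)
        = (\<integral>\<^sup>+x. liminf (\<lambda>l. ennreal ((S m x - S (n l) x)\<^sup>2)) \<partial>M)"
    proof (rule nn_integral_cong_AE)
      show "AE x in M. ennreal ((S m x - u x)\<^sup>2) = liminf (\<lambda>l. ennreal ((S m x - S (n l) x)\<^sup>2))"
        using conv
      proof eventually_elim
        case (elim x)
        have "(\<lambda>l. ennreal ((S m x - S (n l) x)\<^sup>2)) \<longlonglongrightarrow> ennreal ((S m x - u x)\<^sup>2)"
          by (intro tendsto_intros elim)
        then show ?case by (rule lim_imp_Liminf[OF sequentially_bot, symmetric])
      qed
    qed
    also have "\<dots> \<le> liminf (\<lambda>l. \<integral>\<^sup>+x. ennreal ((S m x - S (n l) x)\<^sup>2) \<partial>M)"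
      by (rule nn_integral_liminf) measurable
    also have "\<dots> \<le> liminf (\<lambda>l::nat. ennreal ((1/4) ^ k))"
    proof (rule Liminf_mono)
      show "\<forall>\<^sub>F l in sequentially. ?I (\<lambda>x. (S m x - S (n l) x)\<^sup>2) \<le> ennreal ((1/4) ^ k)"
        using eventually_ge_at_top[of k]
      proof eventually_elim
        case (elim l)
        have "?d m (n l) \<le> (1/4) ^ k"
          by (rule N) (use that nN elim in auto)
        then show ?case by (simp add: nn_integral_eq_integral int2 ennreal_leI)
      qed
    qed
    also have "\<dots> = ennreal ((1/4) ^ k)" by (simp add: Liminf_const)
    finally show ?thesis .
  qed
  have diff2: "square_integrable M (\<lambda>x. S (N 0) x - u x)"
    unfolding square_integrable_def
  proof
    show "integrable M (\<lambda>x. (S (N 0) x - u x)\<^sup>2)"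
    proof (rule integrableI_bounded)
      show "(\<integral>\<^sup>+ x. ennreal (norm ((S (N 0) x - u x)\<^sup>2)) \<partial>M) < \<infinity>"
        using fatou[of 0 "N 0"] by (auto intro: order_le_less_trans)
    qed measurable
  qed measurable
  have u2: "square_integrable M u"
    using square_integrable_diff[OF S[of "N 0"] diff2] by simp
  have bound: "(LINT x|M. (S m x - u x)\<^sup>2) \<le> (1/4) ^ k" if "N k \<le> m" for m k
  proof -
    have i: "integrable M (\<lambda>x. (S m x - u x)\<^sup>2)"
      using square_integrable_diff[OF S u2] by (simp add: square_integrable_def)
    show ?thesis using fatou[OF that] by (simp add: nn_integral_eq_integral[OF i])
  qed
  have "(\<lambda>n. LINT x|M. (S n x - u x)\<^sup>2) \<longlonglongrightarrow> 0"
  proof (rule LIMSEQ_I)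
    fix e :: real assume "0 < e"
    then obtain k where k: "(1/4::real) ^ k < e"
      using real_arch_pow_inv[of e "1/4"] by auto
    show "\<exists>no. \<forall>n\<ge>no. norm ((LINT x|M. (S n x - u x)\<^sup>2) - 0) < e"
    proof (intro exI allI impI)
      fix m assume "N k \<le> m"
      then show "norm ((LINT x|M. (S m x - u x)\<^sup>2) - 0) < e" using bound k by fastforce
    qed
  qed
  with u2 show thesis by (rule that)
qed

section \<open>Orthogonal expansions\<close>

lemma orthogonal_sum_square_norm:
  assumes E: "\<And>k. square_integrable M (E k)"
    and orth: "\<And>j k. j \<noteq> k \<Longrightarrow> (LINT x|M. E j x * E k x) = 0"
    and "finite I"
  shows "(LINT x|M. (\<Sum>k\<in>I. c k * E k x)\<^sup>2) = (\<Sum>k\<in>I. (c k)\<^sup>2 * (LINT x|M. (E k x)\<^sup>2))"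
  using \<open>finite I\<close>
proof (induction I rule: finite_induct)
  case (insert i I)
  let ?S = "\<lambda>x. \<Sum>k\<in>I. c k * E k x"
  have S: "square_integrable M ?S"
    by (intro square_integrable_sum square_integrable_scale E)
  have int: "integrable M (\<lambda>x. E i x * E k x)" for i k
    by (rule square_integrable_mult[OF E E])
  have "(LINT x|M. E i x * ?S x) = (LINT x|M. (\<Sum>k\<in>I. c k * (E i x * E k x)))"
    by (simp add: sum_distrib_left mult.left_commute)
  also have "\<dots> = (\<Sum>k\<in>I. c k * (LINT x|M. E i x * E k x))"
    using int by simp
  also have "\<dots> = 0"
  proof (intro sum.neutral ballI)
    fix k assume "k \<in> I"
    then have "i \<noteq> k" using insert.hyps by blast
    then show "c k * (LINT x|M. E i x * E k x) = 0" by (simp add: orth)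
  qed
  finally have cross: "(LINT x|M. E i x * ?S x) = 0" .
  have "(\<lambda>x. (\<Sum>k\<in>insert i I. c k * E k x)\<^sup>2)
      = (\<lambda>x. (c i)\<^sup>2 * (E i x)\<^sup>2 + 2 * c i * (E i x * ?S x) + (?S x)\<^sup>2)"
    using insert.hyps by (simp add: fun_eq_iff power2_sum power_mult_distrib algebra_simps)
  then have "(LINT x|M. (\<Sum>k\<in>insert i I. c k * E k x)\<^sup>2)
      = (LINT x|M. (c i)\<^sup>2 * (E i x)\<^sup>2 + 2 * c i * (E i x * ?S x) + (?S x)\<^sup>2)" by simp
  also have "\<dots> = (c i)\<^sup>2 * (LINT x|M. (E i x)\<^sup>2) + 2 * c i * (LINT x|M. E i x * ?S x) + (LINT x|M. (?S x)\<^sup>2)"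
    using S E square_integrable_mult[OF E S] by (simp add: square_integrable_def)
  finally show ?case using insert cross by simp
qed simp

lemma orthogonal_sum_inner:
  assumes E: "\<And>k. square_integrable M (E k)"
    and orth: "\<And>j k. j \<noteq> k \<Longrightarrow> (LINT x|M. E j x * E k x) = 0"
    and "finite I"
  shows "(LINT x|M. (\<Sum>k\<in>I. c k * E k x) * E j x) = (if j \<in> I then c j * (LINT x|M. (E j x)\<^sup>2) else 0)"
proof -
  have int: "integrable M (\<lambda>x. E i x * E k x)" for i k
    by (rule square_integrable_mult[OF E E])
  have "(LINT x|M. (\<Sum>k\<in>I. c k * E k x) * E j x) = (LINT x|M. (\<Sum>k\<in>I. c k * (E k x * E j x)))"
    by (simp add: sum_distrib_right mult.assoc)
  also have "\<dots> = (\<Sum>k\<in>I. c k * (LINT x|M. E k x * E j x))"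
    using int by simp
  also have "\<dots> = (\<Sum>k\<in>I. if k = j then c j * (LINT x|M. (E j x)\<^sup>2) else 0)"
    by (intro sum.cong) (auto simp: orth power2_eq_square)
  finally show ?thesis using \<open>finite I\<close> by (simp add: sum.delta)
qed

theorem Riesz_Fischer:
  assumes E: "\<And>k. square_integrable M (E k)"
    and orth: "\<And>j k. j \<noteq> k \<Longrightarrow> (LINT x|M. E j x * E k x) = 0"
    and summ: "summable (\<lambda>k. (c k)\<^sup>2 * (LINT x|M. (E k x)\<^sup>2))"
  obtains u where "square_integrable M u"
    "(\<lambda>n. LINT x|M. ((\<Sum>k\<le>n. c k * E k x) - u x)\<^sup>2) \<longlonglongrightarrow> 0"
    "(LINT x|M. (u x)\<^sup>2) = (\<Sum>k. (c k)\<^sup>2 * (LINT x|M. (E k x)\<^sup>2))"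
    "\<And>j. (LINT x|M. u x * E j x) = c j * (LINT x|M. (E j x)\<^sup>2)"
proof -
  define S where "S n x = (\<Sum>k\<le>n. c k * E k x)" for n x
  define a where "a k = (c k)\<^sup>2 * (LINT x|M. (E k x)\<^sup>2)" for k
  have S: "square_integrable M (S n)" for n
    unfolding S_def by (intro square_integrable_sum square_integrable_scale E)
  have sa: "summable a" using summ by (simp add: a_def[abs_def])
  have a0: "0 \<le> a k" for k by (simp add: a_def)
  have S2: "(LINT x|M. (S n x)\<^sup>2) = (\<Sum>k\<le>n. a k)" for n
    unfolding S_def a_def by (rule orthogonal_sum_square_norm[OF E orth]) auto
  have diff: "(LINT x|M. (S m x - S n x)\<^sup>2) = (\<Sum>k\<in>{n<..m}. a k)" if "n \<le> m" for m n
  proof -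
    have "S m x - S n x = (\<Sum>k\<in>{n<..m}. c k * E k x)" for x
    proof -
      have "{..m} = {..n} \<union> {n<..m}" using that by auto
      then have "S m x = S n x + (\<Sum>k\<in>{n<..m}. c k * E k x)"
        unfolding S_def by (simp add: sum.union_disjoint ivl_disj_int)
      then show ?thesis by simp
    qed
    then show ?thesis
      unfolding a_def by (simp add: orthogonal_sum_square_norm[OF E orth])
  qed
  have cauchy: "\<exists>N. \<forall>m\<ge>N. \<forall>n\<ge>N. (LINT x|M. (S m x - S n x)\<^sup>2) \<le> e" if e: "0 < e" for e
  proof -
    obtain N where N: "\<And>m n. m \<ge> N \<Longrightarrow> norm (sum a {m..<n}) < e"
      using sa e unfolding summable_Cauchy by meson
    have le: "(LINT x|M. (S m x - S n x)\<^sup>2) \<le> e" if "n \<le> m" "N \<le> n" for m n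
    proof -
      have "{n<..m} = {Suc n..<Suc m}" by auto
      then show ?thesis using N[of "Suc n" "Suc m"] that by (simp add: diff)
    qed
    show ?thesis
    proof (intro exI allI impI)
      fix m n assume "N \<le> m" "N \<le> n"
      then show "(LINT x|M. (S m x - S n x)\<^sup>2) \<le> e"
        using le[of n m] le[of m n] by (cases "n \<le> m") (simp_all add: power2_commute)
    qed
  qed
  obtain u where u: "square_integrable M u" and lim: "(\<lambda>n. LINT x|M. (S n x - u x)\<^sup>2) \<longlonglongrightarrow> 0"
    using L2_complete[OF S cauchy] by blast
  have coeff: "(LINT x|M. u x * E j x) = c j * (LINT x|M. (E j x)\<^sup>2)" for j
  proof -
    have "(\<lambda>n. LINT x|M. S n x * E j x) \<longlonglongrightarrow> (LINT x|M. u x * E j x)"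
      by (rule integral_mult_tendsto[OF S u E lim])
    moreover have "(\<lambda>n. LINT x|M. S n x * E j x) \<longlonglongrightarrow> c j * (LINT x|M. (E j x)\<^sup>2)"
    proof (rule tendsto_eventually)
      show "\<forall>\<^sub>F n in sequentially. (LINT x|M. S n x * E j x) = c j * (LINT x|M. (E j x)\<^sup>2)"
        using eventually_ge_at_top[of j]
        unfolding S_def
        by eventually_elim (subst orthogonal_sum_inner[OF E orth], auto)
    qed
    ultimately show ?thesis by (rule LIMSEQ_unique)
  qed
  have uS: "(LINT x|M. u x * S n x) = (\<Sum>k\<le>n. a k)" for n
  proof -
    have "(LINT x|M. u x * S n x) = (LINT x|M. (\<Sum>k\<le>n. c k * (u x * E k x)))"
      unfolding S_def by (simp add: sum_distrib_left mult.left_commute)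
    also have "\<dots> = (\<Sum>k\<le>n. c k * (LINT x|M. u x * E k x))"
      using square_integrable_mult[OF u E] by simp
    finally show ?thesis by (simp add: coeff a_def power2_eq_square mult.assoc)
  qed
  have pyth: "(LINT x|M. (S n x - u x)\<^sup>2) = (LINT x|M. (u x)\<^sup>2) - (\<Sum>k\<le>n. a k)" for n
  proof -
    have "(LINT x|M. (S n x - u x)\<^sup>2) = (LINT x|M. (S n x)\<^sup>2 - 2 * (u x * S n x) + (u x)\<^sup>2)"
      by (simp add: power2_diff algebra_simps)
    also have "\<dots> = (LINT x|M. (S n x)\<^sup>2) - 2 * (LINT x|M. u x * S n x) + (LINT x|M. (u x)\<^sup>2)"
      using S u square_integrable_mult[OF u S] by (simp add: square_integrable_def)
    finally show ?thesis by (simp add: S2 uS)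
  qed
  have "(\<lambda>n. (LINT x|M. (u x)\<^sup>2) - (LINT x|M. (S n x - u x)\<^sup>2)) \<longlonglongrightarrow> (LINT x|M. (u x)\<^sup>2) - 0"
    by (intro tendsto_intros lim)
  then have "(\<lambda>n. \<Sum>k\<le>n. a k) \<longlonglongrightarrow> (LINT x|M. (u x)\<^sup>2)"
    by (simp add: pyth)
  moreover have "(\<lambda>n. \<Sum>k\<le>n. a k) \<longlonglongrightarrow> (\<Sum>k. a k)"
    using sa by (rule summable_LIMSEQ')
  ultimately have "(LINT x|M. (u x)\<^sup>2) = (\<Sum>k. a k)" by (rule LIMSEQ_unique)
  with u lim coeff show thesis by (intro that[of u]) (simp_all add: S_def a_def)
qed

text \<open>Bessel's inequality makes the Fourier coefficients square summable, so the expansion converges to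
  some \<open>u\<close>; then \<open>h - u\<close> is orthogonal to the whole system, and totality gives \<open>h = u\<close>.\<close>
theorem orthogonal_expansion:
  assumes E: "\<And>k. square_integrable M (E k)"
    and orth: "\<And>j k. j \<noteq> k \<Longrightarrow> (LINT x|M. E j x * E k x) = 0"
    and pos: "\<And>k. 0 < (LINT x|M. (E k x)\<^sup>2)"
    and total: "\<And>g. square_integrable M g \<Longrightarrow> (\<And>k. (LINT x|M. g x * E k x) = 0) \<Longrightarrow> AE x in M. g x = 0"
    and h: "square_integrable M h"
  defines "c \<equiv> \<lambda>k. (LINT x|M. h x * E k x) / (LINT x|M. (E k x)\<^sup>2)"
  shows "(\<lambda>n. LINT x|M. ((\<Sum>k\<le>n. c k * E k x) - h x)\<^sup>2) \<longlonglongrightarrow> 0"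
    and "(\<lambda>k. (c k)\<^sup>2 * (LINT x|M. (E k x)\<^sup>2)) sums (LINT x|M. (h x)\<^sup>2)"
proof -
  define S where "S n x = (\<Sum>k\<le>n. c k * E k x)" for n x
  define a where "a k = (c k)\<^sup>2 * (LINT x|M. (E k x)\<^sup>2)" for k
  have S: "square_integrable M (S n)" for n
    unfolding S_def by (intro square_integrable_sum square_integrable_scale E)
  have a0: "0 \<le> a k" for k by (simp add: a_def)
  have hE: "(LINT x|M. h x * E k x) = c k * (LINT x|M. (E k x)\<^sup>2)" for k
    using pos[of k] by (simp add: c_def)
  have S2: "(LINT x|M. (S n x)\<^sup>2) = (\<Sum>k\<le>n. a k)" for n
    unfolding S_def a_def by (rule orthogonal_sum_square_norm[OF E orth]) auto
  have hS: "(LINT x|M. h x * S n x) = (\<Sum>k\<le>n. a k)" for n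
  proof -
    have "(LINT x|M. h x * S n x) = (LINT x|M. (\<Sum>k\<le>n. c k * (h x * E k x)))"
      unfolding S_def by (simp add: sum_distrib_left mult.left_commute)
    also have "\<dots> = (\<Sum>k\<le>n. c k * (LINT x|M. h x * E k x))"
      using square_integrable_mult[OF h E] by simp
    finally show ?thesis by (simp add: hE a_def power2_eq_square mult.assoc)
  qed
  have bessel: "(\<Sum>k\<le>n. a k) \<le> (LINT x|M. (h x)\<^sup>2)" for n
  proof -
    have "0 \<le> (LINT x|M. (S n x - h x)\<^sup>2)" by simp
    also have "\<dots> = (LINT x|M. (S n x)\<^sup>2 - 2 * (h x * S n x) + (h x)\<^sup>2)"
      by (simp add: power2_diff algebra_simps)
    also have "\<dots> = (LINT x|M. (S n x)\<^sup>2) - 2 * (LINT x|M. h x * S n x) + (LINT x|M. (h x)\<^sup>2)"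
      using S h square_integrable_mult[OF h S] by (simp add: square_integrable_def)
    finally show ?thesis by (simp add: S2 hS)
  qed
  have sa: "summable a"
  proof (rule summableI_nonneg_bounded)
    fix n show "sum a {..<n} \<le> (LINT x|M. (h x)\<^sup>2)"
      by (rule order_trans[OF _ bessel[of n]]) (auto intro!: sum_mono2 a0)
  qed (rule a0)
  obtain u where u: "square_integrable M u"
    and lim: "(\<lambda>n. LINT x|M. ((\<Sum>k\<le>n. c k * E k x) - u x)\<^sup>2) \<longlonglongrightarrow> 0"
    and u2: "(LINT x|M. (u x)\<^sup>2) = (\<Sum>k. (c k)\<^sup>2 * (LINT x|M. (E k x)\<^sup>2))"
    and uE: "\<And>j. (LINT x|M. u x * E j x) = c j * (LINT x|M. (E j x)\<^sup>2)"
    by (rule Riesz_Fischer[OF E orth sa[unfolded a_def[abs_def]]]) blast+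
  have "(LINT x|M. (h x - u x) * E k x) = 0" for k
    using square_integrable_mult[OF h E] square_integrable_mult[OF u E]
    by (simp add: left_diff_distrib uE hE)
  then have ae: "AE x in M. h x - u x = 0"
    by (intro total square_integrable_diff h u)
  have hm: "h \<in> borel_measurable M" and um: "u \<in> borel_measurable M"
    and Em: "\<And>k. E k \<in> borel_measurable M"
    using h u E by (auto simp: square_integrable_def)
  have "(LINT x|M. ((\<Sum>k\<le>n. c k * E k x) - h x)\<^sup>2) = (LINT x|M. ((\<Sum>k\<le>n. c k * E k x) - u x)\<^sup>2)" for n
    by (rule integral_cong_AE) (use ae in \<open>auto intro!: borel_measurable_sum borel_measurable_times borel_measurable_diff borel_measurable_power hm um Em\<close>)
  with lim show "(\<lambda>n. LINT x|M. ((\<Sum>k\<le>n. c k * E k x) - h x)\<^sup>2) \<longlonglongrightarrow> 0" by simp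
  have "(LINT x|M. (h x)\<^sup>2) = (LINT x|M. (u x)\<^sup>2)"
    by (rule integral_cong_AE) (use ae hm um in auto)
  then show "(\<lambda>k. (c k)\<^sup>2 * (LINT x|M. (E k x)\<^sup>2)) sums (LINT x|M. (h x)\<^sup>2)"
    using sa u2 by (simp add: a_def[abs_def] summable_sums)
qed

section \<open>One-sided fractional moments of a Jacobi weight\<close>

lemma has_integral_scaled_Beta:
  fixes p c x :: real
  assumes "0 < x" "0 < p" "0 < c"
  shows "((\<lambda>s. s powr (p - 1) * (x - s) powr (c - 1)) has_integral x powr (p + c - 1) * Beta p c) {0..x}"
proof -
  have "((\<lambda>t. t powr (p - 1) * (1 - t) powr (c - 1)) has_integral Beta p c) {0..1}"
    by (rule has_integral_Beta_real) (use assms in auto)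
  from has_integral_stretch_real[OF this, of "1/x"]
  have "((\<lambda>s. (s/x) powr (p - 1) * (1 - s/x) powr (c - 1)) has_integral x * Beta p c) ((\<lambda>s. s * x) ` {0..1})"
    using assms by simp
  also have "(\<lambda>s. s * x) ` {0..1} = {0..x}"
    using assms by (subst image_mult_atLeastAtMost_if') auto
  finally have "((\<lambda>s. x powr (p + c - 2) * ((s/x) powr (p - 1) * (1 - s/x) powr (c - 1)))
      has_integral x powr (p + c - 2) * (x * Beta p c)) {0..x}"
    by (rule has_integral_mult_right)
  moreover have "x powr (p + c - 2) * (x * Beta p c) = x powr (p + c - 1) * Beta p c"
  proof -
    have "x * x powr (p + c - 2) = x powr (1 + (p + c - 2))"
      using assms by (intro powr_mult_base) simp
    then show ?thesis by (simp add: algebra_simps)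
  qed
  moreover have "x powr (p + c - 2) * ((s/x) powr (p - 1) * (1 - s/x) powr (c - 1))
      = s powr (p - 1) * (x - s) powr (c - 1)" if "s \<in> {0..x}" for s
  proof -
    have "1 - s/x = (x - s)/x" using assms by (simp add: field_simps)
    then have "x powr (p + c - 2) * ((s/x) powr (p - 1) * (1 - s/x) powr (c - 1))
      = x powr ((p - 1) + (c - 1)) * (s powr (p - 1) / x powr (p - 1) * ((x - s) powr (c - 1) / x powr (c - 1)))"
      using assms that by (simp add: powr_divide)
    also have "\<dots> = s powr (p - 1) * (x - s) powr (c - 1)"
      unfolding powr_add using assms by simp
    finally show ?thesis .
  qed
  ultimately show ?thesis
    by (metis (mono_tags, lifting) has_integral_cong)
qed

lemma binomial_series_pochhammer:
  fixes s e :: real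
  assumes "\<bar>s\<bar> < 1"
  shows "(\<lambda>k. pochhammer e k / fact k * s ^ k) sums (1 - s) powr (- e)"
proof -
  have "((- e) gchoose k) * (- s) ^ k = pochhammer e k / fact k * s ^ k" for k
  proof -
    have "(- e) gchoose k = (- 1) ^ k * (pochhammer e k / fact k)"
      by (simp add: gbinomial_pochhammer)
    moreover have "(- s) ^ k = (- 1) ^ k * s ^ k" by (rule power_minus)
    moreover have "(- 1 :: real) ^ k * (- 1) ^ k = 1" by (simp flip: power_mult_distrib)
    ultimately show ?thesis by (metis (no_types, lifting) mult.assoc mult.left_commute mult_1)
  qed
  then show ?thesis using gen_binomial_real[of "- s" "- e"] assms by simp
qed

text \<open>Differentiating \<open>x\<^bsup>p\<^esup> \<Sum> c\<^sub>k x\<^bsup>k\<^esup>\<close> multiplies the coefficients by \<open>k + p\<close>. The sum of the new series is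
  a parameter, because in the applications it has a closed form.\<close>
lemma DERIV_powr_times_power_series:
  fixes c :: "nat \<Rightarrow> real"
  assumes summ: "\<And>y. \<bar>y\<bar> < 1 \<Longrightarrow> summable (\<lambda>k. c k * y ^ k)" and x: "0 < x" "x < 1"
    and sums: "(\<lambda>k. (real k + p) * c k * x ^ k) sums s"
  shows "((\<lambda>x. x powr p * (\<Sum>k. c k * x ^ k)) has_real_derivative x powr (p - 1) * s) (at x)"
proof -
  define f f' where "f = (\<Sum>k. c k * x ^ k)" and "f' = (\<Sum>k. diffs c k * x ^ k)"
  have f: "((\<lambda>x. \<Sum>k. c k * x ^ k) has_real_derivative f') (at x)"
    unfolding f'_def by (rule termdiffs_strong'[of 1]) (use summ x in auto)
  have "(\<lambda>k. of_nat k * c k * x ^ (k - Suc 0)) sums f'"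
    unfolding f'_def by (rule diffs_equiv, rule termdiff_converges[of _ 1]) (use summ x in auto)
  then have "(\<lambda>k. x * (of_nat k * c k * x ^ (k - Suc 0))) sums (x * f')" by (rule sums_mult)
  also have "(\<lambda>k. x * (of_nat k * c k * x ^ (k - Suc 0))) = (\<lambda>k. real k * c k * x ^ k)"
  proof
    fix k show "x * (of_nat k * c k * x ^ (k - Suc 0)) = real k * c k * x ^ k"
      by (cases k) auto
  qed
  finally have "(\<lambda>k. real k * c k * x ^ k + p * (c k * x ^ k)) sums (x * f' + p * f)"
    unfolding f_def by (intro sums_add sums_mult summable_sums summ) (use x in auto)
  then have "(\<lambda>k. (real k + p) * c k * x ^ k) sums (x * f' + p * f)"
    by (simp add: algebra_simps)
  with sums have s: "s = x * f' + p * f" by (rule sums_unique2)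
  have "((\<lambda>x. x powr p * (\<Sum>k. c k * x ^ k)) has_real_derivative
      p * x powr (p - 1) * f + f' * x powr p) (at x)"
    unfolding f_def by (rule DERIV_mult[OF has_real_derivative_powr[OF x(1)] f])
  also have "p * x powr (p - 1) * f + f' * x powr p = x powr (p - 1) * s"
    using powr_mult_base[of x "p - 1"] x by (simp add: s algebra_simps)
  finally show ?thesis .
qed

text \<open>The value of \<open>\<integral>\<^sub>0\<^sup>x s\<^bsup>b-1\<^esup> (1 - s)\<^bsup>a-1\<^esup> (x - s)\<^bsup>c-1\<^esup> ds\<close> for \<open>0 < x < 1\<close>, obtained by expanding
  \<open>(1 - s)\<^bsup>a-1\<^esup>\<close>. The series is a Gauss hypergeometric function up to a factor; it is used because it can be
  differentiated in \<open>x\<close> term by term, unlike the integral with its singular moving endpoint.\<close>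
definition left_moment :: "real \<Rightarrow> real \<Rightarrow> real \<Rightarrow> real \<Rightarrow> real" where
  "left_moment a b c x =
     x powr (b + c - 1) * (\<Sum>k. pochhammer (1 - a) k / fact k * Beta (b + real k) c * x ^ k)"

lemma Beta_real_pos: "0 < Beta p q" if "0 < p" "0 < q" for p q :: real
  using that by (simp add: Beta_def)

lemma Beta_plus1_left_real: "(p + q) * Beta (p + 1) q = p * Beta p q" if "0 < p" "0 < q" for p q :: real
  by (rule Beta_plus1_left) (use that in \<open>auto elim!: nonpos_Ints_cases'\<close>)

lemma Beta_plus1_right_real: "(p + q) * Beta p (q + 1) = q * Beta p q" if "0 < p" "0 < q" for p q :: real
  by (rule Beta_plus1_right) (use that in \<open>auto elim!: nonpos_Ints_cases'\<close>)

lemma Beta_add_nat_le: "Beta (b + real k) c \<le> Beta b c" if "0 < b" "0 < c" for b c :: real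
proof (induction k)
  case (Suc k)
  have p: "0 < b + real k" using that by simp
  have "(b + real k + c) * Beta (b + real k + 1) c \<le> (b + real k + c) * Beta (b + real k) c"
    using Beta_plus1_left_real[OF p that(2)] Beta_real_pos[OF p that(2)] that by (simp add: mult_right_mono)
  then have "Beta (b + real k + 1) c \<le> Beta (b + real k) c"
    using p that by (simp add: mult_le_cancel_left)
  with Suc show ?case by (simp add: add_ac)
qed simp

lemma pochhammer_nonneg_real: "0 \<le> pochhammer e k" if "0 \<le> e" for e :: real
  using that by (induction k) (auto simp: pochhammer_Suc)

lemma pochhammer_fact_nonneg: "0 \<le> pochhammer (1 - a) k / fact k" if "a \<le> 1" for a :: real
  using that by (simp add: pochhammer_nonneg_real)

lemma left_moment_summable:
  fixes a b c y :: real
  assumes a: "a \<le> 1" and b: "0 < b" and c: "0 < c" and "\<bar>y\<bar> < 1"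
  shows "summable (\<lambda>k. pochhammer (1 - a) k / fact k * Beta (b + real k) c * y ^ k)"
proof (rule summable_comparison_test')
  show "summable (\<lambda>k. Beta b c * (pochhammer (1 - a) k / fact k * \<bar>y\<bar> ^ k))"
    using binomial_series_pochhammer[of "\<bar>y\<bar>" "1 - a"] assms
    by (intro summable_mult) (auto simp: summable_def)
  fix k :: nat
  have B: "0 \<le> Beta (b + real k) c" by (intro less_imp_le Beta_real_pos) (use b c in auto)
  have "norm (pochhammer (1 - a) k / fact k * Beta (b + real k) c * y ^ k)
      = pochhammer (1 - a) k / fact k * \<bar>y\<bar> ^ k * Beta (b + real k) c"
    using abs_of_nonneg[OF pochhammer_fact_nonneg[OF a, of k]] abs_of_nonneg[OF B]
    by (simp only: real_norm_def abs_mult power_abs mult_ac)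
  also have "\<dots> \<le> pochhammer (1 - a) k / fact k * \<bar>y\<bar> ^ k * Beta b c"
    by (intro mult_left_mono Beta_add_nat_le b c mult_nonneg_nonneg pochhammer_fact_nonneg a) auto
  finally show "norm (pochhammer (1 - a) k / fact k * Beta (b + real k) c * y ^ k)
      \<le> Beta b c * (pochhammer (1 - a) k / fact k * \<bar>y\<bar> ^ k)"
    by (simp only: mult_ac)
qed

text \<open>For \<open>a \<le> 1\<close> the binomial coefficients of \<open>(1 - s)\<^bsup>a-1\<^esup>\<close> are nonnegative, so monotone convergence
  justifies integrating term by term.\<close>
lemma has_integral_left_moment:
  fixes a b c x :: real
  assumes a: "a \<le> 1" and b: "0 < b" and c: "0 < c" and x: "0 < x" "x < 1"
  shows "((\<lambda>s. s powr (b - 1) * (1 - s) powr (a - 1) * (x - s) powr (c - 1))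
           has_integral left_moment a b c x) {0..x}"
proof -
  define q where "q k = pochhammer (1 - a) k / fact k" for k
  have q0: "0 \<le> q k" for k unfolding q_def by (rule pochhammer_fact_nonneg[OF a])
  define f where "f n s = (\<Sum>k<n. q k * (s powr (b + real k - 1) * (x - s) powr (c - 1)))" for n s
  define i where "i n = (\<Sum>k<n. q k * (x powr (b + real k + c - 1) * Beta (b + real k) c))" for n
  show ?thesis
  proof (rule has_integral_monotone_convergence_increasing[of f i])
    fix n show "(f n has_integral i n) {0..x}"
      unfolding f_def i_def
      by (intro has_integral_sum has_integral_mult_right has_integral_scaled_Beta) (use x b c in auto)
    fix s show "f n s \<le> f (Suc n) s" unfolding f_def by (simp add: q0)
  next
    fix s assume s: "s \<in> {0..x}"
    have "(\<lambda>k. s powr (b - 1) * (x - s) powr (c - 1) * (q k * s ^ k)) sums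
        (s powr (b - 1) * (x - s) powr (c - 1) * (1 - s) powr (- (1 - a)))"
      unfolding q_def by (intro sums_mult binomial_series_pochhammer) (use s x in auto)
    moreover have "s powr (b - 1) * (x - s) powr (c - 1) * (q k * s ^ k)
        = q k * (s powr (b + real k - 1) * (x - s) powr (c - 1))" for k
    proof (cases "s = 0")
      case False
      then have "s powr (b + real k - 1) = s powr (b - 1) * s ^ k"
        using s by (simp add: powr_realpow[symmetric] powr_add[symmetric] algebra_simps)
      then show ?thesis by simp
    qed simp
    ultimately have "(\<lambda>k. q k * (s powr (b + real k - 1) * (x - s) powr (c - 1))) sums
        (s powr (b - 1) * (x - s) powr (c - 1) * (1 - s) powr (- (1 - a)))"
      by (simp only:)
    also have "s powr (b - 1) * (x - s) powr (c - 1) * (1 - s) powr (- (1 - a))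
        = s powr (b - 1) * (1 - s) powr (a - 1) * (x - s) powr (c - 1)" by simp
    finally show "(\<lambda>n. f n s) \<longlonglongrightarrow> s powr (b - 1) * (1 - s) powr (a - 1) * (x - s) powr (c - 1)"
      unfolding f_def sums_def .
  next
    have "(\<lambda>k. x powr (b + c - 1) * (q k * Beta (b + real k) c * x ^ k)) sums left_moment a b c x"
      unfolding left_moment_def q_def
      by (intro sums_mult summable_sums left_moment_summable a b c) (use x in auto)
    moreover have "x powr (b + c - 1) * (q k * Beta (b + real k) c * x ^ k)
        = q k * (x powr (b + real k + c - 1) * Beta (b + real k) c)" for k
    proof -
      have "x powr (b + real k + c - 1) = x powr (b + c - 1) * x ^ k"
        using x by (simp add: powr_realpow[symmetric] powr_add[symmetric] algebra_simps)
      then show ?thesis by simp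
    qed
    ultimately show "i \<longlonglongrightarrow> left_moment a b c x"
      unfolding i_def by (simp add: sums_def)
  qed
qed

text \<open>This is differentiation of \<open>(x - s)\<^bsup>c\<^esup>\<close> under the integral sign; on coefficients it is the recurrence of
  the Beta function in its second argument.\<close>
lemma left_moment_deriv_succ:
  fixes a b c x :: real
  assumes a: "a \<le> 1" and b: "0 < b" and c: "0 < c" and x: "0 < x" "x < 1"
  shows "(left_moment a b (c + 1) has_real_derivative c * left_moment a b c x) (at x)"
proof -
  have eq: "(real k + (b + (c + 1) - 1)) * (pochhammer (1 - a) k / fact k * Beta (b + real k) (c + 1)) * x ^ k
     = c * (pochhammer (1 - a) k / fact k * Beta (b + real k) c * x ^ k)" for k
  proof -
    have "(b + real k + c) * Beta (b + real k) (c + 1) = c * Beta (b + real k) c"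
      by (rule Beta_plus1_right_real) (use b c in auto)
    then have "pochhammer (1 - a) k / fact k * x ^ k * ((b + real k + c) * Beta (b + real k) (c + 1))
       = pochhammer (1 - a) k / fact k * x ^ k * (c * Beta (b + real k) c)" by simp
    then show ?thesis by (simp add: mult_ac add_ac)
  qed
  have sums: "(\<lambda>k. (real k + (b + (c + 1) - 1)) * (pochhammer (1 - a) k / fact k * Beta (b + real k) (c + 1)) * x ^ k)
    sums (c * (\<Sum>k. pochhammer (1 - a) k / fact k * Beta (b + real k) c * x ^ k))"
    unfolding eq by (intro sums_mult summable_sums left_moment_summable a b c) (use x in auto)
  have "((\<lambda>x. left_moment a b (c + 1) x) has_real_derivative
      x powr (b + (c + 1) - 1 - 1) * (c * (\<Sum>k. pochhammer (1 - a) k / fact k * Beta (b + real k) c * x ^ k))) (at x)"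
    unfolding left_moment_def
    by (rule DERIV_powr_times_power_series[OF left_moment_summable x sums]) (use a b c in auto)
  then show ?thesis unfolding left_moment_def by (simp add: mult_ac)
qed

text \<open>For the critical exponent \<open>c = 2 - a - b\<close> the factor \<open>k + 1 - a\<close> cancels the only factors that keep
  the series from being binomial, so that the derivative is elementary. The factor \<open>1 / \<Gamma>(1 - a)\<close> is written
  with \<open>rGamma\<close> to include \<open>a = 1\<close>, where it vanishes.\<close>
lemma left_moment_deriv:
  fixes a b x :: real
  assumes a: "0 < a" "a \<le> 1" and b: "0 < b" and ab: "a + b < 2" and x: "0 < x" "x < 1"
  shows "(left_moment a b (2 - a - b) has_real_derivative
           Gamma b * Gamma (2 - a - b) * rGamma (1 - a) * (x powr (- a) * (1 - x) powr (- b))) (at x)"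
proof -
  define c where "c = 2 - a - b"
  have c: "0 < c" using ab by (simp add: c_def)
  define R where "R = Gamma b * Gamma c * rGamma (1 - a)"
  have eq: "(real k + (b + c - 1)) * (pochhammer (1 - a) k / fact k * Beta (b + real k) c) * x ^ k
     = R * (pochhammer b k / fact k * x ^ k)" for k
  proof -
    have "Beta (b + real k) c = Gamma (b + real k) * Gamma c * rGamma (2 - a + real k)"
      by (simp add: Beta_altdef c_def add_ac)
    moreover have "Gamma (b + real k) = pochhammer b k * Gamma b"
      using b by (subst pochhammer_Gamma) (auto elim!: nonpos_Ints_cases' simp: Gamma_real_pos less_imp_neq[OF Gamma_real_pos, symmetric])
    moreover have "rGamma (1 - a) = pochhammer (1 - a) (Suc k) * rGamma (2 - a + real k)"
      using pochhammer_rGamma[of "1 - a" "Suc k"] by (simp add: algebra_simps)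
    ultimately have B: "Beta (b + real k) c = Gamma b * pochhammer b k * Gamma c * rGamma (2 - a + real k)"
      and G: "rGamma (1 - a) = pochhammer (1 - a) k * (real k + (b + c - 1)) * rGamma (2 - a + real k)"
      by (simp_all add: pochhammer_Suc c_def algebra_simps)
    show ?thesis unfolding R_def B G by (simp add: mult_ac)
  qed
  have sums: "(\<lambda>k. (real k + (b + c - 1)) * (pochhammer (1 - a) k / fact k * Beta (b + real k) c) * x ^ k)
    sums (R * (1 - x) powr (- b))"
    unfolding eq by (intro sums_mult binomial_series_pochhammer) (use x in auto)
  have "((\<lambda>x. left_moment a b c x) has_real_derivative
      x powr (b + c - 1 - 1) * (R * (1 - x) powr (- b))) (at x)"
    unfolding left_moment_def
    by (rule DERIV_powr_times_power_series[OF left_moment_summable x sums]) (use a b c in auto)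
  then show ?thesis unfolding R_def c_def by (simp add: mult_ac)
qed

lemma rGamma_reflection_real: "rGamma z * rGamma (1 - z) = sin (pi * z) / pi" for z :: real
proof -
  have "complex_of_real (rGamma z * rGamma (1 - z)) = of_real (sin (pi * z) / pi)"
    using rGamma_reflection_complex[of "of_real z"]
    by (simp flip: rGamma_complex_of_real sin_of_real)
  then show ?thesis by (simp only: of_real_eq_iff)
qed

text \<open>By the reflection formula both sides equal \<open>\<pi> / (\<Gamma>(1 - a) \<Gamma>(1 - b))\<close>.\<close>
lemma sin_Gamma_rGamma_symmetric:
  fixes a b :: real
  assumes "0 < a" "0 < b"
  shows "sin (pi * b) * (Gamma b * rGamma (1 - a)) = sin (pi * a) * (Gamma a * rGamma (1 - b))"
proof -
  have "sin (pi * z) * Gamma z = pi * rGamma (1 - z)" if "0 < z" for z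
  proof -
    have "Gamma z * rGamma z = 1"
      using Gamma_real_pos[OF that] unfolding rGamma_inverse_Gamma by (intro right_inverse) simp
    then show ?thesis
      using rGamma_reflection_real[of z] by (simp add: field_simps)
        (metis (no_types, lifting) mult.assoc mult.commute mult_1)
  qed
  from this[OF assms(1)] this[OF assms(2)] show ?thesis by (metis mult.assoc mult.commute mult.left_commute)
qed

section \<open>The two-sided kernel maps polynomials to polynomials\<close>

definition riesz_kernel :: "real \<Rightarrow> real \<Rightarrow> real \<Rightarrow> real \<Rightarrow> real \<Rightarrow> real" where
  "riesz_kernel \<rho> \<sigma> c x s = (if s < x then \<rho> else \<sigma>) * \<bar>x - s\<bar> powr (c - 1)"

definition jacobi_riesz :: "real \<Rightarrow> real \<Rightarrow> real \<Rightarrow> real \<Rightarrow> real poly \<Rightarrow> real \<Rightarrow> real" where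
  "jacobi_riesz \<rho> \<sigma> a b p x =
     (LINT s:{0<..<1}|lebesgue. riesz_kernel \<rho> \<sigma> (2 - a - b) x s * jac_weight (a - 1) (b - 1) s * poly p s)"

text \<open>The part to the right of \<open>x\<close> is the left part for the weight with exchanged exponents at the reflected point
  \<open>1 - x\<close>. The coefficients may have any sign: multiplying the kernel by \<open>x - s\<close> turns
  \<open>\<sigma>\<close> into \<open>- \<sigma>\<close> and \<open>c\<close> into \<open>c + 1\<close>.\<close>
lemma riesz_kernel_has_integral:
  fixes a b c x :: real
  assumes a: "0 < a" "a \<le> 1" and b: "0 < b" "b \<le> 1" and c: "0 < c" and x: "0 < x" "x < 1"
  shows "((\<lambda>s. riesz_kernel \<rho> \<sigma> c x s * jac_weight (a - 1) (b - 1) s) has_integral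
           \<rho> * left_moment a b c x + \<sigma> * left_moment b a c (1 - x)) {0..1}"
proof (rule has_integral_combine[where c = x])
  have "((\<lambda>s. \<rho> * (s powr (b - 1) * (1 - s) powr (a - 1) * (x - s) powr (c - 1))) has_integral
      \<rho> * left_moment a b c x) {0..x}"
    by (intro has_integral_mult_right has_integral_left_moment) (use assms in auto)
  then show "((\<lambda>s. riesz_kernel \<rho> \<sigma> c x s * jac_weight (a - 1) (b - 1) s) has_integral
      \<rho> * left_moment a b c x) {0..x}"
    by (rule has_integral_spike_finite[of "{x}", rotated 2])
       (auto simp: riesz_kernel_def jac_weight_def mult_ac)
  have "((\<lambda>s. s powr (a - 1) * (1 - s) powr (b - 1) * ((1 - x) - s) powr (c - 1)) has_integral
      left_moment b a c (1 - x)) (cbox 0 (1 - x))"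
    using has_integral_left_moment[of b a c "1 - x"] assms by simp
  from has_integral_affinity[OF this, of "-1" 1]
  have "((\<lambda>s. (1 - s) powr (a - 1) * s powr (b - 1) * (s - x) powr (c - 1)) has_integral
      left_moment b a c (1 - x)) ((\<lambda>s. 1 - s) ` {0..1 - x})"
    by (simp add: algebra_simps)
  also have "(\<lambda>s. 1 - s) ` {0..1 - x} = {x..1}"
    by (subst image_diff_atLeastAtMost) auto
  finally have "((\<lambda>s. \<sigma> * ((1 - s) powr (a - 1) * s powr (b - 1) * (s - x) powr (c - 1))) has_integral
      \<sigma> * left_moment b a c (1 - x)) {x..1}"
    by (rule has_integral_mult_right)
  then show "((\<lambda>s. riesz_kernel \<rho> \<sigma> c x s * jac_weight (a - 1) (b - 1) s) has_integral
      \<sigma> * left_moment b a c (1 - x)) {x..1}"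
    by (rule has_integral_spike_finite[of "{}", rotated 2])
       (auto simp: riesz_kernel_def jac_weight_def mult_ac)
qed (use x in auto)

lemma borel_measurable_poly [measurable]: "poly p \<in> borel_measurable borel" for p :: "real poly"
  by (intro borel_measurable_continuous_onI continuous_intros)

lemma poly_bounded_01:
  fixes p :: "real poly"
  obtains B where "0 \<le> B" "\<And>x. x \<in> {0<..<1} \<Longrightarrow> \<bar>poly p x\<bar> \<le> B"
proof -
  have "compact (poly p ` {0..1})"
    by (intro compact_continuous_image continuous_intros) auto
  then obtain B where B: "\<And>s. s \<in> {0..1} \<Longrightarrow> \<bar>poly p s\<bar> \<le> B"
    by (metis bounded_iff compact_imp_bounded imageI real_norm_def)
  have "0 \<le> B" using order_trans[OF abs_ge_zero B[of 0]] by simp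
  with B show thesis by (intro that[of B]) auto
qed

lemma riesz_kernel_absolutely_integrable:
  fixes a b c x :: real
  assumes a: "0 < a" "a \<le> 1" and b: "0 < b" "b \<le> 1" and c: "0 < c" and x: "0 < x" "x < 1"
  shows "(\<lambda>s. riesz_kernel \<rho> \<sigma> c x s * jac_weight (a - 1) (b - 1) s * poly p s)
           absolutely_integrable_on {0<..<1}"
proof -
  let ?k = "\<lambda>s. riesz_kernel 1 1 c x s * jac_weight (a - 1) (b - 1) s"
  have "(\<lambda>s. ?k s) integrable_on {0..1}"
    using riesz_kernel_has_integral[OF assms, of 1 1] by blast
  then have "(\<lambda>s. ?k s) absolutely_integrable_on {0..1}"
    by (rule nonnegative_absolutely_integrable_1) (auto simp: riesz_kernel_def jac_weight_def)
  then have 1: "(\<lambda>s. ?k s) absolutely_integrable_on {0<..<1}"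
    by (rule set_integrable_subset) auto
  obtain B where B: "\<And>s. s \<in> {0<..<1} \<Longrightarrow> \<bar>poly p s\<bar> \<le> B"
    using poly_bounded_01[of p] by blast
  have "(\<lambda>s. ((if s < x then \<rho> else \<sigma>) * poly p s) * (?k s))
      absolutely_integrable_on {0<..<1}"
  proof (rule absolutely_integrable_bounded_measurable_product_real[OF _ _ _ 1])
    have "(\<lambda>s. (if s < x then \<rho> else \<sigma>) * poly p s) \<in> borel_measurable borel"
      by measurable
    then show "(\<lambda>s. (if s < x then \<rho> else \<sigma>) * poly p s) \<in> borel_measurable (lebesgue_on {0<..<1})"
      by (intro measurable_restrict_space1 measurable_completion) simp
    show "bounded ((\<lambda>s. (if s < x then \<rho> else \<sigma>) * poly p s) ` {0<..<1})"
    proof (rule boundedI[of _ "(\<bar>\<rho>\<bar> + \<bar>\<sigma>\<bar>) * B"])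
      fix y assume "y \<in> (\<lambda>s. (if s < x then \<rho> else \<sigma>) * poly p s) ` {0<..<1}"
      then obtain s where s: "s \<in> {0<..<1}" and y: "y = (if s < x then \<rho> else \<sigma>) * poly p s" by auto
      have "norm y = \<bar>if s < x then \<rho> else \<sigma>\<bar> * \<bar>poly p s\<bar>" by (simp add: y abs_mult)
      also have "\<dots> \<le> (\<bar>\<rho>\<bar> + \<bar>\<sigma>\<bar>) * B"
        using B[of s] s by (intro mult_mono) auto
      finally show "norm y \<le> (\<bar>\<rho>\<bar> + \<bar>\<sigma>\<bar>) * B" .
    qed
  qed auto
  also have "(\<lambda>s. ((if s < x then \<rho> else \<sigma>) * poly p s) * (?k s))
      = (\<lambda>s. riesz_kernel \<rho> \<sigma> c x s * jac_weight (a - 1) (b - 1) s * poly p s)"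
    by (auto simp: fun_eq_iff riesz_kernel_def)
  finally show ?thesis .
qed

text \<open>The coefficients \<open>\<rho>\<close> (left of \<open>x\<close>) and \<open>\<sigma>\<close> (right of \<open>x\<close>) are kept independent of each other so that the
  assumptions are invariant under exchanging \<open>(a, \<rho>)\<close> with \<open>(b, \<sigma>)\<close>; this exchange is the passage to the
  adjoint operator. The balance condition is the homogeneous form of
  \<open>r = sin(\<pi>\<beta>) / (sin(\<pi>(\<alpha>-\<beta>)) + sin(\<pi>\<beta>))\<close>.\<close>
locale balanced_kernel =
  fixes a b \<rho> \<sigma> :: real
  assumes a: "0 < a" "a \<le> 1" and b: "0 < b" "b \<le> 1" and ab: "1 < a + b" "a + b < 2"
    and \<rho>\<sigma>: "0 \<le> \<rho>" "0 \<le> \<sigma>" "0 < \<rho> + \<sigma>"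
    and balance: "\<rho> * sin (pi * a) = \<sigma> * sin (pi * b)"
begin

definition c :: real where "c = 2 - a - b"

abbreviation T :: "real poly \<Rightarrow> real \<Rightarrow> real" where "T \<equiv> jacobi_riesz \<rho> \<sigma> a b"

lemma c_pos: "0 < c" using ab by (simp add: c_def)

lemma T_integrable:
  assumes "0 < x" "x < 1"
  shows "set_integrable lebesgue {0<..<1}
     (\<lambda>s. riesz_kernel \<rho> \<sigma> c x s * jac_weight (a - 1) (b - 1) s * poly p s)"
  by (rule riesz_kernel_absolutely_integrable) (use assms a b c_pos in auto)

lemma T_eq_integral:
  assumes "0 < x" "x < 1"
  shows "T p x = integral {0..1} (\<lambda>s. riesz_kernel \<rho> \<sigma> c x s * jac_weight (a - 1) (b - 1) s * poly p s)"
  using set_lebesgue_integral_eq_integral(2)[OF T_integrable[OF assms, of p]]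
  by (simp add: jacobi_riesz_def c_def integral_open_interval_real)

lemma T_add: "0 < x \<Longrightarrow> x < 1 \<Longrightarrow> T (p + q) x = T p x + T q x"
  unfolding jacobi_riesz_def using T_integrable[of x p] T_integrable[of x q]
  by (simp add: c_def distrib_left set_integral_add)

lemma T_smult: "T (smult k p) x = k * T p x"
  unfolding jacobi_riesz_def by (simp add: mult.left_commute[of _ k] flip: set_integral_mult_right)

lemma T_sum:
  assumes "finite I" "0 < x" "x < 1"
  shows "T (\<Sum>i\<in>I. f i) x = (\<Sum>i\<in>I. T (f i) x)"
  using assms
proof (induction I rule: finite_induct)
  case empty
  then show ?case using T_smult[of 0 0 x] by simp
next
  case (insert i I)
  then show ?case by (simp add: T_add)
qed

text \<open>Integrate the derivative of \<open>s\<^bsup>m+b\<^esup> (1 - s)\<^bsup>a\<^esup> (x - s) |x - s|\<^bsup>c-1\<^esup>\<close>, with the coefficients \<open>\<rho>\<close>, \<open>\<sigma>\<close> on the two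
  sides of \<open>x\<close>, over the unit interval. This function vanishes at both ends and is continuous at \<open>x\<close>, and
  its derivative is the integrand of \<open>T\<close> for a combination of three consecutive powers.\<close>
lemma T_recurrence:
  assumes x: "0 < x" "x < 1"
  shows "(real m + 2) * T (monom 1 (m + 2)) x =
     ((b + m) * (1 + x) + a * x + c) * T (monom 1 (m + 1)) x - (b + m) * x * T (monom 1 m) x"
proof -
  define \<Phi> where "\<Phi> s = s ^ m * (s powr b * (1 - s) powr a) *
      (if s < x then \<rho> * \<bar>x - s\<bar> powr c else - \<sigma> * \<bar>x - s\<bar> powr c)" for s
  define B where "B = smult (real m + 2) (monom 1 (m + 2))
      + smult (- ((b + m) * (1 + x) + a * x + c)) (monom 1 (m + 1)) + smult ((b + m) * x) (monom 1 m)"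
  have cont: "continuous_on {0..1} \<Phi>"
  proof -
    have "continuous_on {0..1} (\<lambda>s. if s \<le> x then \<rho> * \<bar>x - s\<bar> powr c else - \<sigma> * \<bar>x - s\<bar> powr c)"
    proof -
      have "continuous_on ({0..x} \<union> {x..1}) (\<lambda>s. if s \<le> x then \<rho> * \<bar>x - s\<bar> powr c else - \<sigma> * \<bar>x - s\<bar> powr c)"
        using c_pos by (intro continuous_on_If continuous_on_mult continuous_on_powr' continuous_intros) auto
      then show ?thesis using x by (simp add: ivl_disj_un_two_touch)
    qed
    then have "continuous_on {0..1} (\<lambda>s. s ^ m * (s powr b * (1 - s) powr a) *
       (if s \<le> x then \<rho> * \<bar>x - s\<bar> powr c else - \<sigma> * \<bar>x - s\<bar> powr c))"
      using a b by (intro continuous_on_mult continuous_on_powr' continuous_intros) auto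
    moreover have "s ^ m * (s powr b * (1 - s) powr a) *
       (if s \<le> x then \<rho> * \<bar>x - s\<bar> powr c else - \<sigma> * \<bar>x - s\<bar> powr c) = \<Phi> s" for s
      unfolding \<Phi>_def by (cases "s = x") auto
    ultimately show ?thesis by simp
  qed
  have deriv: "(\<Phi> has_vector_derivative riesz_kernel \<rho> \<sigma> c x s * jac_weight (a - 1) (b - 1) s * poly B s) (at s)"
    if s: "s \<in> {0<..<1} - {x}" for s
  proof -
    \<comment> \<open>the sign \<open>e\<close> turns \<open>|x - s|\<close> into \<open>e (x - s)\<close>, so that both sides of \<open>x\<close> are differentiated at once\<close>
    define k where "k = (if s < x then \<rho> else - \<sigma>)"
    define e where "e = (if s < x then (1::real) else -1)"
    have e: "e * (x - s) > 0" "e * e = 1" using s by (auto simp: e_def)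
    define \<Psi> where "\<Psi> t = t ^ m * (t powr b * (1 - t) powr a) * (k * (e * (x - t)) powr c)" for t
    have s1: "s powr b = s * s powr (b - 1)" "(1 - s) powr a = (1 - s) * (1 - s) powr (a - 1)"
      "(e * (x - s)) powr c = (e * (x - s)) * (e * (x - s)) powr (c - 1)"
      using s e powr_mult_base[of s "b - 1"] powr_mult_base[of "1 - s" "a - 1"]
        powr_mult_base[of "e * (x - s)" "c - 1"] by auto
    have sm: "s * (real m * s ^ (m - 1)) = real m * s ^ m" by (cases m) auto
    define W where "W = s powr (b - 1) * (1 - s) powr (a - 1) * (e * (x - s)) powr (c - 1)"
    have "(\<Psi> has_real_derivative
       ((real m * s ^ (m - 1)) * (s powr b * (1 - s) powr a) * (k * (e * (x - s)) powr c)
      + s ^ m * (b * s powr (b - 1)) * (1 - s) powr a * (k * (e * (x - s)) powr c)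
      + s ^ m * s powr b * (a * (1 - s) powr (a - 1) * (- 1)) * (k * (e * (x - s)) powr c)
      + s ^ m * (s powr b * (1 - s) powr a) * (k * (c * (e * (x - s)) powr (c - 1) * (- e))))) (at s)"
      (is "(_ has_real_derivative ?D) _")
      unfolding \<Psi>_def using s e
      by (auto intro!: derivative_eq_intros simp: algebra_simps)
    also have "?D = k * e * W * ((s * (real m * s ^ (m - 1))) * (1 - s) * (x - s)
         + s ^ m * b * (1 - s) * (x - s) - s ^ m * s * a * (x - s) - s ^ m * s * (1 - s) * c)"
      unfolding s1 W_def by (simp add: algebra_simps)
    also have "\<dots> = k * e * W * poly B s"
      unfolding sm B_def by (simp add: poly_monom c_def algebra_simps power2_eq_square)
    also have "k * e * W = riesz_kernel \<rho> \<sigma> c x s * jac_weight (a - 1) (b - 1) s"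
      unfolding W_def riesz_kernel_def jac_weight_def k_def e_def using s by (auto simp: mult_ac)
    finally have d: "(\<Psi> has_real_derivative
       riesz_kernel \<rho> \<sigma> c x s * jac_weight (a - 1) (b - 1) s * poly B s) (at s)" .
    have ev: "\<forall>\<^sub>F t in nhds s. \<Psi> t = \<Phi> t"
    proof (cases "s < x")
      case True
      then have "\<forall>\<^sub>F t in nhds s. t < x" using eventually_nhds_in_open[of "{..<x}" s] by simp
      then show ?thesis
        by eventually_elim (use True in \<open>simp add: \<Psi>_def \<Phi>_def k_def e_def\<close>)
    next
      case False
      then have "x < s" using s by auto
      then have "\<forall>\<^sub>F t in nhds s. x < t" using eventually_nhds_in_open[of "{x<..}" s] by simp
      then show ?thesis
        by eventually_elim (use False in \<open>simp add: \<Psi>_def \<Phi>_def k_def e_def\<close>)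
    qed
    have "(\<Phi> has_real_derivative
       riesz_kernel \<rho> \<sigma> c x s * jac_weight (a - 1) (b - 1) s * poly B s) (at s)"
      using d by (subst (asm) DERIV_cong_ev[OF refl ev refl])
    then show ?thesis by (simp add: has_real_derivative_iff_has_vector_derivative)
  qed
  have "((\<lambda>s. riesz_kernel \<rho> \<sigma> c x s * jac_weight (a - 1) (b - 1) s * poly B s) has_integral (\<Phi> 1 - \<Phi> 0)) {0..1}"
    by (rule fundamental_theorem_of_calculus_interior_strong[of "{x}"]) (use cont deriv in auto)
  moreover have "\<Phi> 1 = 0" "\<Phi> 0 = 0" using a b by (auto simp: \<Phi>_def)
  ultimately have "T B x = 0"
    using T_eq_integral[OF x, of B] by (simp add: integral_unique)
  moreover have "T B x = (real m + 2) * T (monom 1 (m + 2)) x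
      - ((b + m) * (1 + x) + a * x + c) * T (monom 1 (m + 1)) x + (b + m) * x * T (monom 1 m) x"
    unfolding B_def using x by (simp only: T_add T_smult)
  ultimately show ?thesis by simp
qed

lemma T_one:
  assumes "0 < x" "x < 1"
  shows "T 1 x = \<rho> * left_moment a b c x + \<sigma> * left_moment b a c (1 - x)"
  using riesz_kernel_has_integral[OF a b c_pos assms, of \<rho> \<sigma>] T_eq_integral[OF assms, of 1]
  by (simp add: integral_unique)

text \<open>The constant value of \<open>T 1\<close>; any point of the interval could be used.\<close>
definition \<tau> :: real where "\<tau> = T 1 (1/2)"

text \<open>The derivatives of the two one-sided moments are opposite multiples of \<open>x\<^bsup>-a\<^esup> (1 - x)\<^bsup>-b\<^esup>\<close>, and the balance
  condition makes the multiples cancel.\<close>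
lemma T_one_const:
  assumes x: "0 < x" "x < 1"
  shows "T 1 x = \<tau>"
proof -
  define g where "g x = \<rho> * left_moment a b c x + \<sigma> * left_moment b a c (1 - x)" for x
  have "(g has_real_derivative 0) (at y)" if y: "y \<in> {0<..<1}" for y
  proof -
    let ?Y = "Gamma b * Gamma c * rGamma (1 - a) * (y powr (- a) * (1 - y) powr (- b))" and ?Z = "Gamma a * Gamma c * rGamma (1 - b) * ((1 - y) powr (- b) * (1 - (1 - y)) powr (- a))"
    have c': "2 - b - a = c" by (simp add: c_def)
    have "(left_moment a b c has_real_derivative
           ?Y) (at y)"
      using left_moment_deriv[of a b y] a b ab y by (simp add: c_def)
    moreover have "(left_moment b a c has_real_derivative
           ?Z) (at (1 - y))"
      using left_moment_deriv[of b a "1 - y"] a b ab y unfolding c' by simp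
    then have "((\<lambda>t. left_moment b a c (1 - t)) has_real_derivative
           ?Z * (0 - 1)) (at y)"
      by (rule DERIV_chain2) (auto intro!: derivative_eq_intros)
    ultimately have "(g has_real_derivative
        (\<rho> * (?Y) +
         \<sigma> * (?Z * (0 - 1)))) (at y)"
      unfolding g_def by (intro DERIV_add DERIV_cmult)
    moreover have "\<rho> * (Gamma b * rGamma (1 - a)) = \<sigma> * (Gamma a * rGamma (1 - b))"
    proof -
      have sym: "sin (pi * b) * (Gamma b * rGamma (1 - a)) = sin (pi * a) * (Gamma a * rGamma (1 - b))"
        by (rule sin_Gamma_rGamma_symmetric) (use a b in auto)
      show ?thesis
      proof (cases "a = 1")
        case True
        then have b1: "b < 1" using ab by simp
        then have "0 < sin (pi * b)" using b by (intro sin_gt_zero) auto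
        then have "\<sigma> = 0" using balance True by simp
        then show ?thesis using True by simp
      next
        case False
        then have a1: "a < 1" using a by simp
        then have sa: "0 < sin (pi * a)" using a by (intro sin_gt_zero) auto
        have "sin (pi * a) * (\<rho> * (Gamma b * rGamma (1 - a))) = \<sigma> * (sin (pi * b) * (Gamma b * rGamma (1 - a)))"
          using balance by (metis mult.assoc mult.commute)
        also have "\<dots> = sin (pi * a) * (\<sigma> * (Gamma a * rGamma (1 - b)))"
          unfolding sym by (simp only: mult_ac)
        finally show ?thesis using sa by simp
      qed
    qed
    then have "\<rho> * (?Y) +
         \<sigma> * (?Z * (0 - 1)) = 0"
    proof -
      assume h: "\<rho> * (Gamma b * rGamma (1 - a)) = \<sigma> * (Gamma a * rGamma (1 - b))"
      have "\<rho> * (?Y) +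
         \<sigma> * (?Z * (0 - 1))
        = (\<rho> * (Gamma b * rGamma (1 - a)) - \<sigma> * (Gamma a * rGamma (1 - b)))
           * (Gamma c * (y powr (- a) * (1 - y) powr (- b)))"
        by (simp add: algebra_simps)
      then show ?thesis using h by simp
    qed
    ultimately show ?thesis by (simp only:)
  qed
  then have "g x = g (1/2)"
  proof -
    assume *: "\<And>y. y \<in> {0<..<1} \<Longrightarrow> (g has_real_derivative 0) (at y)"
    have "\<exists>k. \<forall>y\<in>{0<..<1}. g y = k"
      by (rule has_field_derivative_zero_constant)
         (use * in \<open>auto intro: has_field_derivative_at_within convex_real_interval\<close>)
    then show ?thesis using x by auto
  qed
  then show ?thesis using x by (simp add: \<tau>_def T_one g_def)
qed

lemma \<tau>_pos: "0 < \<tau>"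
proof -
  let ?k = "\<lambda>s. riesz_kernel \<rho> \<sigma> c (1/2) s * jac_weight (a - 1) (b - 1) s"
  have K: "0 < ?k s"
    if "s \<in> {0<..<1}" "if 0 < \<rho> then s < 1/2 else 1/2 < s" for s
    using that \<rho>\<sigma> by (auto simp: riesz_kernel_def jac_weight_def split: if_splits)
  have K0: "0 \<le> ?k s" for s
    using \<rho>\<sigma> by (auto simp: riesz_kernel_def jac_weight_def)
  define J where "J = (if 0 < \<rho> then {0<..<1/2} else {1/2<..<1::real})"
  have J: "J \<subseteq> {0<..<1}" by (auto simp: J_def)
  have T: "\<tau> = (LINT s|lebesgue. indicat_real {0<..<1} s * (?k s))"
    unfolding \<tau>_def jacobi_riesz_def c_def set_lebesgue_integral_def by simp
  have int: "integrable lebesgue (\<lambda>s. indicat_real {0<..<1} s * (?k s))"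
    using T_integrable[of "1/2" 1] by (simp add: set_integrable_def)
  have "0 \<le> \<tau>" unfolding T using K0 by (intro integral_nonneg_AE) auto
  moreover have "\<tau> \<noteq> 0"
  proof
    assume "\<tau> = 0"
    then have "AE s in lebesgue. indicat_real {0<..<1} s * (?k s) = 0"
      unfolding T using K0 by (subst (asm) integral_nonneg_eq_0_iff_AE[OF int]) auto
    then have "AE s in lebesgue. s \<notin> J"
    proof eventually_elim
      case (elim s)
      show ?case
      proof
        assume "s \<in> J"
        then have "s \<in> {0<..<1}" "if 0 < \<rho> then s < 1/2 else 1/2 < s" using J by (auto simp: J_def split: if_splits)
        with K[of s] elim show False by (metis indicator_simps(1) mult_1 less_irrefl)
      qed
    qed
    then have "J \<in> null_sets lebesgue"
      by (subst AE_iff_null_sets) (auto simp: J_def)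
    then have "negligible J" by (simp add: negligible_iff_null_sets)
    then show False
      by (simp add: J_def open_not_negligible split: if_splits)
  qed
  ultimately show ?thesis by simp
qed

text \<open>The recurrence starts only at degree 2, so degree 1 needs its own argument: \<open>x T 1 - T s\<close> is the integral
  against the kernel with exponent \<open>c\<close> instead of \<open>c - 1\<close>, hence an antiderivative of \<open>c T 1 = c \<tau>\<close>.\<close>
lemma T_linear_monom:
  obtains k where "\<And>x. 0 < x \<Longrightarrow> x < 1 \<Longrightarrow> T (monom 1 1) x = (a + b - 1) * \<tau> * x + k"
proof -
  define S where "S x = \<rho> * left_moment a b (c + 1) x + (- \<sigma>) * left_moment b a (c + 1) (1 - x)" for x
  have S: "S x = x * \<tau> - T (monom 1 1) x" if x: "0 < x" "x < 1" for x
  proof -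
    have "S x = integral {0..1} (\<lambda>s. riesz_kernel \<rho> (- \<sigma>) (c + 1) x s * jac_weight (a - 1) (b - 1) s)"
      using riesz_kernel_has_integral[OF a b _ x, of "c + 1" \<rho> "- \<sigma>"] c_pos
      by (simp add: S_def integral_unique)
    also have "\<dots> = integral {0..1} (\<lambda>s. riesz_kernel \<rho> \<sigma> c x s * jac_weight (a - 1) (b - 1) s * poly [:x, -1:] s)"
    proof (rule integral_cong)
      fix s
      have "\<bar>x - s\<bar> powr c = \<bar>x - s\<bar> * \<bar>x - s\<bar> powr (c - 1)"
        using powr_mult_base[of "\<bar>x - s\<bar>" "c - 1"] by simp
      then have "riesz_kernel \<rho> (- \<sigma>) (c + 1) x s = riesz_kernel \<rho> \<sigma> c x s * (x - s)"
        unfolding riesz_kernel_def by (simp add: abs_if algebra_simps)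
      then show "riesz_kernel \<rho> (- \<sigma>) (c + 1) x s * jac_weight (a - 1) (b - 1) s
          = riesz_kernel \<rho> \<sigma> c x s * jac_weight (a - 1) (b - 1) s * poly [:x, -1:] s"
        by simp
    qed
    also have "\<dots> = T [:x, -1:] x" using x by (simp add: T_eq_integral)
    also have "[:x, -1:] = smult x 1 + smult (-1) (monom 1 1)"
      by (simp add: monom_altdef one_pCons)
    also have "T (smult x 1 + smult (-1) (monom 1 1)) x = x * \<tau> - T (monom 1 1) x"
      using x by (simp only: T_add T_smult T_one_const)
    finally show ?thesis .
  qed
  have dS: "((\<lambda>y. S y - c * \<tau> * y) has_real_derivative 0) (at y)" if y: "y \<in> {0<..<1}" for y
  proof -
    have "(left_moment a b (c + 1) has_real_derivative c * left_moment a b c y) (at y)"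
      by (rule left_moment_deriv_succ) (use a b c_pos y in auto)
    moreover have "(left_moment b a (c + 1) has_real_derivative c * left_moment b a c (1 - y)) (at (1 - y))"
      by (rule left_moment_deriv_succ) (use a b c_pos y in auto)
    then have "((\<lambda>t. left_moment b a (c + 1) (1 - t)) has_real_derivative c * left_moment b a c (1 - y) * (0 - 1)) (at y)"
      by (rule DERIV_chain2) (auto intro!: derivative_eq_intros)
    ultimately have "((\<lambda>y. S y - c * \<tau> * y) has_real_derivative
       (\<rho> * (c * left_moment a b c y) + (- \<sigma>) * (c * left_moment b a c (1 - y) * (0 - 1)) - c * \<tau> * 1)) (at y)"
      unfolding S_def by (intro DERIV_add DERIV_cmult DERIV_diff DERIV_ident)
    moreover have "\<rho> * left_moment a b c y + \<sigma> * left_moment b a c (1 - y) = \<tau>"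
      using y T_one[of y] T_one_const[of y] by simp
    then have "c * (\<rho> * left_moment a b c y + \<sigma> * left_moment b a c (1 - y)) = c * \<tau>" by simp
    then have "\<rho> * (c * left_moment a b c y) + (- \<sigma>) * (c * left_moment b a c (1 - y) * (0 - 1)) - c * \<tau> * 1 = 0"
      by (simp add: algebra_simps)
    ultimately show ?thesis by simp
  qed
  have "\<exists>k. \<forall>y\<in>{0<..<1}. S y - c * \<tau> * y = k"
    by (rule has_field_derivative_zero_constant)
       (use dS in \<open>auto intro: has_field_derivative_at_within convex_real_interval\<close>)
  then obtain k where k: "\<And>y. y \<in> {0<..<1} \<Longrightarrow> S y - c * \<tau> * y = k" by blast
  show thesis
  proof (rule that[of "- k"])
    fix x :: real assume "0 < x" "x < 1"
    then show "T (monom 1 1) x = (a + b - 1) * \<tau> * x + - k"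
      using k[of x] S[of x] by (simp add: c_def algebra_simps)
  qed
qed

text \<open>The factor by which \<open>T\<close> multiplies the coefficient of degree \<open>n\<close> of polynomials of degree at most \<open>n\<close>.\<close>
definition lead :: "nat \<Rightarrow> real" where "lead n = \<tau> * pochhammer (a + b - 1) n / fact n"

lemma lead_Suc: "real (Suc n) * lead (Suc n) = (a + b - 1 + real n) * lead n"
  by (simp add: lead_def pochhammer_Suc field_simps del: of_nat_Suc)

lemma T_monom:
  "\<exists>q. degree q \<le> n \<and> coeff q n = lead n \<and> (\<forall>x\<in>{0<..<1}. T (monom 1 n) x = poly q x)"
proof (induction n rule: induct_nat_012)
  case 0
  have "T (monom 1 0) x = poly [:\<tau>:] x" if "x \<in> {0<..<1}" for x
    using that T_one_const[of x] by (simp add: monom_0 one_pCons)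
  then show ?case by (intro exI[of _ "[:\<tau>:]"]) (simp add: lead_def)
next
  case 1
  obtain k where k: "\<And>x. 0 < x \<Longrightarrow> x < 1 \<Longrightarrow> T (monom 1 1) x = (a + b - 1) * \<tau> * x + k"
    using T_linear_monom by blast
  show ?case
    by (intro exI[of _ "[:k, (a + b - 1) * \<tau>:]"]) (use k in \<open>simp add: lead_def\<close>)
next
  case (ge2 n)
  obtain p where p: "degree p \<le> n" "coeff p n = lead n" "\<And>x. x \<in> {0<..<1} \<Longrightarrow> T (monom 1 n) x = poly p x"
    using ge2.IH(1) by blast
  obtain q where q: "degree q \<le> Suc n" "coeff q (Suc n) = lead (Suc n)"
      "\<And>x. x \<in> {0<..<1} \<Longrightarrow> T (monom 1 (Suc n)) x = poly q x"
    using ge2.IH(2) by blast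
  define u where "u = smult (1 / (real n + 2)) ([:b + n + c, b + n + a:] * q - [:0, b + n:] * p)"
  have "degree ([:b + n + c, b + n + a:] * q) \<le> Suc (Suc n)"
    using degree_mult_le[of "[:b + n + c, b + n + a:]" q] q(1) degree_pCons_le[of "b + n + c" "[:b + n + a:]"] by simp
  moreover have "degree ([:0, b + n:] * p) \<le> Suc (Suc n)"
    using degree_mult_le[of "[:0, b + n:]" p] p(1) degree_pCons_le[of 0 "[:b + n:]"] by simp
  ultimately have deg: "degree u \<le> Suc (Suc n)"
    unfolding u_def by (intro order_trans[OF degree_smult_le] degree_diff_le)
  have "coeff p (Suc n) = 0" "coeff q (Suc (Suc n)) = 0"
    using p q by (auto intro!: coeff_eq_0)
  then have "coeff u (Suc (Suc n)) = (b + n + a) * lead (Suc n) / (real n + 2)"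
    using q by (simp add: u_def)
  also have "\<dots> = lead (Suc (Suc n))"
    using lead_Suc[of "Suc n"] by (simp add: field_simps)
  finally have co: "coeff u (Suc (Suc n)) = lead (Suc (Suc n))" .
  have "T (monom 1 (Suc (Suc n))) x = poly u x" if x: "x \<in> {0<..<1}" for x
  proof -
    have "(real n + 2) * T (monom 1 (Suc (Suc n))) x
        = ((b + n) * (1 + x) + a * x + c) * poly q x - (b + n) * x * poly p x"
      using T_recurrence[of x n] x p(3)[of x] q(3)[of x] by simp
    moreover have "(real n + 2) * poly u x = poly ([:b + n + c, b + n + a:] * q - [:0, b + n:] * p) x"
      by (simp add: u_def del: poly_diff poly_mult poly_pCons)
    moreover have "\<dots> = ((b + n) * (1 + x) + a * x + c) * poly q x - (b + n) * x * poly p x"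
      by (simp add: algebra_simps)
    ultimately have "(real n + 2) * T (monom 1 (Suc (Suc n))) x = (real n + 2) * poly u x" by simp
    then show ?thesis by (simp del: distrib_right_numeral)
  qed
  with deg co show ?case by blast
qed

lemma T_poly:
  assumes "degree p \<le> n"
  obtains q where "degree q \<le> n" "coeff q n = lead n * coeff p n"
    "\<And>x. x \<in> {0<..<1} \<Longrightarrow> T p x = poly q x"
proof -
  obtain t where t: "\<And>i. degree (t i) \<le> i" "\<And>i. coeff (t i) i = lead i"
     "\<And>i x. x \<in> {0<..<1} \<Longrightarrow> T (monom 1 i) x = poly (t i) x"
    using T_monom by metis
  define q where "q = (\<Sum>i\<le>n. smult (coeff p i) (t i))"
  have deg: "degree q \<le> n"
    unfolding q_def by (intro degree_sum_le order_trans[OF degree_smult_le] order_trans[OF t(1)]) auto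
  have "coeff q n = (\<Sum>i\<le>n. coeff p i * coeff (t i) n)" by (simp add: q_def coeff_sum)
  also have "\<dots> = (\<Sum>i\<le>n. if i = n then coeff p n * lead n else 0)"
    by (intro sum.cong refl) (use t in \<open>auto intro!: coeff_eq_0 le_less_trans[OF t(1)]\<close>)
  finally have co: "coeff q n = lead n * coeff p n" by simp
  have "T p x = poly q x" if x: "x \<in> {0<..<1}" for x
  proof -
    have "p = (\<Sum>i\<le>n. smult (coeff p i) (monom 1 i))"
      using poly_as_sum_of_monoms'[OF assms] by (simp add: smult_monom)
    then have "T p x = T (\<Sum>i\<le>n. smult (coeff p i) (monom 1 i)) x" by simp
    also have "\<dots> = (\<Sum>i\<le>n. coeff p i * T (monom 1 i) x)"
      using x by (simp add: T_sum T_smult)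
    also have "\<dots> = poly q x" using x by (simp add: q_def poly_sum t(3))
    finally show ?thesis .
  qed
  with deg co show thesis by (rule that)
qed

end

section \<open>Jacobi polynomials and weighted integration by parts\<close>

lemma alternating_sum_shift:
  fixes f :: "nat \<Rightarrow> real"
  shows "(\<Sum>m\<le>Suc n. (- 1) ^ m * real (Suc n choose m) * f m)
       = (\<Sum>m\<le>n. (- 1) ^ m * real (n choose m) * (f m - f (Suc m)))"
proof -
  have "(\<Sum>m\<le>Suc n. (- 1) ^ m * real (Suc n choose m) * f m)
      = f 0 + (\<Sum>m\<le>n. (- 1) ^ Suc m * real (Suc n choose Suc m) * f (Suc m))"
    by (subst sum.atMost_Suc_shift) simp
  also have "(\<Sum>m\<le>n. (- 1) ^ Suc m * real (Suc n choose Suc m) * f (Suc m))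
      = (\<Sum>m\<le>n. (- 1) ^ Suc m * real (n choose Suc m) * f (Suc m))
        - (\<Sum>m\<le>n. (- 1) ^ m * real (n choose m) * f (Suc m))"
    unfolding sum_subtractf[symmetric] by (intro sum.cong refl) (simp add: algebra_simps)
  also have "f 0 + ((\<Sum>m\<le>n. (- 1) ^ Suc m * real (n choose Suc m) * f (Suc m))
        - (\<Sum>m\<le>n. (- 1) ^ m * real (n choose m) * f (Suc m)))
      = (\<Sum>m\<le>Suc n. (- 1) ^ m * real (n choose m) * f m) - (\<Sum>m\<le>n. (- 1) ^ m * real (n choose m) * f (Suc m))"
    by (subst sum.atMost_Suc_shift) simp
  also have "(\<Sum>m\<le>Suc n. (- 1) ^ m * real (n choose m) * f m) = (\<Sum>m\<le>n. (- 1) ^ m * real (n choose m) * f m)"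
    by simp
  finally show ?thesis by (simp add: sum_subtractf right_diff_distrib)
qed

text \<open>An \<open>n\<close>-th finite difference annihilates polynomials of degree \<open>j < n\<close> in \<open>m\<close>; rising factorials are reproduced by
  a single difference, which gives the induction.\<close>
lemma alternating_sum_pochhammer:
  fixes z :: real
  assumes "j < n"
  shows "(\<Sum>m\<le>n. (- 1) ^ m * real (n choose m) * pochhammer (z + real m) j) = 0"
  using assms
proof (induction n arbitrary: j z)
  case (Suc n)
  show ?case
  proof (cases j)
    case 0
    show ?thesis unfolding alternating_sum_shift using 0 by simp
  next
    case (Suc i)
    have "pochhammer (z + real m) j - pochhammer (z + real (Suc m)) j
        = - real j * pochhammer (z + 1 + real m) i" for m
    proof -
      have "pochhammer (z + real m) (Suc i) = (z + real m) * pochhammer (z + real m + 1) i"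
        by (rule pochhammer_rec)
      moreover have "pochhammer (z + real m + 1) (Suc i) = pochhammer (z + real m + 1) i * (z + real m + 1 + real i)"
        by (rule pochhammer_Suc)
      ultimately show ?thesis using Suc by (simp add: algebra_simps)
    qed
    then have "(\<Sum>m\<le>Suc n. (- 1) ^ m * real (Suc n choose m) * pochhammer (z + real m) j)
        = - real j * (\<Sum>m\<le>n. (- 1) ^ m * real (n choose m) * pochhammer (z + 1 + real m) i)"
      unfolding alternating_sum_shift by (simp add: sum_distrib_left mult_ac)
    also have "\<dots> = 0" using Suc.IH[of i "z + 1"] Suc Suc.prems by simp
    finally show ?thesis .
  qed
qed simp

definition jacobi_G_poly :: "nat \<Rightarrow> real \<Rightarrow> real \<Rightarrow> real poly" where
  "jacobi_G_poly n a b = (\<Sum>m\<le>n. smult (((real n + a) gchoose m) * ((real n + b) gchoose (n - m)))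
     ([:-1, 1:] ^ (n - m) * [:0, 1:] ^ m))"

lemma poly_jacobi_G_poly: "poly (jacobi_G_poly n a b) x = jacobi_G n a b x"
proof -
  have eq: "(2 * x - 1 - 1) / 2 = x - 1" "(2 * x - 1 + 1) / 2 = x" by (simp_all add: field_simps)
  show ?thesis
    unfolding jacobi_G_poly_def jacobi_G_def jacobi_poly_def eq
    by (simp add: poly_sum poly_power mult_ac)
qed

lemma monic_product:
  "degree ([:-1, 1::real:] ^ k * [:0, 1:] ^ m) = k + m" "coeff ([:-1, 1::real:] ^ k * [:0, 1:] ^ m) (k + m) = 1"
proof -
  show deg: "degree ([:-1, 1::real:] ^ k * [:0, 1:] ^ m) = k + m"
    by (subst degree_mult_eq) (simp_all add: degree_power_eq)
  have "lead_coeff ([:-1, 1::real:] ^ k * [:0, 1:] ^ m) = 1"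
    by (simp add: lead_coeff_mult lead_coeff_power)
  then show "coeff ([:-1, 1::real:] ^ k * [:0, 1:] ^ m) (k + m) = 1" using deg by simp
qed

lemma degree_jacobi_G_poly: "degree (jacobi_G_poly n a b) \<le> n"
  unfolding jacobi_G_poly_def
  by (intro degree_sum_le order_trans[OF degree_smult_le]) (auto simp: monic_product)

lemma gbinomial_real_pos: "0 < z gchoose k" if "real k < z + 1" for z :: real
proof -
  have "0 < (\<Prod>i = 0..<k. z - real i)"
    using that by (intro prod_pos) auto
  then show ?thesis by (simp add: gbinomial_prod_rev)
qed

text \<open>Every summand of the defining sum is a positive multiple of a monic polynomial of degree \<open>n\<close>, so
  no cancellation can lower the degree.\<close>
lemma coeff_jacobi_G_poly_pos:
  assumes "0 < a" "0 < b"
  shows "0 < coeff (jacobi_G_poly n a b) n"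
proof -
  have "coeff (jacobi_G_poly n a b) n = (\<Sum>m\<le>n. ((real n + a) gchoose m) * ((real n + b) gchoose (n - m)))"
    unfolding jacobi_G_poly_def coeff_sum
  proof (intro sum.cong refl)
    fix m assume "m \<in> {..n}"
    then have "coeff ([:-1, 1::real:] ^ (n - m) * [:0, 1:] ^ m) n = 1"
      using monic_product(2)[of "n - m" m] by simp
    then show "coeff (smult (((real n + a) gchoose m) * ((real n + b) gchoose (n - m)))
       ([:-1, 1:] ^ (n - m) * [:0, 1:] ^ m)) n = ((real n + a) gchoose m) * ((real n + b) gchoose (n - m))"
      by simp
  qed
  also have "\<dots> > 0"
    using assms by (intro sum_pos mult_pos_pos gbinomial_real_pos) auto
  finally show ?thesis .
qed

lemma has_integral_jac_weight_Beta:
  fixes a b :: real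
  assumes "- 1 < a" "- 1 < b"
  shows "((\<lambda>x. jac_weight a b x * ((1 - x) ^ k * x ^ m)) has_integral Beta (b + m + 1) (a + k + 1)) {0..1}"
proof -
  have "((\<lambda>t. t powr (b + m + 1 - 1) * (1 - t) powr (a + k + 1 - 1)) has_integral Beta (b + m + 1) (a + k + 1)) {0..1}"
    by (rule has_integral_Beta_real) (use assms in auto)
  then show ?thesis
  proof (rule has_integral_spike_finite[of "{0, 1}", rotated 2])
    fix x :: real assume x: "x \<in> {0..1} - {0, 1}"
    then have "x powr (b + m) = x powr b * x ^ m" "(1 - x) powr (a + k) = (1 - x) powr a * (1 - x) ^ k"
      by (auto simp: powr_add powr_realpow)
    then show "jac_weight a b x * ((1 - x) ^ k * x ^ m) = x powr (b + m + 1 - 1) * (1 - x) powr (a + k + 1 - 1)"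
      by (simp add: jac_weight_def)
  qed simp
qed

lemma jac_weight_poly_integrable:
  fixes a b :: real
  assumes "- 1 < a" "- 1 < b"
  shows "set_integrable lebesgue {0<..<1} (\<lambda>x. jac_weight a b x * poly p x)"
proof -
  have "(\<lambda>x. jac_weight a b x) absolutely_integrable_on {0..1}"
    using has_integral_jac_weight_Beta[OF assms, of 0 0]
    by (intro nonnegative_absolutely_integrable_1) (auto simp: jac_weight_def integrable_on_def)
  then have 1: "(\<lambda>x. jac_weight a b x) absolutely_integrable_on {0<..<1}"
    by (rule set_integrable_subset) auto
  obtain B where "\<And>x. x \<in> {0<..<1} \<Longrightarrow> \<bar>poly p x\<bar> \<le> B"
    using poly_bounded_01[of p] by blast
  then have "bounded (poly p ` {0<..<1})" by (auto intro!: boundedI[of _ B])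
  then have "(\<lambda>x. poly p x * jac_weight a b x) absolutely_integrable_on {0<..<1}"
    by (intro absolutely_integrable_bounded_measurable_product_real[OF _ _ _ 1]
          measurable_restrict_space1 measurable_completion) auto
  then show ?thesis by (simp add: mult.commute)
qed

definition jac_int :: "real \<Rightarrow> real \<Rightarrow> real poly \<Rightarrow> real" where
  "jac_int a b p = (LINT x:{0<..<1}|lebesgue. jac_weight a b x * poly p x)"

lemma jac_int_add: "jac_int a b (p + q) = jac_int a b p + jac_int a b q" if "- 1 < a" "- 1 < b"
  unfolding jac_int_def using jac_weight_poly_integrable[OF that]
  by (simp add: distrib_left set_integral_add)

lemma jac_int_smult: "jac_int a b (smult k p) = k * jac_int a b p"
  unfolding jac_int_def by (simp add: mult.left_commute[of _ k] flip: set_integral_mult_right)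

lemma jac_int_sum: "jac_int a b (\<Sum>i\<in>I. f i) = (\<Sum>i\<in>I. jac_int a b (f i))" if "- 1 < a" "- 1 < b"
proof (induction I rule: infinite_finite_induct)
  case (infinite I)
  then show ?case using jac_int_smult[of a b 0 0] by simp
next
  case empty
  then show ?case using jac_int_smult[of a b 0 0] by simp
next
  case (insert i I)
  then show ?case by (simp add: jac_int_add[OF that])
qed

lemma jac_int_eq_integral:
  assumes "- 1 < a" "- 1 < b"
  shows "jac_int a b p = integral {0..1} (\<lambda>x. jac_weight a b x * poly p x)"
  using set_lebesgue_integral_eq_integral(2)[OF jac_weight_poly_integrable[OF assms, of p]]
  by (simp add: jac_int_def integral_open_interval_real)

text \<open>Each summand integrates to a Beta value, and the Gamma factors of the binomial coefficients cancel those of the Beta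
  values except for a rising factorial of length \<open>j\<close>. What remains is an alternating binomial sum of order \<open>n > j\<close>.\<close>
lemma jacobi_orthogonal_monom:
  assumes ab: "0 < a" "0 < b" and j: "j < n"
  shows "jac_int a b (jacobi_G_poly n a b * monom 1 j) = 0"
proof -
  let ?C = "\<lambda>m. ((real n + a) gchoose m) * ((real n + b) gchoose (n - m))"
    and ?q = "\<lambda>m. [:-1, 1::real:] ^ (n - m) * [:0, 1:] ^ m"
    and ?R = "rGamma (a + b + n + j + 2)"
  define K where "K = (- 1) ^ n / fact n * (Gamma (real n + a + 1) * Gamma (real n + b + 1) * ?R)"
  have summand: "jac_int a b (smult (?C m) (?q m) * monom 1 j)
      = K * ((- 1) ^ m * real (n choose m) * pochhammer (b + 1 + real m) j)"
    if m: "m \<le> n" for m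
  proof -
    have "jac_int a b (smult (?C m) (?q m) * monom 1 j)
      = ?C m * jac_int a b (?q m * monom 1 j)"
      by (simp add: jac_int_smult)
    also have "jac_int a b (?q m * monom 1 j)
       = integral {0..1} (\<lambda>x. (- 1) ^ (n - m) * (jac_weight a b x * ((1 - x) ^ (n - m) * x ^ (m + j))))"
    proof (subst jac_int_eq_integral)
      have "(x - 1) ^ (n - m) = (- 1) ^ (n - m) * (1 - x) ^ (n - m)" for x :: real
        by (simp flip: power_mult_distrib)
      then show "integral {0..1} (\<lambda>x. jac_weight a b x * poly ([:- 1, 1:] ^ (n - m) * [:0, 1:] ^ m * monom 1 j) x) =
        integral {0..1} (\<lambda>x. (- 1) ^ (n - m) * (jac_weight a b x * ((1 - x) ^ (n - m) * x ^ (m + j))))"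
        by (intro integral_cong) (simp add: poly_power poly_monom power_add mult_ac)
    qed (use ab in auto)
    also have "\<dots> = (- 1) ^ (n - m) * Beta (b + real (m + j) + 1) (a + real (n - m) + 1)"
      using has_integral_mult_right[OF has_integral_jac_weight_Beta[of a b "n - m" "m + j"]] ab
      by (intro integral_unique) auto
    also have "Beta (b + real (m + j) + 1) (a + real (n - m) + 1)
      = (pochhammer (b + 1 + real m) j * Gamma (b + real m + 1)) * Gamma (a + real (n - m) + 1) * ?R"
    proof -
      have "Gamma (b + real (m + j) + 1) = pochhammer (b + 1 + real m) j * Gamma (b + real m + 1)"
      proof -
        have "b + 1 + real m \<notin> \<int>\<^sub>\<le>\<^sub>0" using ab by (auto elim!: nonpos_Ints_cases')
        moreover have "0 < Gamma (b + 1 + real m)" using ab by (intro Gamma_real_pos) simp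
        ultimately show ?thesis
          using pochhammer_Gamma[of "b + 1 + real m" j] by (simp add: add_ac)
      qed
      moreover have "b + real (m + j) + 1 + (a + real (n - m) + 1) = a + b + n + j + 2"
        using m by simp
      ultimately show ?thesis by (simp only: Beta_altdef)
    qed
    also have "?C m * ((- 1) ^ (n - m) *
        ((pochhammer (b + 1 + real m) j * Gamma (b + real m + 1)) * Gamma (a + real (n - m) + 1) * ?R))
      = (((real n + a) gchoose m) * Gamma (a + real (n - m) + 1)) * (((real n + b) gchoose (n - m)) * Gamma (b + real m + 1))
        * (- 1) ^ (n - m) * pochhammer (b + 1 + real m) j * ?R"
      by (simp only: mult_ac)
    also have "((real n + a) gchoose m) * Gamma (a + real (n - m) + 1) = Gamma (real n + a + 1) / fact m"
    proof -
      have "real n + a + 1 \<notin> \<int>\<^sub>\<le>\<^sub>0" using ab by (auto elim!: nonpos_Ints_cases')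
      then have "(real n + a) gchoose m = Gamma (real n + a + 1) / (fact m * Gamma (real n + a - real m + 1))"
        by (rule gbinomial_Gamma)
      also have "real n + a - real m + 1 = a + real (n - m) + 1" using m by simp
      finally have eq: "(real n + a) gchoose m = Gamma (real n + a + 1) / (fact m * Gamma (a + real (n - m) + 1))" .
      have "0 < Gamma (a + real (n - m) + 1)" using ab by (intro Gamma_real_pos) simp
      then show ?thesis unfolding eq by (simp del: of_nat_diff)
    qed
    also have "((real n + b) gchoose (n - m)) * Gamma (b + real m + 1) = Gamma (real n + b + 1) / fact (n - m)"
    proof -
      have "real n + b + 1 \<notin> \<int>\<^sub>\<le>\<^sub>0" using ab by (auto elim!: nonpos_Ints_cases')
      then have "(real n + b) gchoose (n - m) = Gamma (real n + b + 1) / (fact (n - m) * Gamma (real n + b - real (n - m) + 1))"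
        by (rule gbinomial_Gamma)
      also have "real n + b - real (n - m) + 1 = b + real m + 1" using m by simp
      finally have eq: "(real n + b) gchoose (n - m) = Gamma (real n + b + 1) / (fact (n - m) * Gamma (b + real m + 1))" .
      have "0 < Gamma (b + real m + 1)" using ab by (intro Gamma_real_pos) simp
      then show ?thesis unfolding eq by simp
    qed
    also have "Gamma (real n + a + 1) / fact m * (Gamma (real n + b + 1) / fact (n - m)) * (- 1) ^ (n - m)
        * pochhammer (b + 1 + real m) j * ?R
        = K * ((- 1) ^ m * real (n choose m) * pochhammer (b + 1 + real m) j)"
    proof -
      have "(- 1 :: real) ^ (n - m) = (- 1) ^ n * (- 1) ^ m"
      proof -
        have "(- 1 :: real) ^ n = (- 1) ^ (n - m) * (- 1) ^ m"
          using m by (simp flip: power_add)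
        then show ?thesis by (simp add: mult.assoc flip: power_mult_distrib)
      qed
      moreover have "real (n choose m) = fact n / (fact m * fact (n - m))"
        using m by (rule binomial_fact)
      ultimately show ?thesis by (simp add: K_def)
    qed
    finally show ?thesis .
  qed
  have "jac_int a b (jacobi_G_poly n a b * monom 1 j) =
      (\<Sum>m\<le>n. jac_int a b (smult (?C m) (?q m) * monom 1 j))"
    unfolding jacobi_G_poly_def sum_distrib_right using ab by (intro jac_int_sum) auto
  also have "\<dots> = (\<Sum>m\<le>n. K * ((- 1) ^ m * real (n choose m) * pochhammer (b + 1 + real m) j))"
    by (intro sum.cong refl summand) simp
  also have "\<dots> = 0"
    using alternating_sum_pochhammer[OF j, of "b + 1"] by (simp flip: sum_distrib_left)
  finally show ?thesis .
qed

text \<open>Stated without division: for \<open>p\<close> of degree at most \<open>n\<close> only the coefficient of degree \<open>n\<close> matters for the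
  scalar product with \<open>G\<^sub>n\<close>. For \<open>p\<close> of smaller degree this is orthogonality.\<close>
lemma jacobi_orthogonal:
  assumes ab: "0 < a" "0 < b" and p: "degree p \<le> n"
  shows "coeff (jacobi_G_poly n a b) n * jac_int a b (jacobi_G_poly n a b * p)
       = coeff p n * jac_int a b (jacobi_G_poly n a b * jacobi_G_poly n a b)"
proof -
  let ?P = "jacobi_G_poly n a b"
  have low: "jac_int a b (?P * q) = 0" if "\<And>i. n \<le> i \<Longrightarrow> coeff q i = 0" for q
  proof -
    have "q = (\<Sum>i\<le>degree q. smult (coeff q i) (monom 1 i))"
      using poly_as_sum_of_monoms[of q] by (simp add: smult_monom)
    then have "jac_int a b (?P * q) = jac_int a b (\<Sum>i\<le>degree q. smult (coeff q i) (?P * monom 1 i))"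
      by (metis (no_types, lifting) mult_smult_right sum.cong sum_distrib_left)
    also have "\<dots> = (\<Sum>i\<le>degree q. coeff q i * jac_int a b (?P * monom 1 i))"
      using ab by (subst jac_int_sum) (auto simp: jac_int_smult)
    also have "\<dots> = 0"
      using jacobi_orthogonal_monom[OF ab] that by (intro sum.neutral) (metis leI mult_eq_0_iff)
    finally show ?thesis .
  qed
  have "jac_int a b (?P * (smult (coeff ?P n) p + smult (- coeff p n) ?P)) = 0"
  proof (rule low)
    fix i assume "n \<le> i"
    then show "coeff (smult (coeff ?P n) p + smult (- coeff p n) ?P) i = 0"
      using p degree_jacobi_G_poly[of n a b] by (cases "i = n") (simp_all add: coeff_eq_0)
  qed
  moreover have "jac_int a b (?P * (smult (coeff ?P n) p + smult (- coeff p n) ?P))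
      = coeff ?P n * jac_int a b (?P * p) + (- coeff p n) * jac_int a b (?P * ?P)"
    unfolding distrib_left mult_smult_right using ab by (subst jac_int_add) (simp_all only: jac_int_smult)
  ultimately show ?thesis by simp
qed

text \<open>The polynomial \<open>q\<close> with \<open>(\<omega>\<^bsup>(a,b)\<^esup> p)' = \<omega>\<^bsup>(a-1,b-1)\<^esup> q\<close>.\<close>
definition weighted_deriv :: "real \<Rightarrow> real \<Rightarrow> real poly \<Rightarrow> real poly" where
  "weighted_deriv a b p = [:b, - (a + b):] * p + [:0, 1, -1:] * pderiv p"

lemma weighted_deriv:
  assumes "0 < s" "s < 1"
  shows "((\<lambda>s. jac_weight a b s * poly p s) has_real_derivative
           jac_weight (a - 1) (b - 1) s * poly (weighted_deriv a b p) s) (at s)"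
proof -
  have s1: "s powr b = s * s powr (b - 1)" "(1 - s) powr a = (1 - s) * (1 - s) powr (a - 1)"
    using assms powr_mult_base[of s "b - 1"] powr_mult_base[of "1 - s" "a - 1"] by auto
  have "((\<lambda>s. (1 - s) powr a * s powr b * poly p s) has_real_derivative
      (a * (1 - s) powr (a - 1) * (- 1)) * s powr b * poly p s + (1 - s) powr a * (b * s powr (b - 1)) * poly p s
      + (1 - s) powr a * s powr b * poly (pderiv p) s) (at s)"
    using assms by (auto intro!: derivative_eq_intros simp: algebra_simps)
  also have "(a * (1 - s) powr (a - 1) * (- 1)) * s powr b * poly p s + (1 - s) powr a * (b * s powr (b - 1)) * poly p s
      + (1 - s) powr a * s powr b * poly (pderiv p) s
      = jac_weight (a - 1) (b - 1) s * poly (weighted_deriv a b p) s"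
    unfolding s1 jac_weight_def weighted_deriv_def by (simp add: algebra_simps)
  finally show ?thesis unfolding jac_weight_def .
qed

lemma weighted_deriv_add: "weighted_deriv a b (p + q) = weighted_deriv a b p + weighted_deriv a b q"
  by (simp only: weighted_deriv_def pderiv_add distrib_left add_ac)

lemma weighted_deriv_smult: "weighted_deriv a b (smult k p) = smult k (weighted_deriv a b p)"
  by (simp only: weighted_deriv_def pderiv_smult mult_smult_right smult_add_right)

text \<open>The boundary terms vanish because both exponents are positive. The remaining two integrals carry
  different weights, related by \<open>\<omega>\<^bsup>(a,b)\<^esup> = x (1 - x) \<omega>\<^bsup>(a-1,b-1)\<^esup>\<close>.\<close>
lemma jac_int_by_parts:
  assumes "0 < a" "0 < b"
  shows "jac_int (a - 1) (b - 1) (weighted_deriv a b p * q) = - jac_int a b (p * pderiv q)"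
proof -
  have d: "((\<lambda>s. jac_weight a b s * poly (p * q) s) has_vector_derivative
      jac_weight (a - 1) (b - 1) s * poly (weighted_deriv a b (p * q)) s) (at s)" if "s \<in> {0<..<1}" for s
    using weighted_deriv[of s a b "p * q"] that by (simp add: has_real_derivative_iff_has_vector_derivative)
  have "((\<lambda>s. jac_weight (a - 1) (b - 1) s * poly (weighted_deriv a b (p * q)) s) has_integral
      (jac_weight a b 1 * poly (p * q) 1 - jac_weight a b 0 * poly (p * q) 0)) {0..1}"
  proof (rule fundamental_theorem_of_calculus_interior)
    show "continuous_on {0..1} (\<lambda>s. jac_weight a b s * poly (p * q) s)"
      unfolding jac_weight_def using assms
      by (intro continuous_on_mult continuous_on_powr' continuous_intros) auto
  qed (use d in auto)
  then have 0: "jac_int (a - 1) (b - 1) (weighted_deriv a b (p * q)) = 0"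
    using assms by (simp add: jac_int_eq_integral integral_unique jac_weight_def)
  have "weighted_deriv a b (p * q) = weighted_deriv a b p * q + [:0, 1, -1:] * (p * pderiv q)"
    by (simp add: weighted_deriv_def pderiv_mult algebra_simps)
  then have "jac_int (a - 1) (b - 1) (weighted_deriv a b p * q) + jac_int (a - 1) (b - 1) ([:0, 1, -1:] * (p * pderiv q)) = 0"
    using 0 assms by (simp add: jac_int_add)
  moreover have "jac_int (a - 1) (b - 1) ([:0, 1, -1:] * (p * pderiv q)) = jac_int a b (p * pderiv q)"
    unfolding jac_int_def
  proof (rule set_lebesgue_integral_cong)
    show "\<forall>s. s \<in> {0<..<1} \<longrightarrow> jac_weight (a - 1) (b - 1) s * poly ([:0, 1, -1:] * (p * pderiv q)) s
        = jac_weight a b s * poly (p * pderiv q) s"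
    proof (intro allI impI)
      fix s :: real assume s: "s \<in> {0<..<1}"
      have s1: "s powr b = s * s powr (b - 1)" "(1 - s) powr a = (1 - s) * (1 - s) powr (a - 1)"
        using s powr_mult_base[of s "b - 1"] powr_mult_base[of "1 - s" "a - 1"] by auto
      show "jac_weight (a - 1) (b - 1) s * poly ([:0, 1, -1:] * (p * pderiv q)) s
        = jac_weight a b s * poly (p * pderiv q) s"
        unfolding jac_weight_def s1 by (simp add: algebra_simps)
    qed
  qed simp
  ultimately show ?thesis by simp
qed

lemma coeff_weighted_deriv:
  assumes "degree p \<le> n"
  shows "degree (weighted_deriv a b p) \<le> Suc n" "coeff (weighted_deriv a b p) (Suc n) = - (a + b + real n) * coeff p n"
proof -
  have "degree ([:b, - (a + b):] * p) \<le> Suc n"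
    using degree_mult_le[of "[:b, - (a + b):]" p] assms degree_pCons_le[of b "[:- (a + b):]"] by simp
  moreover have "degree ([:0, 1, -1:] * pderiv p) \<le> Suc n"
  proof (cases "degree p = 0")
    case False
    then show ?thesis using degree_mult_le[of "[:0, 1, -1:]" "pderiv p"] assms by (simp add: degree_pderiv)
  next
    case True
    then show ?thesis by (metis degree_0 le0 mult_zero_right pderiv_eq_0_iff)
  qed
  ultimately show "degree (weighted_deriv a b p) \<le> Suc n"
    unfolding weighted_deriv_def by (rule degree_add_le)
  have "coeff p (Suc n) = 0" "coeff p (Suc (Suc n)) = 0" using assms by (auto intro!: coeff_eq_0)
  then show "coeff (weighted_deriv a b p) (Suc n) = - (a + b + real n) * coeff p n"
    unfolding weighted_deriv_def by (cases n) (simp_all add: coeff_pderiv algebra_simps)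
qed

lemma frac_op_eq_jacobi_riesz:
  fixes a b x :: real
  assumes a: "0 < a" "a \<le> 1" and b: "0 < b" "b \<le> 1" and ab: "a + b < 2" and x: "0 < x" "x < 1"
  shows "frac_op (a + b) r (\<lambda>s. jac_weight a b s * poly p s) x
       = - (1 / Gamma (2 - a - b)) * jacobi_riesz r (1 - r) a b (weighted_deriv a b p) x"
proof -
  let ?q = "weighted_deriv a b p"
  let ?u = "\<lambda>s. jac_weight a b s * poly p s"
  let ?f = "\<lambda>s. jac_weight (a - 1) (b - 1) s * poly ?q s"
  define c where "c = 2 - a - b"
  let ?k = "\<lambda>\<rho> \<sigma> s. riesz_kernel \<rho> \<sigma> c x s * jac_weight (a - 1) (b - 1) s * poly ?q s"
  have c: "0 < c" "2 - (a + b) = c" using ab by (auto simp: c_def)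
  let ?L = "LINT s:{0<..<x}|lebesgue. deriv ?u s * (x - s) powr (c - 1)"
    and ?R = "LINT s:{x<..<1}|lebesgue. deriv ?u s * (s - x) powr (c - 1)"
  have du: "deriv ?u s = ?f s" if "0 < s" "s < 1" for s
    using weighted_deriv[OF that] by (rule DERIV_imp_deriv)
  have L: "?L
      = (LINT s:{0<..<1}|lebesgue. ?k 1 0 s)"
    unfolding set_lebesgue_integral_def
    by (rule Bochner_Integration.integral_cong)
       (use x du in \<open>auto simp: riesz_kernel_def indicator_def\<close>)
  have R: "?R
      = (LINT s:{0<..<1}|lebesgue. ?k 0 1 s)"
    unfolding set_lebesgue_integral_def
    by (rule Bochner_Integration.integral_cong)
       (use x du in \<open>auto simp: riesz_kernel_def indicator_def\<close>)
  have "jacobi_riesz r (1 - r) a b ?q x =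
     (LINT s:{0<..<1}|lebesgue.
        r * (?k 1 0 s)
        + (1 - r) * (?k 0 1 s))"
    unfolding jacobi_riesz_def c_def set_lebesgue_integral_def
    by (rule Bochner_Integration.integral_cong) (auto simp: riesz_kernel_def indicator_def)
  also have "\<dots> = r * ?L
     + (1 - r) * ?R"
    unfolding L R using riesz_kernel_absolutely_integrable[OF a b c(1) x]
    by (subst set_integral_add) auto
  finally have J: "jacobi_riesz r (1 - r) a b ?q x =
      r * ?L
     + (1 - r) * ?R" .
  show ?thesis
    unfolding frac_op_def left_frac_int_def right_frac_int_def c(2) c_def[symmetric] J
    by (simp add: distrib_left mult_ac)
qed

section \<open>Duality of the two-sided operators\<close>

lemma borel_measurable_jac_weight [measurable]: "jac_weight a b \<in> borel_measurable borel"
  unfolding jac_weight_def by measurable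

lemma borel_measurable_riesz_kernel [measurable]:
  assumes [measurable]: "f \<in> borel_measurable M" "g \<in> borel_measurable M"
  shows "(\<lambda>z. riesz_kernel \<rho> \<sigma> c (f z) (g z)) \<in> borel_measurable M"
  unfolding riesz_kernel_def by measurable

lemma set_integral_lebesgue_lborel:
  fixes f :: "real \<Rightarrow> real"
  assumes [measurable]: "f \<in> borel_measurable borel" "A \<in> sets borel"
  shows "(LINT x:A|lebesgue. f x) = (LINT x|lborel. indicator A x * f x)"
    and "set_integrable lebesgue A f \<longleftrightarrow> integrable lborel (\<lambda>x. indicator A x * f x)"
proof -
  have m: "(\<lambda>x. indicator A x * f x) \<in> borel_measurable lborel" by measurable
  show "(LINT x:A|lebesgue. f x) = (LINT x|lborel. indicator A x * f x)"
    unfolding set_lebesgue_integral_def using integral_completion[OF m] by simp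
  show "set_integrable lebesgue A f \<longleftrightarrow> integrable lborel (\<lambda>x. indicator A x * f x)"
    unfolding set_integrable_def using integrable_completion[OF m] by simp
qed

lemma (in balanced_kernel) lead_pos: "0 < lead n"
  unfolding lead_def using \<tau>_pos ab by (auto intro!: divide_pos_pos mult_pos_pos pochhammer_pos)

context balanced_kernel
begin

sublocale dual: balanced_kernel b a \<sigma> \<rho>
  using a b ab \<rho>\<sigma> balance by unfold_locales (auto simp: add_ac)

text \<open>Fubini's theorem: exchanging the roles of \<open>x\<close> and \<open>s\<close> in the kernel exchanges \<open>\<rho>\<close> and \<open>\<sigma>\<close>. Absolute
  integrability comes from the case without polynomial factors, where the inner integral is the
  constant \<open>\<tau>\<close> times an integrable weight.\<close>
lemma T_duality:
  "(LINT x:{0<..<1}|lebesgue. jac_weight (b - 1) (a - 1) x * (poly m x * T q x))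
   = (LINT s:{0<..<1}|lebesgue. jac_weight (a - 1) (b - 1) s * (poly q s * jacobi_riesz \<sigma> \<rho> b a m s))"
proof -
  let ?w = "jac_weight (a - 1) (b - 1)" and ?v = "jac_weight (b - 1) (a - 1)"
  let ?k = "\<lambda>x s. riesz_kernel \<rho> \<sigma> c x s * ?w s"
  define I where "I = indicat_real {0<..<1::real}"
  have [measurable]: "I \<in> borel_measurable borel" unfolding I_def by measurable
  define F0 where "F0 x s = I x * I s * ?k x s * ?v x" for x s
  define F where "F x s = F0 x s * (poly q s * poly m x)" for x s
  have F0_nonneg: "0 \<le> F0 x s" for x s
    unfolding F0_def I_def riesz_kernel_def jac_weight_def using \<rho>\<sigma> by simp
  have measF0 [measurable]: "case_prod F0 \<in> borel_measurable (lborel \<Otimes>\<^sub>M lborel)"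
    unfolding F0_def by measurable
  have measF [measurable]: "case_prod F \<in> borel_measurable (lborel \<Otimes>\<^sub>M lborel)"
    unfolding F_def F0_def by measurable
  have T_lborel: "I x * T p x = (LINT s|lborel. I x * I s * (?k x s * poly p s))" for x p
    unfolding jacobi_riesz_def c_def[symmetric] I_def
    by (subst set_integral_lebesgue_lborel) (auto simp: mult.assoc)
  have T_int: "integrable lborel (\<lambda>s. I x * I s * (?k x s * poly p s))" for x p
  proof (cases "x \<in> {0<..<1}")
    case True
    then have "integrable lborel (\<lambda>s. I s * (?k x s * poly p s))"
      using T_integrable[of x p] unfolding I_def
      by (subst set_integral_lebesgue_lborel(2)[symmetric]) auto
    then have "integrable lborel (\<lambda>s. I x * (I s * (?k x s * poly p s)))"
      by (rule integrable_mult_right)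
    then show ?thesis by (simp add: mult.assoc)
  qed (simp add: I_def)
  have F0_eq: "F0 x s = ?v x * (I x * I s * (?k x s * poly 1 s))" for x s
    unfolding F0_def by simp
  have int0: "integrable (lborel \<Otimes>\<^sub>M lborel) (case_prod F0)"
  proof (rule lborel_pair.Fubini_integrable)
    show "AE x in lborel. integrable lborel (\<lambda>y. case (x, y) of (x, y) \<Rightarrow> F0 x y)"
      unfolding prod.case F0_eq by (intro AE_I2 integrable_mult_right T_int)
    have "(LINT y|lborel. norm (F0 x y)) = \<tau> * (I x * (?v x * poly 1 x))" for x
    proof -
      have "(LINT y|lborel. norm (F0 x y)) = (LINT y|lborel. F0 x y)"
        using F0_nonneg by simp
      also have "\<dots> = ?v x * (I x * T 1 x)"
        unfolding T_lborel F0_eq by simp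
      also have "I x * T 1 x = I x * \<tau>" using T_one_const[of x] by (simp add: I_def indicator_def)
      finally show ?thesis by simp
    qed
    then have "(\<lambda>x. LINT y|lborel. norm (case (x, y) of (x, y) \<Rightarrow> F0 x y))
        = (\<lambda>x. \<tau> * (I x * (?v x * poly 1 x)))" by simp
    moreover have "integrable lborel (\<lambda>x. I x * (?v x * poly 1 x))"
      using jac_weight_poly_integrable[of "b - 1" "a - 1" 1] a b unfolding I_def
      by (subst set_integral_lebesgue_lborel(2)[symmetric]) auto
    ultimately show "integrable lborel (\<lambda>x. LINT y|lborel. norm (case (x, y) of (x, y) \<Rightarrow> F0 x y))"
      by simp
  qed measurable
  obtain Bq where Bq: "0 \<le> Bq" "\<And>x. x \<in> {0<..<1} \<Longrightarrow> \<bar>poly q x\<bar> \<le> Bq" by (rule poly_bounded_01[of q]) blast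
  obtain Bm where Bm: "0 \<le> Bm" "\<And>x. x \<in> {0<..<1} \<Longrightarrow> \<bar>poly m x\<bar> \<le> Bm" by (rule poly_bounded_01[of m]) blast
  have int: "integrable (lborel \<Otimes>\<^sub>M lborel) (case_prod F)"
  proof (rule Bochner_Integration.integrable_bound)
    show "integrable (lborel \<Otimes>\<^sub>M lborel) (\<lambda>z. case_prod F0 z * (Bq * Bm))"
      using int0 by (rule integrable_mult_left)
    show "AE z in lborel \<Otimes>\<^sub>M lborel. norm (case_prod F z) \<le> norm (case_prod F0 z * (Bq * Bm))"
    proof (rule AE_I2, clarify)
      fix x s
      show "norm (F x s) \<le> norm (F0 x s * (Bq * Bm))"
      proof (cases "x \<in> {0<..<1} \<and> s \<in> {0<..<1}")
        case True
        have "norm (F x s) = F0 x s * (\<bar>poly q s\<bar> * \<bar>poly m x\<bar>)"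
          using F0_nonneg[of x s] by (simp add: F_def abs_mult)
        also have "\<dots> \<le> F0 x s * (Bq * Bm)"
          using Bq Bm True F0_nonneg[of x s] by (intro mult_left_mono mult_mono) auto
        finally show ?thesis using F0_nonneg[of x s] Bq(1) Bm(1) by simp
      next
        case False
        then have "F0 x s = 0" by (auto simp: F0_def I_def)
        then show ?thesis by (simp add: F_def)
      qed
    qed
  qed measurable
  have "(LINT x:{0<..<1}|lebesgue. ?v x * (poly m x * T q x))
      = (LINT x:{0<..<1}|lebesgue. ?v x * (poly m x * (I x * T q x)))"
    by (rule set_lebesgue_integral_cong) (auto simp: I_def)
  also have "\<dots> = (LINT x|lborel. LINT s|lborel. F x s)"
  proof -
    have Fx: "I x * (?v x * (poly m x * (I x * T q x))) = (LINT s|lborel. F x s)" for x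
    proof -
      have "(LINT s|lborel. F x s) = (LINT s|lborel. (?v x * poly m x) *
          (I x * I s * (?k x s * poly q s)))"
        by (rule Bochner_Integration.integral_cong) (auto simp: F_def F0_def mult_ac)
      also have "\<dots> = ?v x * poly m x * (I x * T q x)"
        unfolding T_lborel by simp
      also have "\<dots> = I x * (?v x * (poly m x * (I x * T q x)))"
        by (auto simp: I_def indicator_def)
      finally show ?thesis by simp
    qed
    have "(\<lambda>x. I x * T q x) \<in> borel_measurable borel"
      unfolding T_lborel by measurable
    then have mg: "(\<lambda>x. ?v x * (poly m x * (I x * T q x))) \<in> borel_measurable borel"
      by measurable
    show ?thesis
      using set_integral_lebesgue_lborel(1)[OF mg, of "{0<..<1}"] unfolding I_def[symmetric] Fx by simp
  qed
  also have "\<dots> = (LINT s|lborel. LINT x|lborel. F x s)"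
    using lborel_pair.Fubini_integral[OF int] by simp
  also have "\<dots> = (LINT s:{0<..<1}|lebesgue. ?w s * (poly q s * (I s * jacobi_riesz \<sigma> \<rho> b a m s)))"
  proof -
    have kern: "riesz_kernel \<rho> \<sigma> c x s = riesz_kernel \<sigma> \<rho> c s x" for x s
      unfolding riesz_kernel_def by (cases x s rule: linorder_cases) (auto simp: abs_minus_commute)
    have c': "2 - b - a = c" by (simp add: c_def)
    have T'_lborel: "I s * jacobi_riesz \<sigma> \<rho> b a m s = (LINT x|lborel. I s * I x * (riesz_kernel \<sigma> \<rho> c s x * ?v x * poly m x))" for s
      unfolding jacobi_riesz_def c' I_def
      by (subst set_integral_lebesgue_lborel) (auto simp: mult.assoc)
    have Fs: "I s * (?w s * (poly q s * (I s * jacobi_riesz \<sigma> \<rho> b a m s))) = (LINT x|lborel. F x s)" for s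
    proof -
      have "(LINT x|lborel. F x s) = (LINT x|lborel. (?w s * poly q s) *
          (I s * I x * (riesz_kernel \<sigma> \<rho> c s x * ?v x * poly m x)))"
        by (rule Bochner_Integration.integral_cong) (auto simp: F_def F0_def kern mult_ac)
      also have "\<dots> = ?w s * poly q s * (I s * jacobi_riesz \<sigma> \<rho> b a m s)"
        unfolding T'_lborel by simp
      also have "\<dots> = I s * (?w s * (poly q s * (I s * jacobi_riesz \<sigma> \<rho> b a m s)))"
        by (auto simp: I_def indicator_def)
      finally show ?thesis by simp
    qed
    have "(\<lambda>s. I s * jacobi_riesz \<sigma> \<rho> b a m s) \<in> borel_measurable borel"
      unfolding T'_lborel by measurable
    then have mg: "(\<lambda>s. ?w s * (poly q s * (I s * jacobi_riesz \<sigma> \<rho> b a m s))) \<in> borel_measurable borel"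
      by measurable
    show ?thesis
      using set_integral_lebesgue_lborel(1)[OF mg, of "{0<..<1}"] unfolding I_def[symmetric] Fs by simp
  qed
  also have "\<dots> = (LINT s:{0<..<1}|lebesgue. ?w s * (poly q s * jacobi_riesz \<sigma> \<rho> b a m s))"
    by (rule set_lebesgue_integral_cong) (auto simp: I_def)
  finally show ?thesis .
qed

abbreviation P :: "nat \<Rightarrow> real poly" where "P n \<equiv> jacobi_G_poly n a b"

text \<open>The polynomial that represents \<open>L (\<omega>\<^bsup>(a,b)\<^esup> G\<^sub>n)\<close>, up to a constant factor the Jacobi polynomial of degree
  \<open>n + 1\<close> for the weight \<open>\<omega>\<^bsup>(b-1,a-1)\<^esup>\<close>. It is pinned down by its values on the interval; the leading coefficient is
  recorded because it carries the norm.\<close>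
definition image_poly :: "nat \<Rightarrow> real poly" where
  "image_poly n = (SOME q. degree q \<le> Suc n
     \<and> coeff q (Suc n) = (1 / Gamma c) * lead (Suc n) * (a + b + real n) * coeff (P n) n
     \<and> (\<forall>x\<in>{0<..<1}. - (1 / Gamma c) * T (weighted_deriv a b (P n)) x = poly q x))"

lemma image_poly:
  "degree (image_poly n) \<le> Suc n"
  "coeff (image_poly n) (Suc n) = (1 / Gamma c) * lead (Suc n) * (a + b + real n) * coeff (P n) n"
  "\<And>x. x \<in> {0<..<1} \<Longrightarrow> poly (image_poly n) x = - (1 / Gamma c) * T (weighted_deriv a b (P n)) x"
proof -
  have d: "degree (weighted_deriv a b (P n)) \<le> Suc n"
    by (intro coeff_weighted_deriv degree_jacobi_G_poly)
  obtain q where q: "degree q \<le> Suc n" "coeff q (Suc n) = lead (Suc n) * coeff (weighted_deriv a b (P n)) (Suc n)"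
    "\<And>x. x \<in> {0<..<1} \<Longrightarrow> T (weighted_deriv a b (P n)) x = poly q x"
    using T_poly[OF d] by blast
  have "\<exists>q. degree q \<le> Suc n
     \<and> coeff q (Suc n) = (1 / Gamma c) * lead (Suc n) * (a + b + real n) * coeff (P n) n
     \<and> (\<forall>x\<in>{0<..<1}. - (1 / Gamma c) * T (weighted_deriv a b (P n)) x = poly q x)"
  proof (intro exI[of _ "smult (- (1 / Gamma c)) q"] conjI ballI)
    show "degree (smult (- (1 / Gamma c)) q) \<le> Suc n"
      by (rule order_trans[OF degree_smult_le q(1)])
    show "coeff (smult (- (1 / Gamma c)) q) (Suc n) = (1 / Gamma c) * lead (Suc n) * (a + b + real n) * coeff (P n) n"
    proof -
      have "- g * (l * (- s * k)) = g * l * s * k" for g l s k :: real by simp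
      then show ?thesis by (simp only: coeff_smult q(2) coeff_weighted_deriv(2)[OF degree_jacobi_G_poly])
    qed
  qed (simp add: q(3))
  from someI_ex[OF this, folded image_poly_def]
  show "degree (image_poly n) \<le> Suc n"
    "coeff (image_poly n) (Suc n) = (1 / Gamma c) * lead (Suc n) * (a + b + real n) * coeff (P n) n"
    "\<And>x. x \<in> {0<..<1} \<Longrightarrow> poly (image_poly n) x = - (1 / Gamma c) * T (weighted_deriv a b (P n)) x"
    by simp_all
qed

lemma frac_op_jacobi_image:
  assumes "x \<in> {0<..<1}" "\<rho> + \<sigma> = 1"
  shows "frac_op (a + b) \<rho> (\<lambda>s. jac_weight a b s * (\<Sum>j\<le>N. d j * poly (P j) s)) x
       = (\<Sum>j\<le>N. d j * poly (image_poly j) x)"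
proof -
  have x: "0 < x" "x < 1" and s: "1 - \<rho> = \<sigma>" using assms by auto
  define p where "p = (\<Sum>j\<le>N. smult (d j) (P j))"
  have wd: "weighted_deriv a b p = (\<Sum>j\<le>N. smult (d j) (weighted_deriv a b (P j)))"
    unfolding p_def by (induction N) (simp_all add: weighted_deriv_add weighted_deriv_smult)
  have "frac_op (a + b) \<rho> (\<lambda>s. jac_weight a b s * poly p s) x = - (1 / Gamma c) * T (weighted_deriv a b p) x"
    using frac_op_eq_jacobi_riesz[OF a b ab(2) x, of \<rho> p] by (simp add: s c_def)
  also have "\<dots> = (\<Sum>j\<le>N. d j * poly (image_poly j) x)"
    unfolding wd using x by (simp add: T_sum T_smult image_poly(3) sum_distrib_left sum_negf[symmetric])
  finally show ?thesis by (simp add: p_def poly_sum)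
qed

definition norm2_P :: "nat \<Rightarrow> real" where "norm2_P n = jac_int a b (P n * P n)"

text \<open>Duality and integration by parts turn the scalar product with \<open>m\<close> into that of \<open>G\<^sub>n\<close> with the derivative of the
  adjoint image of \<open>m\<close>, which has degree at most \<open>n\<close>; so only its leading coefficient counts.\<close>
lemma image_inner:
  assumes m: "degree m \<le> Suc n"
  shows "coeff (P n) n * jac_int (b - 1) (a - 1) (image_poly n * m)
     = (1 / Gamma c) * (real (Suc n) * dual.lead (Suc n) * coeff m (Suc n)) * norm2_P n"
proof -
  obtain t where t: "degree t \<le> Suc n" "coeff t (Suc n) = dual.lead (Suc n) * coeff m (Suc n)"
    "\<And>x. x \<in> {0<..<1} \<Longrightarrow> jacobi_riesz \<sigma> \<rho> b a m x = poly t x"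
    using dual.T_poly[OF m] by blast
  have "jac_int (b - 1) (a - 1) (image_poly n * m)
     = (LINT x:{0<..<1}|lebesgue. - (1 / Gamma c) *
          (jac_weight (b - 1) (a - 1) x * (poly m x * T (weighted_deriv a b (P n)) x)))"
    unfolding jac_int_def
    by (rule set_lebesgue_integral_cong) (simp_all add: image_poly(3))
  also have "\<dots> = - (1 / Gamma c) * (LINT s:{0<..<1}|lebesgue.
     jac_weight (a - 1) (b - 1) s * (poly (weighted_deriv a b (P n)) s * jacobi_riesz \<sigma> \<rho> b a m s))"
    unfolding T_duality[symmetric] by (rule set_integral_mult_right)
  also have "(LINT s:{0<..<1}|lebesgue.
     jac_weight (a - 1) (b - 1) s * (poly (weighted_deriv a b (P n)) s * jacobi_riesz \<sigma> \<rho> b a m s))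
     = jac_int (a - 1) (b - 1) (weighted_deriv a b (P n) * t)"
    unfolding jac_int_def
    by (rule set_lebesgue_integral_cong) (simp_all add: t(3))
  also have "\<dots> = - jac_int a b (P n * pderiv t)"
    by (rule jac_int_by_parts) (use a b in auto)
  finally have 1: "jac_int (b - 1) (a - 1) (image_poly n * m) = (1 / Gamma c) * jac_int a b (P n * pderiv t)"
    by simp
  have d: "degree (pderiv t) \<le> n" using t(1) by (simp add: degree_pderiv)
  have "coeff (P n) n * jac_int a b (P n * pderiv t) = coeff (pderiv t) n * norm2_P n"
    unfolding norm2_P_def by (rule jacobi_orthogonal[OF _ _ d]) (use a b in auto)
  also have "coeff (pderiv t) n = real (Suc n) * dual.lead (Suc n) * coeff m (Suc n)"
    by (simp add: coeff_pderiv t(2))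
  finally show ?thesis unfolding 1 by simp
qed

lemma coeff_P_pos: "0 < coeff (P n) n"
  using a b by (intro coeff_jacobi_G_poly_pos) auto

lemma image_orthogonal:
  assumes "degree m \<le> n"
  shows "jac_int (b - 1) (a - 1) (image_poly n * m) = 0"
proof -
  have "coeff (P n) n * jac_int (b - 1) (a - 1) (image_poly n * m) = 0"
    using image_inner[of m n] assms by (simp add: coeff_eq_0)
  then show ?thesis using coeff_P_pos[of n] by simp
qed

lemma image_norm:
  "jac_int (b - 1) (a - 1) (image_poly n * image_poly n)
     = (1 / Gamma c)\<^sup>2 * (lead (Suc n) * dual.lead (Suc n) * real (Suc n) * (a + b + real n)) * norm2_P n"
proof -
  have "coeff (P n) n * jac_int (b - 1) (a - 1) (image_poly n * image_poly n)
     = coeff (P n) n * ((1 / Gamma c)\<^sup>2 * (lead (Suc n) * dual.lead (Suc n) * real (Suc n) * (a + b + real n)) * norm2_P n)"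
    unfolding image_inner[OF image_poly(1)] image_poly(2) by (simp add: power2_eq_square mult_ac)
  then show ?thesis using coeff_P_pos[of n] by simp
qed

text \<open>The ratio of the squared norms of image and argument for \<open>n = 0\<close>, where it is smallest.\<close>
definition \<delta> :: real where "\<delta> = (1 / Gamma c)\<^sup>2 * (lead 1 * dual.lead 1 * (a + b))"

lemma \<delta>_pos: "0 < \<delta>"
  unfolding \<delta>_def using lead_pos[of 1] dual.lead_pos[of 1] ab Gamma_real_pos[OF c_pos]
  by (intro mult_pos_pos) auto

text \<open>Passing from \<open>n\<close> to \<open>n + 1\<close> multiplies the right-hand side by
  \<open>(a + b + n) (a + b + n + 1) / ((n + 1) (n + 2))\<close>, which is at least 1 since \<open>a + b > 1\<close>.\<close>
lemma lead_growth: "lead 1 * dual.lead 1 * (a + b) \<le> lead (Suc n) * dual.lead (Suc n) * real (Suc n) * (a + b + real n)"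
proof (induction n)
  case (Suc n)
  define L where "L = lead (Suc n) * dual.lead (Suc n)"
  have L: "0 < L" unfolding L_def by (intro mult_pos_pos lead_pos dual.lead_pos)
  have l: "lead (Suc (Suc n)) = (a + b + real n) / (real n + 2) * lead (Suc n)"
    using lead_Suc[of "Suc n"] by (simp add: field_simps)
  have dl: "dual.lead (Suc (Suc n)) = (a + b + real n) / (real n + 2) * dual.lead (Suc n)"
    using dual.lead_Suc[of "Suc n"] by (simp add: field_simps)
  define y k where "y = a + b + real n" and "k = real n + 2"
  have y: "real n + 1 \<le> y" "k \<le> y + 1" and k: "0 < k" using ab by (simp_all add: y_def k_def)
  have "(real n + 1) * k \<le> y * (y + 1)"
    using y k by (intro mult_mono) auto
  then have "L * y * ((real n + 1) * k) \<le> L * y * (y * (y + 1))"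
    using L y by (intro mult_left_mono) auto
  then have "L * (real n + 1) * y * k \<le> (y * L) * (y * (y + 1))"
    by (simp only: mult_ac)
  then have "L * (real n + 1) * y \<le> (y * L) * (y * (y + 1)) / k"
    using k by (simp only: pos_le_divide_eq)
  also have "\<dots> = (y / k * lead (Suc n)) * (y / k * dual.lead (Suc n)) * k * (y + 1)"
    using k by (simp add: L_def)
  also have "\<dots> = lead (Suc (Suc n)) * dual.lead (Suc (Suc n)) * real (Suc (Suc n)) * (a + b + real (Suc n))"
    unfolding l dl y_def k_def by (simp add: add_ac)
  finally show ?case using Suc unfolding L_def y_def by (simp add: add_ac)
qed simp

lemma norm2_P_nonneg: "0 \<le> norm2_P n"
  unfolding norm2_P_def jac_int_def set_lebesgue_integral_def
  by (intro integral_nonneg_AE) (auto simp: jac_weight_def)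

lemma image_norm_ge: "\<delta> * norm2_P n \<le> jac_int (b - 1) (a - 1) (image_poly n * image_poly n)"
  unfolding image_norm \<delta>_def mult.assoc[of "(1 / Gamma c)\<^sup>2"]
  by (intro mult_left_mono mult_right_mono lead_growth norm2_P_nonneg) simp

end

section \<open>Weighted spaces on the unit interval\<close>

text \<open>With the weight absorbed in the measure, the weighted spaces become ordinary spaces of
  square-integrable functions, to which the orthogonal expansions apply.\<close>
definition jac_measure :: "real \<Rightarrow> real \<Rightarrow> real measure" where
  "jac_measure a b = density (lebesgue_on {0<..<1}) (\<lambda>x. ennreal (jac_weight a b x))"

lemma borel_imp_lebesgue_on: "f \<in> borel_measurable borel \<Longrightarrow> f \<in> borel_measurable (lebesgue_on S)" for f :: "real \<Rightarrow> real"
  by (intro measurable_restrict_space1 measurable_completion) simp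

lemma jac_weight_measurable_on: "jac_weight a b \<in> borel_measurable (lebesgue_on {0<..<1})"
  by (rule borel_imp_lebesgue_on) measurable

lemma borel_measurable_jac_measure [simp]:
  "borel_measurable (jac_measure a b) = (borel_measurable (lebesgue_on {0<..<1}) :: (real \<Rightarrow> real) set)"
  unfolding jac_measure_def by (rule measurable_cong_sets) simp_all

lemma space_jac_measure [simp]: "space (jac_measure a b) = {0<..<1}"
  unfolding jac_measure_def by simp

lemma jac_weight_nonneg [simp]: "0 \<le> jac_weight a b x"
  by (simp add: jac_weight_def)

lemma jac_weight_pos: "0 < x \<Longrightarrow> x < 1 \<Longrightarrow> 0 < jac_weight a b x"
  by (simp add: jac_weight_def)

lemma jac_weight_uminus:
  "0 < x \<Longrightarrow> x < 1 \<Longrightarrow> jac_weight (- a) (- b) x * jac_weight a b x = 1"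
  by (simp add: jac_weight_def powr_minus field_simps)

lemma integrable_jac_measure:
  fixes g :: "real \<Rightarrow> real"
  assumes "g \<in> borel_measurable (lebesgue_on {0<..<1})"
  shows "integrable (jac_measure a b) g \<longleftrightarrow> set_integrable lebesgue {0<..<1} (\<lambda>x. jac_weight a b x * g x)"
  unfolding jac_measure_def set_integrable_def
  using assms jac_weight_measurable_on[of a b]
  by (subst integrable_density) (simp_all add: integrable_restrict_space)

lemma integral_jac_measure:
  fixes g :: "real \<Rightarrow> real"
  assumes "g \<in> borel_measurable (lebesgue_on {0<..<1})"
  shows "(LINT x|jac_measure a b. g x) = (LINT x:{0<..<1}|lebesgue. jac_weight a b x * g x)"
  unfolding jac_measure_def set_lebesgue_integral_def
  using assms jac_weight_measurable_on[of a b]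
  by (subst integral_density) (simp_all add: integral_restrict_space)

lemma AE_jac_measure: "(AE x in jac_measure a b. Q x) \<longleftrightarrow> (AE x in lebesgue_on {0<..<1}. Q x)"
proof -
  have "(AE x in jac_measure a b. Q x) \<longleftrightarrow> (AE x in lebesgue_on {0<..<1}. 0 < ennreal (jac_weight a b x) \<longrightarrow> Q x)"
    unfolding jac_measure_def using jac_weight_measurable_on[of a b] by (subst AE_density) simp_all
  also have "\<dots> \<longleftrightarrow> (AE x in lebesgue_on {0<..<1}. Q x)"
    by (rule AE_cong) (simp add: jac_weight_pos)
  finally show ?thesis .
qed

lemma square_integrable_jac_measure: "square_integrable (jac_measure a b) g \<longleftrightarrow> g \<in> wL2 (jac_weight a b)"
proof -
  have "(\<lambda>x. (g x)\<^sup>2) \<in> borel_measurable (lebesgue_on {0<..<1})" if "g \<in> borel_measurable (lebesgue_on {0<..<1})"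
    using that by measurable
  then show ?thesis
    unfolding square_integrable_def wL2_def by (auto simp: integrable_jac_measure)
qed

lemma wnorm_jac_measure:
  assumes "g \<in> borel_measurable (lebesgue_on {0<..<1})"
  shows "wnorm (jac_weight a b) g = sqrt (LINT x|jac_measure a b. (g x)\<^sup>2)"
proof -
  have "(\<lambda>x. (g x)\<^sup>2) \<in> borel_measurable (lebesgue_on {0<..<1})" using assms by measurable
  then show ?thesis unfolding wnorm_def by (simp add: integral_jac_measure)
qed

lemma wL2_tendsto_jac_measure:
  "wL2_tendsto (jac_weight a b) S u \<longleftrightarrow>
     square_integrable (jac_measure a b) u \<and> (\<forall>N. square_integrable (jac_measure a b) (S N)) \<and>
     (\<lambda>N. LINT x|jac_measure a b. (S N x - u x)\<^sup>2) \<longlonglongrightarrow> 0"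
proof -
  have "(\<lambda>N. wnorm (jac_weight a b) (\<lambda>x. S N x - u x)) \<longlonglongrightarrow> 0 \<longleftrightarrow>
     (\<lambda>N. LINT x|jac_measure a b. (S N x - u x)\<^sup>2) \<longlonglongrightarrow> 0"
    if "square_integrable (jac_measure a b) u" "\<And>N. square_integrable (jac_measure a b) (S N)"
  proof -
    have w: "wnorm (jac_weight a b) (\<lambda>x. S N x - u x) = sqrt (LINT x|jac_measure a b. (S N x - u x)\<^sup>2)" for N
      using square_integrable_diff[OF that(2)[of N] that(1)]
      by (intro wnorm_jac_measure) (simp add: square_integrable_def)
    show ?thesis
    proof
      assume "(\<lambda>N. wnorm (jac_weight a b) (\<lambda>x. S N x - u x)) \<longlonglongrightarrow> 0"
      then have "(\<lambda>N. (sqrt (LINT x|jac_measure a b. (S N x - u x)\<^sup>2))\<^sup>2) \<longlonglongrightarrow> 0\<^sup>2"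
        unfolding w by (rule tendsto_power)
      then show "(\<lambda>N. LINT x|jac_measure a b. (S N x - u x)\<^sup>2) \<longlonglongrightarrow> 0" by simp
    next
      assume "(\<lambda>N. LINT x|jac_measure a b. (S N x - u x)\<^sup>2) \<longlonglongrightarrow> 0"
      then have "(\<lambda>N. sqrt (LINT x|jac_measure a b. (S N x - u x)\<^sup>2)) \<longlonglongrightarrow> sqrt 0"
        by (rule tendsto_real_sqrt)
      then show "(\<lambda>N. wnorm (jac_weight a b) (\<lambda>x. S N x - u x)) \<longlonglongrightarrow> 0"
        unfolding w by simp
    qed
  qed
  then show ?thesis
    unfolding wL2_tendsto_def square_integrable_jac_measure[symmetric] by blast
qed

lemma jac_measure_poly:
  fixes a b :: real
  assumes "- 1 < a" "- 1 < b"
  shows "integrable (jac_measure a b) (poly p)" "(LINT x|jac_measure a b. poly p x) = jac_int a b p"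
    "square_integrable (jac_measure a b) (poly p)"
proof -
  have m: "poly q \<in> borel_measurable (lebesgue_on {0<..<1})" for q :: "real poly"
    by (rule borel_imp_lebesgue_on) measurable
  have i: "integrable (jac_measure a b) (poly q)" for q
    using jac_weight_poly_integrable[OF assms] by (simp add: integrable_jac_measure m)
  show "integrable (jac_measure a b) (poly p)" by (rule i)
  show "(LINT x|jac_measure a b. poly p x) = jac_int a b p"
    unfolding jac_int_def by (rule integral_jac_measure[OF m])
  have "poly (p\<^sup>2) = (\<lambda>x. (poly p x)\<^sup>2)" by (simp add: fun_eq_iff)
  then show "square_integrable (jac_measure a b) (poly p)"
    unfolding square_integrable_def using m i[of "p\<^sup>2"] by simp
qed

lemma AE_lebesgue_on_imp_ex:
  assumes "AE x in lebesgue_on {0<..<1::real}. Q x"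
  shows "\<exists>x\<in>{0<..<1}. Q x"
proof (rule ccontr)
  assume "\<not> ?thesis"
  then have "AE x in lebesgue_on {0<..<1::real}. False"
    using assms by (auto elim!: AE_mp)
  then have "ae_filter (lebesgue_on {0<..<1::real}) = bot" by (simp add: eventually_False)
  then show False
    by (simp add: ae_filter_eq_bot_iff emeasure_restrict_space)
qed

text \<open>A nonzero polynomial has finitely many roots and so cannot vanish almost everywhere.\<close>
lemma jac_int_square_pos:
  fixes a b :: real
  assumes "- 1 < a" "- 1 < b" "p \<noteq> 0"
  shows "0 < jac_int a b (p * p)"
proof (rule ccontr)
  assume "\<not> ?thesis"
  then have "(LINT x|jac_measure a b. (poly p x)\<^sup>2) \<le> 0"
    using jac_measure_poly(2)[OF assms(1,2), of "p * p"] by (simp add: power2_eq_square)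
  then have "AE x in jac_measure a b. poly p x = 0"
    by (intro square_norm_zero_AE jac_measure_poly assms)
  then have 1: "AE x in lebesgue_on {0<..<1}. poly p x = 0" by (simp add: AE_jac_measure)
  have "negligible {x. poly p x = 0}" using poly_roots_finite[OF assms(3)] by (rule negligible_finite)
  then have "AE x in lebesgue. x \<notin> {x. poly p x = 0}"
    by (intro AE_not_in) (simp add: negligible_iff_null_sets)
  then have 2: "AE x in lebesgue_on {0<..<1}. x \<notin> {x. poly p x = 0}"
    by (subst AE_restrict_space_iff) auto
  from 1 2 have "AE x in lebesgue_on {0<..<1::real}. False" by (auto elim!: AE_mp)
  then show False using AE_lebesgue_on_imp_ex by blast
qed

text \<open>By Weierstrass, orthogonality to polynomials extends to continuous functions. The sign of \<open>g\<close> is an almost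
  everywhere limit of continuous functions, which may be clipped to \<open>[-1, 1]\<close>; dominated convergence then
  gives \<open>\<integral> |g| = 0\<close>.\<close>
lemma polynomials_total:
  fixes a b :: real
  assumes ab: "- 1 < a" "- 1 < b" and g: "square_integrable (jac_measure a b) g"
    and orth: "\<And>p. (LINT x|jac_measure a b. g x * poly p x) = 0"
  shows "AE x in jac_measure a b. g x = 0"
proof -
  let ?M = "jac_measure a b"
  have gm: "g \<in> borel_measurable ?M" using g by (simp add: square_integrable_def)
  have gi: "integrable ?M g"
    using square_integrable_mult[OF g jac_measure_poly(3)[OF ab, of 1]] by simp
  have cont0: "(LINT x|?M. g x * \<phi> x) = 0" if \<phi>: "continuous_on UNIV \<phi>" for \<phi> :: "real \<Rightarrow> real"
  proof -
    have \<phi>m: "\<phi> \<in> borel_measurable ?M"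
      using \<phi> by (simp add: borel_imp_lebesgue_on borel_measurable_continuous_onI)
    have "compact (\<phi> ` {0..1})"
      by (intro compact_continuous_image continuous_on_subset[OF \<phi>]) auto
    then obtain B where B: "\<And>s. s \<in> {0..1} \<Longrightarrow> \<bar>\<phi> s\<bar> \<le> B"
      by (metis bounded_iff compact_imp_bounded imageI real_norm_def)
    have g\<phi>: "integrable ?M (\<lambda>x. g x * \<phi> x)"
    proof (rule Bochner_Integration.integrable_bound)
      show "integrable ?M (\<lambda>x. g x * B)" using gi by simp
      show "AE x in ?M. norm (g x * \<phi> x) \<le> norm (g x * B)"
        using B by (intro AE_I2) (fastforce simp: abs_mult intro!: mult_left_mono order_trans[OF B abs_ge_self])
    qed (use gm \<phi>m in measurable)
    have small: "\<bar>LINT x|?M. g x * \<phi> x\<bar> \<le> e * (LINT x|?M. \<bar>g x\<bar>)" if e: "0 < e" for e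
    proof -
      obtain n where n: "\<And>x. x \<in> {0..1} \<Longrightarrow> \<bar>\<phi> x - (\<Sum>k\<le>n. \<phi> (k/n) * Bernstein n k x)\<bar> < e"
        using Bernstein_Weierstrass[of \<phi> e] continuous_on_subset[OF \<phi>, of "{0..1}"] e by auto
      define p where "p = (\<Sum>k\<le>n. smult (\<phi> (k/n) * real (n choose k)) ([:0, 1:] ^ k * [:1, -1:] ^ (n - k)))"
      have p: "poly p x = (\<Sum>k\<le>n. \<phi> (k/n) * Bernstein n k x)" for x
        unfolding p_def Bernstein_def by (simp add: poly_sum poly_power mult_ac)
      have gp: "integrable ?M (\<lambda>x. g x * poly p x)"
        by (rule square_integrable_mult[OF g jac_measure_poly(3)[OF ab]])
      have "(LINT x|?M. g x * \<phi> x) = (LINT x|?M. g x * \<phi> x) - (LINT x|?M. g x * poly p x)"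
        using orth by simp
      also have "\<dots> = (LINT x|?M. g x * \<phi> x - g x * poly p x)"
        using g\<phi> gp by simp
      also have "\<bar>\<dots>\<bar> \<le> (LINT x|?M. \<bar>g x * \<phi> x - g x * poly p x\<bar>)"
        by (rule integral_abs_bound)
      also have "\<dots> \<le> (LINT x|?M. e * \<bar>g x\<bar>)"
      proof (rule integral_mono)
        fix x assume "x \<in> space ?M"
        then have "\<bar>\<phi> x - poly p x\<bar> \<le> e" using n[of x] by (simp add: p)
        then have "\<bar>g x\<bar> * \<bar>\<phi> x - poly p x\<bar> \<le> \<bar>g x\<bar> * e" by (intro mult_left_mono) auto
        then show "\<bar>g x * \<phi> x - g x * poly p x\<bar> \<le> e * \<bar>g x\<bar>"
          unfolding right_diff_distrib[symmetric] abs_mult by (simp only: mult.commute)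
      qed (use g\<phi> gp gi in auto)
      finally show ?thesis by simp
    qed
    define G where "G = (LINT x|?M. \<bar>g x\<bar>)"
    have G: "0 \<le> G" unfolding G_def by simp
    have "\<bar>LINT x|?M. g x * \<phi> x\<bar> \<le> 0 + e" if "0 < e" for e
    proof -
      have "\<bar>LINT x|?M. g x * \<phi> x\<bar> \<le> e / (G + 1) * G"
        using G that unfolding G_def by (intro small divide_pos_pos) (simp_all only: add_nonneg_pos zero_less_one)
      also have "\<dots> \<le> e"
        using that G by (simp add: field_simps)
      finally show ?thesis by simp
    qed
    then have "\<bar>LINT x|?M. g x * \<phi> x\<bar> \<le> 0" by (rule field_le_epsilon)
    then show ?thesis by simp
  qed
  have "(\<lambda>x. sgn (g x)) \<in> borel_measurable (lebesgue_on {0<..<1})" using gm by simp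
  then have "(\<lambda>x. sgn (g x)) measurable_on {0<..<1}"
    by (simp add: measurable_on_iff_borel_measurable)
  then obtain N \<phi> where N: "negligible N" and \<phi>: "\<And>n. continuous_on UNIV (\<phi> n)"
    and lim: "\<And>x. x \<notin> N \<Longrightarrow> (\<lambda>n. \<phi> n x) \<longlonglongrightarrow> (if x \<in> {0<..<1} then sgn (g x) else 0)"
    unfolding measurable_on_def by blast
  define \<psi> where "\<psi> n x = max (- 1) (min 1 (\<phi> n x))" for n x
  have \<psi>c: "continuous_on UNIV (\<psi> n)" for n
    unfolding \<psi>_def by (intro continuous_intros \<phi>)
  have \<psi>m: "\<psi> n \<in> borel_measurable ?M" for n
    using \<psi>c by (simp add: borel_imp_lebesgue_on borel_measurable_continuous_onI)
  have "AE x in lebesgue. x \<notin> N"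
    using N by (intro AE_not_in) (simp add: negligible_iff_null_sets)
  then have "AE x in lebesgue_on {0<..<1}. x \<notin> N"
    by (subst AE_restrict_space_iff) auto
  then have AEN: "AE x in ?M. x \<notin> N" by (simp add: AE_jac_measure)
  have "(\<lambda>n. LINT x|?M. g x * \<psi> n x) \<longlonglongrightarrow> (LINT x|?M. \<bar>g x\<bar>)"
  proof (rule integral_dominated_convergence[where w = "\<lambda>x. \<bar>g x\<bar>"])
    show "AE x in ?M. (\<lambda>n. g x * \<psi> n x) \<longlonglongrightarrow> \<bar>g x\<bar>"
      using AEN AE_space
    proof eventually_elim
      case (elim x)
      then have "(\<lambda>n. \<phi> n x) \<longlonglongrightarrow> sgn (g x)" using lim[of x] by simp
      then have "(\<lambda>n. g x * \<psi> n x) \<longlonglongrightarrow> g x * max (- 1) (min 1 (sgn (g x)))"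
        unfolding \<psi>_def by (intro tendsto_intros)
      also have "g x * max (- 1) (min 1 (sgn (g x))) = \<bar>g x\<bar>" by (simp add: sgn_if)
      finally show ?case .
    qed
    show "AE x in ?M. norm (g x * \<psi> n x) \<le> \<bar>g x\<bar>" for n
      by (intro AE_I2) (auto simp: abs_mult \<psi>_def intro!: mult_left_le)
  qed (use gm \<psi>m gi in \<open>auto intro!: borel_measurable_times\<close>)
  then have "(LINT x|?M. \<bar>g x\<bar>) = 0"
    using cont0[OF \<psi>c] by (simp add: LIMSEQ_const_iff)
  then have "AE x in ?M. \<bar>g x\<bar> = 0"
    using gi by (subst (asm) integral_nonneg_eq_0_iff_AE) auto
  then show ?thesis by simp
qed

section \<open>Diagonalisation of the fractional operator\<close>

text \<open>A family with one polynomial of each exact degree spans all polynomials.\<close>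
lemma vanishing_on_graded_basis:
  fixes e :: "nat \<Rightarrow> real poly" and L :: "real poly \<Rightarrow> real"
  assumes deg: "\<And>n. degree (e n) \<le> n" and co: "\<And>n. coeff (e n) n \<noteq> 0"
    and add: "\<And>p q. L (p + q) = L p + L q" and smult: "\<And>k p. L (smult k p) = k * L p"
    and zero: "\<And>n. L (e n) = 0"
  shows "L p = 0"
proof -
  have "L p = 0" if "degree p \<le> n" for n p
    using that
  proof (induction n arbitrary: p)
    case 0
    then obtain k where k: "p = [:k:]" by (auto elim: degree_eq_zeroE)
    obtain l where l: "e 0 = [:l:]" using deg[of 0] by (auto elim: degree_eq_zeroE)
    have "p = smult (k / l) (e 0)" using co[of 0] by (simp add: k l)
    then show ?case using smult[of "k / l" "e 0"] zero[of 0] by simp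
  next
    case (Suc n)
    define k where "k = coeff p (Suc n) / coeff (e (Suc n)) (Suc n)"
    have "degree (p + smult (- k) (e (Suc n))) \<le> n"
    proof (rule degree_le, intro allI impI)
      fix i assume "n < i"
      then show "coeff (p + smult (- k) (e (Suc n))) i = 0"
        using Suc.prems deg[of "Suc n"] co[of "Suc n"]
        by (cases "i = Suc n") (simp_all add: k_def coeff_eq_0)
    qed
    then have "L (p + smult (- k) (e (Suc n))) = 0" by (rule Suc.IH)
    then have "L p + (- k) * L (e (Suc n)) = 0" by (simp only: add smult)
    then show ?case by (simp add: zero)
  qed
  then show ?thesis by blast
qed

text \<open>The normalisation makes \<open>\<sigma> = 1 - \<rho>\<close>, as in \<open>frac_op\<close>; it is preserved by passing to the adjoint.\<close>
locale normalized_kernel = balanced_kernel +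
  assumes norm1: "\<rho> + \<sigma> = 1"
begin

text \<open>\<open>Mu\<close> carries the solutions \<open>u\<close>, \<open>Mh\<close> the right-hand sides \<open>h\<close>.\<close>
abbreviation Mu :: "real measure" where "Mu \<equiv> jac_measure (- a) (- b)"
abbreviation Mh :: "real measure" where "Mh \<equiv> jac_measure (b - 1) (a - 1)"

text \<open>The images together with the constant 1, which spans the orthogonal complement of the range of the operator.\<close>
definition basis_h :: "nat \<Rightarrow> real poly" where
  "basis_h k = (case k of 0 \<Rightarrow> 1 | Suc n \<Rightarrow> image_poly n)"

lemma basis_h_simps [simp]: "basis_h 0 = 1" "basis_h (Suc n) = image_poly n"
  by (simp_all add: basis_h_def)

lemma degree_basis_h: "degree (basis_h k) \<le> k"
  by (cases k) (simp_all add: image_poly(1))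

lemma coeff_basis_h: "coeff (basis_h k) k \<noteq> 0"
proof (cases k)
  case (Suc n)
  then show ?thesis
    using lead_pos[of "Suc n"] coeff_P_pos[of n] ab Gamma_real_pos[OF c_pos] by (simp add: image_poly(2))
qed simp

lemma ab_minus: "- 1 < b - 1" "- 1 < a - 1" using a b by auto

lemma basis_h_square_integrable: "square_integrable Mh (poly (basis_h k))"
  by (rule jac_measure_poly(3)[OF ab_minus])

lemma basis_h_inner: "(LINT x|Mh. poly p x * poly q x) = jac_int (b - 1) (a - 1) (p * q)"
  using jac_measure_poly(2)[OF ab_minus, of "p * q"] by simp

lemma basis_h_orthogonal: "j \<noteq> k \<Longrightarrow> (LINT x|Mh. poly (basis_h j) x * poly (basis_h k) x) = 0"
proof (induction j k rule: linorder_wlog)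
  case (le j k)
  then obtain n where "k = Suc n" "j \<le> n" by (cases k) auto
  then have "jac_int (b - 1) (a - 1) (basis_h k * basis_h j) = 0"
    using image_orthogonal[of "basis_h j" n] degree_basis_h[of j] by simp
  then show ?case by (simp add: basis_h_inner mult.commute)
next
  case (sym j k)
  then show ?case by (simp add: mult.commute)
qed

lemma basis_h_pos: "0 < (LINT x|Mh. (poly (basis_h k) x)\<^sup>2)"
proof -
  have "basis_h k \<noteq> 0" using coeff_basis_h[of k] by auto
  then show ?thesis
    using jac_int_square_pos[OF ab_minus, of "basis_h k"] basis_h_inner[of "basis_h k" "basis_h k"]
    by (simp add: power2_eq_square)
qed

lemma basis_h_total:
  assumes g: "square_integrable Mh g" and 0: "\<And>k. (LINT x|Mh. g x * poly (basis_h k) x) = 0"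
  shows "AE x in Mh. g x = 0"
proof (rule polynomials_total[OF ab_minus g])
  fix p
  have i: "integrable Mh (\<lambda>x. g x * poly q x)" for q
    by (rule square_integrable_mult[OF g jac_measure_poly(3)[OF ab_minus]])
  show "(LINT x|Mh. g x * poly p x) = 0"
    by (rule vanishing_on_graded_basis[where L = "\<lambda>p. LINT x|Mh. g x * poly p x", OF degree_basis_h coeff_basis_h _ _ 0])
       (use i in \<open>simp_all add: distrib_left mult.left_commute\<close>)
qed

definition basis_u :: "nat \<Rightarrow> real \<Rightarrow> real" where
  "basis_u n x = jac_weight a b x * poly (P n) x"

text \<open>The reciprocal weight of the solution space cancels one of the two weight factors of the product.\<close>
lemma basis_u_inner:
  "set_integrable lebesgue {0<..<1} (\<lambda>x. jac_weight (- a) (- b) x * (basis_u j x * basis_u k x))"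
  "(LINT x|Mu. basis_u j x * basis_u k x) = jac_int a b (P j * P k)"
proof -
  have eq: "jac_weight (- a) (- b) x * (basis_u j x * basis_u k x) = jac_weight a b x * poly (P j * P k) x"
    if "x \<in> {0<..<1}" for x
  proof -
    have "jac_weight (- a) (- b) x * (basis_u j x * basis_u k x)
       = (jac_weight (- a) (- b) x * jac_weight a b x) * (jac_weight a b x * poly (P j * P k) x)"
      by (simp add: basis_u_def mult_ac)
    also have "jac_weight (- a) (- b) x * jac_weight a b x = 1"
      using that by (simp add: jac_weight_uminus)
    finally show ?thesis by simp
  qed
  have m: "(\<lambda>x. basis_u j x * basis_u k x) \<in> borel_measurable (lebesgue_on {0<..<1})"
    unfolding basis_u_def by (rule borel_imp_lebesgue_on) measurable
  show "set_integrable lebesgue {0<..<1} (\<lambda>x. jac_weight (- a) (- b) x * (basis_u j x * basis_u k x))"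
    using jac_weight_poly_integrable[of a b "P j * P k"] a b
    by (subst set_integrable_cong[OF refl refl eq]) auto
  show "(LINT x|Mu. basis_u j x * basis_u k x) = jac_int a b (P j * P k)"
    unfolding integral_jac_measure[OF m] jac_int_def
    by (rule set_lebesgue_integral_cong) (use eq in auto)
qed

lemma basis_u_square_integrable: "square_integrable Mu (basis_u k)"
proof -
  have m: "basis_u k \<in> borel_measurable (lebesgue_on {0<..<1})" for k
    unfolding basis_u_def by (rule borel_imp_lebesgue_on) measurable
  then have "(\<lambda>x. (basis_u k x)\<^sup>2) \<in> borel_measurable (lebesgue_on {0<..<1})" by measurable
  then show ?thesis
    unfolding square_integrable_def using m basis_u_inner(1)[of k k]
    by (simp add: integrable_jac_measure power2_eq_square)
qed

lemma basis_u_norm: "(LINT x|Mu. (basis_u k x)\<^sup>2) = norm2_P k"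
  using basis_u_inner(2)[of k k] by (simp add: norm2_P_def power2_eq_square)

lemma basis_u_orthogonal: "j \<noteq> k \<Longrightarrow> (LINT x|Mu. basis_u j x * basis_u k x) = 0"
proof (induction j k rule: linorder_wlog)
  case (le j k)
  have d: "degree (P j) < k" using le degree_jacobi_G_poly[of j a b] by simp
  have "coeff (P k) k * jac_int a b (P k * P j) = coeff (P j) k * jac_int a b (P k * P k)"
    by (rule jacobi_orthogonal) (use a b d in auto)
  then show ?case
    using d coeff_P_pos[of k] by (simp add: basis_u_inner(2) coeff_eq_0 mult.commute)
next
  case (sym j k)
  then show ?case by (simp add: mult.commute)
qed

lemma jacobi_trunc_eq: "jacobi_trunc (a + b) b d N = (\<lambda>x. \<Sum>j\<le>N. d j * basis_u j x)"
  unfolding jacobi_trunc_def basis_u_def poly_jacobi_G_poly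
  by (simp add: fun_eq_iff sum_distrib_left mult_ac)

lemma frac_op_trunc:
  assumes "x \<in> {0<..<1}"
  shows "frac_op (a + b) \<rho> (jacobi_trunc (a + b) b d N) x = (\<Sum>j\<le>N. d j * poly (basis_h (Suc j)) x)"
proof -
  have "jacobi_trunc (a + b) b d N = (\<lambda>s. jac_weight a b s * (\<Sum>j\<le>N. d j * poly (P j) s))"
    unfolding jacobi_trunc_def poly_jacobi_G_poly by simp
  then show ?thesis using frac_op_jacobi_image[OF assms norm1] by simp
qed

lemma frac_op_trunc_square_integrable:
  "square_integrable Mh (frac_op (a + b) \<rho> (jacobi_trunc (a + b) b d N))"
proof -
  let ?g = "\<lambda>x. \<Sum>j\<le>N. d j * poly (basis_h (Suc j)) x"
  let ?f = "frac_op (a + b) \<rho> (jacobi_trunc (a + b) b d N)"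
  have g: "square_integrable Mh ?g"
    by (intro square_integrable_sum square_integrable_scale basis_h_square_integrable)
  have "?f \<in> borel_measurable Mh \<longleftrightarrow> ?g \<in> borel_measurable Mh"
    by (rule measurable_cong) (simp add: frac_op_trunc)
  moreover have "integrable Mh (\<lambda>x. (?f x)\<^sup>2) \<longleftrightarrow> integrable Mh (\<lambda>x. (?g x)\<^sup>2)"
    by (rule Bochner_Integration.integrable_cong) (simp_all add: frac_op_trunc)
  ultimately show ?thesis using g unfolding square_integrable_def by blast
qed

text \<open>The boundary conditions do not appear: every truncation vanishes at 0 and 1 because both exponents of its weight factor are positive.\<close>
abbreviation solves :: "(real \<Rightarrow> real) \<Rightarrow> (nat \<Rightarrow> real) \<Rightarrow> (real \<Rightarrow> real) \<Rightarrow> bool" where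
  "solves h d u \<equiv> wL2_tendsto (jac_weight (- a) (- b)) (jacobi_trunc (a + b) b d) u \<and>
     wL2_tendsto (jac_weight (b - 1) (a - 1)) (\<lambda>N. frac_op (a + b) \<rho> (jacobi_trunc (a + b) b d N)) h"

lemma trunc_square_integrable: "square_integrable Mu (jacobi_trunc (a + b) b d N)"
  unfolding jacobi_trunc_eq
  by (intro square_integrable_sum square_integrable_scale basis_u_square_integrable)

text \<open>Scalar products with a fixed basis element are eventually constant along the truncations, and the limit may be taken
  in them. This gives the compatibility condition on \<open>h\<close> and determines all coefficients.\<close>
lemma solves_coeff:
  assumes "solves h d u"
  shows "(LINT x|Mh. h x) = 0"
    and "d n * (LINT x|Mh. (poly (basis_h (Suc n)) x)\<^sup>2) = (LINT x|Mh. h x * poly (basis_h (Suc n)) x)"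
proof -
  let ?N = "\<lambda>k. LINT x|Mh. (poly (basis_h k) x)\<^sup>2" and ?c = "\<lambda>k. LINT x|Mh. h x * poly (basis_h k) x"
  let ?f = "\<lambda>N. frac_op (a + b) \<rho> (jacobi_trunc (a + b) b d N)"
  have h: "square_integrable Mh h" and lim: "(\<lambda>N. LINT x|Mh. (?f N x - h x)\<^sup>2) \<longlonglongrightarrow> 0"
    using assms by (simp_all add: wL2_tendsto_jac_measure)
  have "(\<lambda>N. LINT x|Mh. ?f N x * poly (basis_h k) x) \<longlonglongrightarrow> ?c k" for k
    by (rule integral_mult_tendsto[OF frac_op_trunc_square_integrable h basis_h_square_integrable lim])
  moreover have eq: "(LINT x|Mh. ?f N x * poly (basis_h k) x)
     = (if k \<in> Suc ` {..N} then d (k - 1) * ?N k else 0)" for N k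
  proof -
    have "(LINT x|Mh. ?f N x * poly (basis_h k) x)
       = (LINT x|Mh. (\<Sum>j\<in>Suc ` {..N}. d (j - 1) * poly (basis_h j) x) * poly (basis_h k) x)"
      by (rule Bochner_Integration.integral_cong) (simp_all add: frac_op_trunc sum.reindex)
    also have "\<dots> = (if k \<in> Suc ` {..N} then d (k - 1) * ?N k else 0)"
      by (rule orthogonal_sum_inner) (simp_all add: basis_h_square_integrable basis_h_orthogonal)
    finally show ?thesis .
  qed
  ultimately have lims: "(\<lambda>N. if k \<in> Suc ` {..N} then d (k - 1) * ?N k else 0)
      \<longlonglongrightarrow> ?c k" for k by simp
  show "(LINT x|Mh. h x) = 0"
  proof -
    have "0 \<notin> Suc ` {..N}" for N by auto
    then show ?thesis using lims[of 0] by (simp add: LIMSEQ_const_iff)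
  qed
  have "(\<lambda>N. if Suc n \<in> Suc ` {..N} then d (Suc n - 1) * ?N (Suc n) else 0)
      \<longlonglongrightarrow> d n * ?N (Suc n)"
    by (rule tendsto_eventually, rule eventually_sequentiallyI[of n]) auto
  with lims[of "Suc n"]
  show "d n * ?N (Suc n) = ?c (Suc n)"
    using LIMSEQ_unique by blast
qed

lemma solves_unique:
  assumes "solves h d u" "solves h d' v"
  shows "AE x in lebesgue_on {0<..<1}. v x = u x"
proof -
  have "d n = d' n" for n
  proof -
    let ?X = "LINT x|Mh. (poly (basis_h (Suc n)) x)\<^sup>2"
    have "d n * ?X = d' n * ?X"
      by (rule trans[OF solves_coeff(2)[OF assms(1)] solves_coeff(2)[OF assms(2), symmetric]])
    then show ?thesis by (rule mult_right_cancel[THEN iffD1, rotated]) (rule less_imp_neq[OF basis_h_pos, symmetric])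
  qed
  then have "d = d'" by blast
  then have "AE x in Mu. v x = u x"
    using assms by (intro L2_limit_unique[where S = "jacobi_trunc (a + b) b d"])
      (simp_all add: wL2_tendsto_jac_measure)
  then show ?thesis by (simp add: AE_jac_measure)
qed

text \<open>Expand \<open>h\<close> in \<open>basis_h\<close>; the coefficient of 1 vanishes, and the others, shifted by one, are the
  coefficients of \<open>u\<close>. Their square summability for \<open>u\<close> follows from the lower bound \<open>\<delta>\<close> on the ratio of norms.\<close>
lemma solves_exists:
  assumes h: "square_integrable Mh h" and mean: "(LINT x|Mh. h x) = 0"
  obtains d u where "solves h d u" "\<delta> * (LINT x|Mu. (u x)\<^sup>2) \<le> (LINT x|Mh. (h x)\<^sup>2)"
proof -
  define N where "N k = (LINT x|Mh. (poly (basis_h k) x)\<^sup>2)" for k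
  define e where "e k = (LINT x|Mh. h x * poly (basis_h k) x) / N k" for k
  have exp1: "(\<lambda>n. LINT x|Mh. ((\<Sum>k\<le>n. e k * poly (basis_h k) x) - h x)\<^sup>2) \<longlonglongrightarrow> 0"
    unfolding e_def N_def
    by (rule orthogonal_expansion(1)[where E = "\<lambda>k. poly (basis_h k)"])
      (use basis_h_square_integrable basis_h_orthogonal basis_h_pos basis_h_total h in blast)+
  have exp2: "(\<lambda>k. (e k)\<^sup>2 * N k) sums (LINT x|Mh. (h x)\<^sup>2)"
    unfolding e_def N_def
    by (rule orthogonal_expansion(2)[where E = "\<lambda>k. poly (basis_h k)"])
      (use basis_h_square_integrable basis_h_orthogonal basis_h_pos basis_h_total h in blast)+
  have e0: "e 0 = 0" using mean by (simp add: e_def)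
  define d where "d n = e (Suc n)" for n
  have "(\<lambda>n. (e (Suc n))\<^sup>2 * N (Suc n)) sums ((LINT x|Mh. (h x)\<^sup>2) - (e 0)\<^sup>2 * N 0)"
    using exp2 sums_Suc_iff[of "\<lambda>n. (e n)\<^sup>2 * N n"] by simp
  then have sums: "(\<lambda>n. (d n)\<^sup>2 * N (Suc n)) sums (LINT x|Mh. (h x)\<^sup>2)"
    by (simp add: d_def e0)
  have NP: "\<delta> * norm2_P n \<le> N (Suc n)" for n
    using image_norm_ge[of n] basis_h_inner[of "image_poly n" "image_poly n"] by (simp add: N_def power2_eq_square)
  have le: "(d n)\<^sup>2 * norm2_P n \<le> (1 / \<delta>) * ((d n)\<^sup>2 * N (Suc n))" for n
  proof -
    have "(d n)\<^sup>2 * (\<delta> * norm2_P n) \<le> (d n)\<^sup>2 * N (Suc n)" by (intro mult_left_mono NP) simp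
    then show ?thesis using \<delta>_pos by (simp add: field_simps)
  qed
  have summ: "summable (\<lambda>n. (d n)\<^sup>2 * (LINT x|Mu. (basis_u n x)\<^sup>2))"
    unfolding basis_u_norm
  proof (rule summable_comparison_test')
    show "summable (\<lambda>n. (1 / \<delta>) * ((d n)\<^sup>2 * N (Suc n)))"
      using sums by (intro summable_mult) (rule sums_summable)
  qed (use le norm2_P_nonneg in simp)
  obtain u where u: "square_integrable Mu u"
    and lim: "(\<lambda>n. LINT x|Mu. ((\<Sum>k\<le>n. d k * basis_u k x) - u x)\<^sup>2) \<longlonglongrightarrow> 0"
    and u2: "(LINT x|Mu. (u x)\<^sup>2) = (\<Sum>k. (d k)\<^sup>2 * (LINT x|Mu. (basis_u k x)\<^sup>2))"
    by (rule Riesz_Fischer[OF basis_u_square_integrable basis_u_orthogonal summ]) blast+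
  have "(LINT x|Mu. (u x)\<^sup>2) \<le> (\<Sum>n. (1 / \<delta>) * ((d n)\<^sup>2 * N (Suc n)))"
    unfolding u2 using le sums summ
    by (intro suminf_le summable_mult) (auto simp: basis_u_norm sums_summable)
  also have "\<dots> = (1 / \<delta>) * (LINT x|Mh. (h x)\<^sup>2)"
    using sums by (subst suminf_mult) (auto simp: sums_summable sums_iff)
  finally have bound: "\<delta> * (LINT x|Mu. (u x)\<^sup>2) \<le> (LINT x|Mh. (h x)\<^sup>2)"
    using \<delta>_pos by (simp add: field_simps)
  have 1: "wL2_tendsto (jac_weight (- a) (- b)) (jacobi_trunc (a + b) b d) u"
    unfolding wL2_tendsto_jac_measure using u lim trunc_square_integrable by (simp add: jacobi_trunc_eq)
  have "(\<lambda>n. LINT x|Mh. ((\<Sum>k\<le>Suc n. e k * poly (basis_h k) x) - h x)\<^sup>2) \<longlonglongrightarrow> 0"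
    using LIMSEQ_Suc[OF exp1] by simp
  moreover have "(LINT x|Mh. ((\<Sum>k\<le>Suc n. e k * poly (basis_h k) x) - h x)\<^sup>2)
     = (LINT x|Mh. (frac_op (a + b) \<rho> (jacobi_trunc (a + b) b d n) x - h x)\<^sup>2)" for n
    by (rule Bochner_Integration.integral_cong) (simp_all add: frac_op_trunc sum.atMost_Suc_shift e0 d_def del: sum.atMost_Suc)
  ultimately have 2: "wL2_tendsto (jac_weight (b - 1) (a - 1)) (\<lambda>N. frac_op (a + b) \<rho> (jacobi_trunc (a + b) b d N)) h"
    unfolding wL2_tendsto_jac_measure using h frac_op_trunc_square_integrable by simp
  from 1 2 bound show thesis by (intro that[of d u]) simp_all
qed

end

section \<open>Primitives and the stability estimate\<close>

text \<open>Cauchy--Schwarz for \<open>f\<close> against the reciprocal weight on \<open>J\<close>. The majorant with exponent \<open>e - 1\<close> is integrable on the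
  whole interval, so that the dependence on \<open>J\<close> is only through \<open>k\<close>.\<close>
lemma weighted_interval_bound:
  fixes a b k :: real
  assumes f: "square_integrable (jac_measure b a) f" and J: "J \<in> sets lebesgue" "J \<subseteq> {0<..<1}"
    and e: "0 < e" and k: "\<And>t. t \<in> J \<Longrightarrow> jac_weight (- b) (- a) t \<le> k * jac_weight (e - 1) (e - 1) t" and k0: "0 \<le> k"
  shows "set_integrable lebesgue J f"
    and "(LINT t:J|lebesgue. f t)\<^sup>2 \<le> (LINT t|jac_measure b a. (f t)\<^sup>2) * (k * jac_int (e - 1) (e - 1) 1)"
proof -
  let ?w = "jac_weight b a" and ?r = "jac_weight (- b) (- a)" and ?v = "jac_weight (e - 1) (e - 1)"
  let ?M = "jac_measure b a"
  define \<psi> where "\<psi> t = indicator J t * ?r t" for t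
  have Jm: "indicat_real J \<in> borel_measurable (lebesgue_on {0<..<1})"
    using J by (intro measurable_restrict_space1) simp
  have \<psi>m: "\<psi> \<in> borel_measurable (lebesgue_on {0<..<1})"
    unfolding \<psi>_def using Jm jac_weight_measurable_on by (intro borel_measurable_times)
  have w1: "?w t * ?r t = 1" if "t \<in> {0<..<1}" for t
    using jac_weight_uminus[of t b a] that by (simp add: mult.commute)
  have \<psi>2: "?w t * (\<psi> t)\<^sup>2 = indicator J t * ?r t" if "t \<in> {0<..<1}" for t
    using w1[OF that] by (simp add: \<psi>_def power2_eq_square indicator_def)
  have le: "indicator J t * ?r t \<le> k * (?v t * poly 1 t)" for t
    using k[of t] k0 by (simp add: indicator_def)
  have int: "set_integrable lebesgue {0<..<1} (\<lambda>t. k * (?v t * poly 1 t))"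
    using jac_weight_poly_integrable[of "e - 1" "e - 1" 1] e by simp
  have \<psi>2m: "(\<lambda>t. (\<psi> t)\<^sup>2) \<in> borel_measurable (lebesgue_on {0<..<1})" using \<psi>m by measurable
  have wJ: "(\<lambda>t. indicator J t * ?r t) \<in> borel_measurable (lebesgue_on {0<..<1})"
    using Jm jac_weight_measurable_on by (intro borel_measurable_times)
  have int2: "set_integrable lebesgue {0<..<1} (\<lambda>t. indicator J t * ?r t)"
    unfolding set_integrable_def
  proof (rule Bochner_Integration.integrable_bound)
    show "integrable lebesgue (\<lambda>t. indicat_real {0<..<1} t *\<^sub>R (k * (?v t * poly 1 t)))"
      using int unfolding set_integrable_def .
    show "(\<lambda>t. indicat_real {0<..<1} t *\<^sub>R (indicator J t * ?r t)) \<in> borel_measurable lebesgue"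
      using wJ by (subst (asm) borel_measurable_restrict_space_iff) (auto simp: mult.commute)
    show "AE t in lebesgue. norm (indicat_real {0<..<1} t *\<^sub>R (indicator J t * ?r t))
        \<le> norm (indicat_real {0<..<1} t *\<^sub>R (k * (?v t * poly 1 t)))"
      using le k0 by (intro AE_I2) (simp add: abs_mult indicator_def)
  qed
  have \<psi>: "square_integrable ?M \<psi>"
    unfolding square_integrable_def using \<psi>m \<psi>2m int2
    by (simp add: integrable_jac_measure cong: set_integrable_cong)
      (subst set_integrable_cong[OF refl refl \<psi>2], auto)
  have f\<psi>m: "(\<lambda>t. f t * \<psi> t) \<in> borel_measurable (lebesgue_on {0<..<1})"
    using f \<psi>m by (auto simp: square_integrable_def)
  have f\<psi>: "indicat_real {0<..<1} t *\<^sub>R (?w t * (f t * \<psi> t)) = indicat_real J t *\<^sub>R f t" for t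
  proof (cases "t \<in> J")
    case True
    then have "t \<in> {0<..<1}" using J by blast
    have "\<psi> t = ?r t" using True by (simp add: \<psi>_def)
    then have "?w t * (f t * \<psi> t) = (?w t * ?r t) * f t"
      by (simp only: mult_ac)
    then have "?w t * (f t * \<psi> t) = f t"
      using w1[OF \<open>t \<in> {0<..<1}\<close>] by simp
    then show ?thesis using True \<open>t \<in> {0<..<1}\<close> by (simp only: indicator_simps)
  qed (simp add: \<psi>_def)
  show "set_integrable lebesgue J f"
    using square_integrable_mult[OF f \<psi>] unfolding integrable_jac_measure[OF f\<psi>m] set_integrable_def f\<psi> .
  have "(LINT t|?M. (\<psi> t)\<^sup>2) = (LINT t:{0<..<1}|lebesgue. indicator J t * ?r t)"
    unfolding integral_jac_measure[OF \<psi>2m] by (rule set_lebesgue_integral_cong) (use \<psi>2 in auto)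
  also have "\<dots> \<le> (LINT t:{0<..<1}|lebesgue. k * (?v t * poly 1 t))"
    by (rule set_integral_mono[OF int2 int]) (rule le)
  also have "\<dots> = k * jac_int (e - 1) (e - 1) 1"
    unfolding jac_int_def by (rule set_integral_mult_right)
  finally have p: "(LINT t|?M. (\<psi> t)\<^sup>2) \<le> k * jac_int (e - 1) (e - 1) 1" .
  have "(LINT t:J|lebesgue. f t) = (LINT t|?M. f t * \<psi> t)"
    unfolding integral_jac_measure[OF f\<psi>m] set_lebesgue_integral_def f\<psi> ..
  then have "(LINT t:J|lebesgue. f t)\<^sup>2 \<le> (LINT t|?M. (f t)\<^sup>2) * (LINT t|?M. (\<psi> t)\<^sup>2)"
    using Cauchy_Schwarz_integral[OF f \<psi>] by simp
  also have "\<dots> \<le> (LINT t|?M. (f t)\<^sup>2) * (k * jac_int (e - 1) (e - 1) 1)"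
    by (intro mult_left_mono p) simp
  finally show "(LINT t:J|lebesgue. f t)\<^sup>2 \<le> (LINT t|?M. (f t)\<^sup>2) * (k * jac_int (e - 1) (e - 1) 1)" .
qed

text \<open>Between \<open>1/2\<close> and \<open>x\<close> the reciprocal weight is split as \<open>t\<^bsup>-1\<^esup> = t\<^bsup>-e\<^esup> t\<^bsup>e-1\<^esup>\<close>, and the first factor is at most its
  value at \<open>x\<close> when \<open>x < 1/2\<close>, and at most 2 otherwise; likewise at the other endpoint.\<close>
lemma inverse_weight_bound:
  fixes a b e x t :: real
  assumes a: "a \<le> 1" and b: "b \<le> 1" and e: "0 < e" "e \<le> 1" and x: "0 < x" "x < 1"
    and t: "min x (1/2) \<le> t" "t \<le> max x (1/2)"
  shows "jac_weight (- b) (- a) t \<le> 2 * jac_weight (- e) (- e) x * jac_weight (e - 1) (e - 1) t"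
proof -
  have t01: "0 < t" "t < 1" using t x by (auto simp: min_def max_def split: if_splits)
  have base: "s powr (- p) \<le> s powr (- e) * s powr (e - 1)" if "0 < s" "s < 1" "p \<le> 1" for s p :: real
  proof -
    have "s powr (- p) \<le> s powr (- 1)" using that by (intro powr_mono') auto
    also have "\<dots> = s powr (- e) * s powr (e - 1)" by (simp flip: powr_add)
    finally show ?thesis .
  qed
  have half: "s powr (- e) \<le> 2" if "1/2 \<le> s" for s :: real
  proof -
    have "s powr (- e) \<le> (1/2) powr (- e)" using that e by (intro powr_mono2') auto
    also have "\<dots> \<le> (1/2) powr (- 1)" using e by (intro powr_mono') auto
    finally show ?thesis by (simp add: powr_minus)
  qed
  have ge1: "1 \<le> s powr (- e)" if "0 < s" "s < 1" for s :: real
    using that e ge_one_powr_ge_zero[of "1 / s" e] by (simp add: powr_minus powr_divide field_simps)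
  have key: "(1 - t) powr (- e) * t powr (- e) \<le> 2 * ((1 - x) powr (- e) * x powr (- e))"
  proof (cases "x \<le> 1/2")
    case True
    then have "x \<le> t" "t \<le> 1/2" using t by auto
    then have "(1 - t) powr (- e) * t powr (- e) \<le> 2 * x powr (- e)"
      using x e t01 by (intro mult_mono half powr_mono2') auto
    also have "\<dots> \<le> 2 * ((1 - x) powr (- e) * x powr (- e))"
      using ge1[of "1 - x"] x by simp
    finally show ?thesis .
  next
    case False
    then have "t \<le> x" "1/2 \<le> t" using t by auto
    then have "(1 - t) powr (- e) * t powr (- e) \<le> (1 - x) powr (- e) * 2"
      using x e t01 by (intro mult_mono half powr_mono2') auto
    also have "\<dots> \<le> 2 * ((1 - x) powr (- e) * x powr (- e))"
      using ge1[of x] x by simp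
    finally show ?thesis .
  qed
  have "jac_weight (- b) (- a) t \<le> ((1 - t) powr (- e) * (1 - t) powr (e - 1)) * (t powr (- e) * t powr (e - 1))"
    unfolding jac_weight_def using t01 a b by (intro mult_mono base) auto
  also have "\<dots> = ((1 - t) powr (- e) * t powr (- e)) * jac_weight (e - 1) (e - 1) t"
    unfolding jac_weight_def by (simp only: mult_ac)
  also have "\<dots> \<le> (2 * ((1 - x) powr (- e) * x powr (- e))) * jac_weight (e - 1) (e - 1) t"
    by (intro mult_right_mono key) simp
  finally show ?thesis unfolding jac_weight_def by (simp only: mult_ac)
qed

definition primitive :: "(real \<Rightarrow> real) \<Rightarrow> real \<Rightarrow> real" where
  "primitive f x = (LINT y:{0<..<x}|lebesgue. f y)"

text \<open>A Hardy-type inequality modulo constants. Measuring the primitive from the midpoint gives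
  \<open>|g(x) - g(1/2)|\<^sup>2 \<le> C \<parallel>f\<parallel>\<^sup>2 (x (1 - x))\<^bsup>-e\<^esup>\<close>, and for small \<open>e\<close> the right-hand side is
  integrable for the weight \<open>\<omega>\<^bsup>(b-1,a-1)\<^esup>\<close>. If \<open>f\<close> is not integrable at 0 the primitive is identically 0 by the
  convention for integrals, and \<open>\<kappa> = 0\<close> works.\<close>
lemma primitive_estimate:
  fixes a b :: real
  assumes a: "0 < a" "a \<le> 1" and b: "0 < b" "b \<le> 1"
  obtains C where "0 < C"
    "\<And>f. square_integrable (jac_measure b a) f \<Longrightarrow>
       \<exists>\<kappa>. square_integrable (jac_measure (b - 1) (a - 1)) (\<lambda>x. primitive f x - \<kappa>) \<and>
         (LINT x|jac_measure (b - 1) (a - 1). (primitive f x - \<kappa>)\<^sup>2) \<le> C * (LINT x|jac_measure b a. (f x)\<^sup>2)"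
proof -
  define e where "e = min a b / 2"
  have e: "0 < e" "e \<le> 1" "e < a" "e < b" using a b by (auto simp: e_def min_def)
  define D where "D = jac_int (e - 1) (e - 1) 1"
  define D' where "D' = jac_int (b - 1 - e) (a - 1 - e) 1"
  have D: "0 < D" "0 < D'"
    unfolding D_def D'_def using jac_int_square_pos[of _ _ 1] e by simp_all
  let ?Mh = "jac_measure (b - 1) (a - 1)"
  show thesis
  proof (rule that[of "2 * D * D'"])
    fix f assume f: "square_integrable (jac_measure b a) f"
    define F where "F = (LINT x|jac_measure b a. (f x)\<^sup>2)"
    have F0: "0 \<le> F" by (simp add: F_def)
    define k where "k x = 2 * jac_weight (- e) (- e) x" for x
    \<comment> \<open>half-open intervals, so that they attach to \<open>{0<..<l}\<close> without overlap\<close>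
    have J: "set_integrable lebesgue {l..<u} f" "(LINT t:{l..<u}|lebesgue. f t)\<^sup>2 \<le> F * (k x * D)"
      if "0 < x" "x < 1" "l = min x (1/2)" "u = max x (1/2)" for x l u
    proof -
      have sub: "{l..<u} \<subseteq> {0<..<1}" using that by auto
      have kk: "jac_weight (- b) (- a) t \<le> k x * jac_weight (e - 1) (e - 1) t" if "t \<in> {l..<u}" for t
        unfolding k_def using that \<open>0 < x\<close> \<open>x < 1\<close> \<open>l = _\<close> \<open>u = _\<close> a b e
        by (intro inverse_weight_bound) auto
      have k0: "0 \<le> k x" by (simp add: k_def)
      show "set_integrable lebesgue {l..<u} f" "(LINT t:{l..<u}|lebesgue. f t)\<^sup>2 \<le> F * (k x * D)"
        using weighted_interval_bound[OF f _ sub e(1) kk k0] by (simp_all add: F_def D_def)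
    qed
    have "\<exists>\<kappa>. primitive f \<in> borel_measurable (lebesgue_on {0<..<1}) \<and>
        (\<forall>x\<in>{0<..<1}. (primitive f x - \<kappa>)\<^sup>2 \<le> F * (k x * D))"
    proof (cases "\<exists>x\<in>{0<..<1}. set_integrable lebesgue {0<..<x} f")
      case False
      then have 0: "primitive f x = 0" if "x \<in> {0<..<1}" for x
        using that unfolding primitive_def set_integrable_def set_lebesgue_integral_def
        by (intro not_integrable_integral_eq) auto
      have "primitive f \<in> borel_measurable (lebesgue_on {0<..<1}) \<longleftrightarrow> (\<lambda>_::real. 0::real) \<in> borel_measurable (lebesgue_on {0<..<1})"
        by (rule measurable_cong) (simp add: 0)
      moreover have "0 \<le> F * (k x * D)" for x using F0 D by (simp add: k_def)
      ultimately show ?thesis using 0 by (intro exI[of _ 0]) auto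
    next
      case True
      then obtain x0 where x0: "x0 \<in> {0<..<1}" "set_integrable lebesgue {0<..<x0} f" by blast
      have half: "set_integrable lebesgue {0<..<1/2} f"
      proof -
        have "set_integrable lebesgue ({0<..<x0} \<union> {min x0 (1/2)..<max x0 (1/2)}) f"
          using J(1)[of x0] x0 by (intro set_integrable_Un) auto
        then show ?thesis by (rule set_integrable_subset) auto
      qed
      have int: "set_integrable lebesgue {0<..<x} f" if "x \<in> {0<..<1}" for x
      proof -
        have "set_integrable lebesgue ({0<..<1/2} \<union> {min x (1/2)..<max x (1/2)}) f"
          using J(1)[of x] half that by (intro set_integrable_Un) auto
        then show ?thesis by (rule set_integrable_subset) auto
      qed
      have split: "primitive f v = primitive f l + (LINT t:{l..<v}|lebesgue. f t)"
        if "0 < l" "l \<le> v" "v < 1" for l v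
      proof -
        have "{0<..<v} = {0<..<l} \<union> {l..<v}" using that by auto
        moreover have "set_integrable lebesgue {l..<v} f"
          by (rule set_integrable_subset[OF int[of v]]) (use that in auto)
        moreover have "{0<..<l} \<inter> {l..<v} = {}" by auto
        ultimately show ?thesis
          unfolding primitive_def using int[of l] that by (simp add: set_integral_Un del: ivl_disj_un)
      qed
      have "(primitive f x - primitive f (1/2))\<^sup>2 \<le> F * (k x * D)" if x: "x \<in> {0<..<1}" for x
      proof (cases "x \<le> 1/2")
        case True
        then show ?thesis
          using split[of x "1/2"] J(2)[of x "min x (1/2)" "max x (1/2)"] x by (simp add: power2_commute min_def max_def split: if_splits)
      next
        case False
        then show ?thesis
          using split[of "1/2" x] J(2)[of x "min x (1/2)" "max x (1/2)"] x by (simp add: min_def max_def split: if_splits)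
      qed
      moreover have "primitive f \<in> borel_measurable (lebesgue_on {0<..<1})"
      proof (rule continuous_imp_measurable_on_sets_lebesgue)
        show "continuous_on {0<..<1} (primitive f)"
        proof (rule continuous_at_imp_continuous_on, rule ballI)
          fix x :: real assume x: "x \<in> {0<..<1}"
          define y where "y = (x + 1) / 2"
          have y: "x < y" "y < 1" using x by (auto simp: y_def)
          have "f integrable_on {0<..<y}"
            using set_lebesgue_integral_eq_integral(1)[OF int[of y]] y x by simp
          then have "f integrable_on {0..y}" by (simp add: integrable_on_Icc_iff_Ioo)
          then have "continuous_on {0..y} (\<lambda>z. integral {0..z} f)"
            by (rule indefinite_integral_continuous_1)
          moreover have "integral {0..z} f = primitive f z" if "z \<in> {0..y}" for z
          proof (cases "z = 0")
            case False
            then show ?thesis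
              unfolding primitive_def using set_lebesgue_integral_eq_integral(2)[OF int[of z]] that y
              by (simp add: integral_open_interval_real)
          qed (simp add: primitive_def set_lebesgue_integral_def)
          ultimately have "continuous_on {0..y} (primitive f)" by (rule continuous_on_eq)
          then show "isCont (primitive f) x"
            by (rule continuous_on_interior) (use x y in auto)
        qed
      qed simp
      ultimately show ?thesis by blast
    qed
    then obtain \<kappa> where m: "primitive f \<in> borel_measurable (lebesgue_on {0<..<1})"
      and le: "\<And>x. x \<in> {0<..<1} \<Longrightarrow> (primitive f x - \<kappa>)\<^sup>2 \<le> F * (k x * D)" by blast
    have m': "(\<lambda>x. primitive f x - \<kappa>) \<in> borel_measurable (lebesgue_on {0<..<1})" using m by measurable
    have m2: "(\<lambda>x. (primitive f x - \<kappa>)\<^sup>2) \<in> borel_measurable (lebesgue_on {0<..<1})" using m by measurable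
    define w where "w x = F * (k x * D)" for x
    have wm: "w \<in> borel_measurable (lebesgue_on {0<..<1})"
      unfolding w_def k_def by (rule borel_imp_lebesgue_on) measurable
    have w: "jac_weight (b - 1) (a - 1) x * w x = (F * (2 * D)) * (jac_weight (b - 1 - e) (a - 1 - e) x * poly 1 x)" for x
    proof -
      have "jac_weight (b - 1 - e) (a - 1 - e) x = jac_weight (b - 1) (a - 1) x * jac_weight (- e) (- e) x"
        using powr_add[of "1 - x" "b - 1" "- e"] powr_add[of x "a - 1" "- e"]
        by (simp add: jac_weight_def)
      then show ?thesis by (simp add: w_def k_def)
    qed
    have w_int: "integrable ?Mh w"
      unfolding integrable_jac_measure[OF wm] w
      using jac_weight_poly_integrable[of "b - 1 - e" "a - 1 - e" 1] e by simp
    have w_val: "(LINT x|?Mh. w x) = 2 * D * D' * F"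
      unfolding integral_jac_measure[OF wm] w D'_def jac_int_def by (subst set_integral_mult_right) simp
    have i2: "integrable ?Mh (\<lambda>x. (primitive f x - \<kappa>)\<^sup>2)"
    proof (rule Bochner_Integration.integrable_bound[OF w_int])
      show "AE x in ?Mh. norm ((primitive f x - \<kappa>)\<^sup>2) \<le> norm (w x)"
        using le by (intro AE_I2) (fastforce simp: w_def intro: order_trans[OF _ abs_ge_self])
    qed (use m2 in simp)
    have "(LINT x|?Mh. (primitive f x - \<kappa>)\<^sup>2) \<le> (LINT x|?Mh. w x)"
      by (rule integral_mono[OF i2 w_int]) (use le in \<open>simp add: w_def\<close>)
    then show "\<exists>\<kappa>. square_integrable ?Mh (\<lambda>x. primitive f x - \<kappa>) \<and>
         (LINT x|?Mh. (primitive f x - \<kappa>)\<^sup>2) \<le> 2 * D * D' * (LINT x|jac_measure b a. (f x)\<^sup>2)"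
      unfolding w_val F_def using m' i2 by (intro exI[of _ \<kappa>]) (simp add: square_integrable_def)
  qed (use D in simp)
qed

context normalized_kernel
begin

text \<open>\<open>A\<close> is the mean of \<open>g\<close> for the weight \<open>q\<close>, and the mean minimises the weighted quadratic deviation. So the
  bound holds with an arbitrary constant \<open>\<kappa>\<close> in place of \<open>A\<close> on the right-hand side.\<close>
lemma weighted_mean_decomposition:
  fixes q g :: "real \<Rightarrow> real"
  assumes G: "square_integrable Mh (\<lambda>x. g x - \<kappa>)"
    and qm: "q \<in> borel_measurable (lebesgue_on {0<..<1})"
    and m: "0 < m" and q: "\<And>x. x \<in> {0<..<1} \<Longrightarrow> m \<le> q x \<and> q x \<le> M"
  obtains A where "square_integrable Mh (\<lambda>x. q x * g x - A * q x)" "(LINT x|Mh. q x * g x - A * q x) = 0"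
    "(LINT x|Mh. (q x * g x - A * q x)\<^sup>2) \<le> M\<^sup>2 * (LINT x|Mh. (g x - \<kappa>)\<^sup>2)"
    "\<forall>B. (LINT x|Mh. q x * g x - B * q x) = 0 \<longrightarrow> B = A"
proof -
  let ?G = "\<lambda>x. g x - \<kappa>"
  have q0: "0 < q x" "\<bar>q x\<bar> \<le> M" if "x \<in> {0<..<1}" for x using q[OF that] m by auto
  have M: "0 < M" using q[of "1/2"] m by auto
  have bounded_mult: "square_integrable Mh (\<lambda>x. q x * F x)" if F: "square_integrable Mh F" for F
    unfolding square_integrable_def
  proof
    have Fm: "F \<in> borel_measurable (lebesgue_on {0<..<1})" using F by (simp add: square_integrable_def)
    show *: "(\<lambda>x. q x * F x) \<in> borel_measurable Mh" using Fm qm by simp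
    show "integrable Mh (\<lambda>x. (q x * F x)\<^sup>2)"
    proof (rule Bochner_Integration.integrable_bound)
      show "integrable Mh (\<lambda>x. M\<^sup>2 * (F x)\<^sup>2)" using F by (simp add: square_integrable_def)
      show "(\<lambda>x. (q x * F x)\<^sup>2) \<in> borel_measurable Mh" using * by measurable
      show "AE x in Mh. norm ((q x * F x)\<^sup>2) \<le> norm (M\<^sup>2 * (F x)\<^sup>2)"
        using q0(2) abs_of_pos[OF M] by (intro AE_I2) (auto simp: power_mult_distrib abs_le_square_iff[symmetric] intro!: mult_right_mono)
    qed
  qed
  have one: "square_integrable Mh (\<lambda>x. 1)"   proof -
    have "poly 1 = (\<lambda>x. 1 :: real)" by (simp add: fun_eq_iff)
    then show ?thesis using jac_measure_poly(3)[OF ab_minus, of 1] by simp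
  qed
  have q2: "square_integrable Mh q" using bounded_mult[OF one] by simp
  have qi: "integrable Mh q" using square_integrable_mult[OF q2 one] by simp
  have qGi: "integrable Mh (\<lambda>x. q x * ?G x)" by (rule square_integrable_mult[OF q2 G])
  have qG2i: "integrable Mh (\<lambda>x. q x * (?G x)\<^sup>2)"
    using square_integrable_mult[OF bounded_mult[OF G] G] by (simp add: power2_eq_square mult.assoc)
  define I where "I = (LINT x|Mh. q x)"
  define I1 where "I1 = (LINT x|Mh. q x * ?G x)"
  define I2 where "I2 = (LINT x|Mh. q x * (?G x)\<^sup>2)"
  have I: "0 < I"
  proof -
    have "0 < m * (LINT x|Mh. 1)"
      using jac_int_square_pos[OF ab_minus, of 1] jac_measure_poly(2)[OF ab_minus, of 1] m by simp
    also have "\<dots> = (LINT x|Mh. m)" by simp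
    also have "\<dots> \<le> I" unfolding I_def
    proof (rule integral_mono[OF _ qi])
      show "integrable Mh (\<lambda>x. m)"
      proof -
        have "integrable Mh (\<lambda>x. 1 :: real)" using one by (simp add: square_integrable_def)
        then have "integrable Mh (\<lambda>x. m * 1)" by (rule integrable_mult_right)
        then show ?thesis by simp
      qed
    qed (use q in auto)
    finally show ?thesis .
  qed
  define A0 where "A0 = I1 / I"
  have eq: "q x * g x - B * q x = q x * ?G x - (B - \<kappa>) * q x" for B x by (simp add: algebra_simps)
  have mean: "(LINT x|Mh. q x * g x - B * q x) = I1 - (B - \<kappa>) * I" for B
    unfolding eq I1_def I_def using qGi qi by simp
  show thesis
  proof (rule that[of "\<kappa> + A0"])
    show s: "square_integrable Mh (\<lambda>x. q x * g x - (\<kappa> + A0) * q x)"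
      unfolding eq by (intro square_integrable_diff square_integrable_scale bounded_mult G q2)
    show "(LINT x|Mh. q x * g x - (\<kappa> + A0) * q x) = 0"
      unfolding mean A0_def using I by simp
    show "\<forall>B. (LINT x|Mh. q x * g x - B * q x) = 0 \<longrightarrow> B = \<kappa> + A0"
      using I unfolding mean A0_def by (simp add: field_simps)
    have var: "q x * (?G x - A0)\<^sup>2 = q x * (?G x)\<^sup>2 - 2 * A0 * (q x * ?G x) + A0\<^sup>2 * q x" for x
      by (simp add: power2_eq_square algebra_simps)
    have vi: "integrable Mh (\<lambda>x. q x * (?G x - A0)\<^sup>2)"
      unfolding var using qG2i qGi qi by simp
    have "(LINT x|Mh. (q x * g x - (\<kappa> + A0) * q x)\<^sup>2) \<le> (LINT x|Mh. M * (q x * (?G x - A0)\<^sup>2))"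
    proof (rule integral_mono)
      fix x assume "x \<in> space Mh"
      then have "q x \<le> M" "0 \<le> q x" using q0[of x] by auto
      then have "q x * (q x * (?G x - A0)\<^sup>2) \<le> M * (q x * (?G x - A0)\<^sup>2)"
        by (intro mult_right_mono) auto
      then show "(q x * g x - (\<kappa> + A0) * q x)\<^sup>2 \<le> M * (q x * (?G x - A0)\<^sup>2)"
        by (simp add: power2_eq_square algebra_simps)
    qed (use s vi in \<open>auto simp: square_integrable_def\<close>)
    also have "\<dots> = M * (I2 - 2 * A0 * I1 + A0\<^sup>2 * I)"
      unfolding var I_def I1_def I2_def using qG2i qGi qi by simp
    also have "\<dots> = M * (I2 - A0\<^sup>2 * I)"
      using I by (simp add: A0_def power2_eq_square)
    also have "\<dots> \<le> M * I2" using M I by (intro mult_left_mono) auto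
    also have "I2 \<le> (LINT x|Mh. M * (?G x)\<^sup>2)"
      unfolding I2_def
    proof (rule integral_mono[OF qG2i])
      show "integrable Mh (\<lambda>x. M * (?G x)\<^sup>2)" using G by (simp add: square_integrable_def)
      fix x assume "x \<in> space Mh"
      then have "q x \<le> M" using q[of x] by simp
      then show "q x * (?G x)\<^sup>2 \<le> M * (?G x)\<^sup>2" by (intro mult_right_mono) auto
    qed
    also have "\<dots> = M * (LINT x|Mh. (?G x)\<^sup>2)" by simp
    finally show "(LINT x|Mh. (q x * g x - (\<kappa> + A0) * q x)\<^sup>2) \<le> M\<^sup>2 * (LINT x|Mh. (?G x)\<^sup>2)"
      using M by (simp add: power2_eq_square mult.assoc)
  qed
qed

text \<open>The equation \<open>L u = f\<^sub>1 - A f\<^sub>2\<close> has the right-hand side \<open>(g - A) / K\<close> with \<open>g\<close> the primitive of \<open>f\<close>. Solvability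
  forces \<open>A\<close> to be the weighted mean; the constant combines those of the primitive, of \<open>1 / K\<close> and of \<open>L\<^sup>-\<^sup>1\<close>.\<close>
theorem stability:
  fixes K :: "real \<Rightarrow> real"
  assumes Km: "K \<in> borel_measurable (lebesgue_on {0<..<1})" and m: "0 < m"
    and K: "\<And>x. x \<in> {0<..<1} \<Longrightarrow> m \<le> K x \<and> K x \<le> M"
  shows "\<exists>C>0. \<forall>f \<in> wL2 (jac_weight b a).
           \<exists>u A. is_solution (a + b) \<rho> b (rhs1 K f) (rhs2 K) u A \<and>
             (\<forall>v B. is_solution (a + b) \<rho> b (rhs1 K f) (rhs2 K) v B \<longrightarrow>
                (AE x in lebesgue_on {0<..<1}. v x = u x) \<and> B = A) \<and>
             wnorm (jac_weight (- a) (- b)) u \<le> C * wnorm (jac_weight b a) f"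
    (is "\<exists>C>0. \<forall>f\<in>_. ?Q C f")
proof -
  obtain C where C: "0 < C"
    "\<And>f. square_integrable (jac_measure b a) f \<Longrightarrow>
       \<exists>\<kappa>. square_integrable Mh (\<lambda>x. primitive f x - \<kappa>) \<and>
         (LINT x|Mh. (primitive f x - \<kappa>)\<^sup>2) \<le> C * (LINT x|jac_measure b a. (f x)\<^sup>2)"
    using primitive_estimate[OF a b] by blast
  define q where "q x = 1 / K x" for x
  have qm: "q \<in> borel_measurable (lebesgue_on {0<..<1})" unfolding q_def using Km by measurable
  have M: "0 < M" using K[of "1/2"] m by auto
  then have invM: "0 < 1 / M" by simp
  have q: "1 / M \<le> q x \<and> q x \<le> 1 / m" if "x \<in> {0<..<1}" for x
    using K[OF that] m by (auto simp: q_def intro!: divide_left_mono)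
  have rhs: "rhs1 K f x - B * rhs2 K x = q x * primitive f x - B * q x" for f B x
    by (simp add: rhs1_def rhs2_def q_def primitive_def)
  have sol: "is_solution (a + b) \<rho> b (rhs1 K f) (rhs2 K) v B \<longleftrightarrow>
     (\<exists>d. solves (\<lambda>x. q x * primitive f x - B * q x) d v)" for f v B
    unfolding is_solution_def rhs using a b by (simp add: jacobi_trunc_def jac_weight_def)
  show ?thesis
  proof (intro exI[of _ "sqrt (C / \<delta>) / m"] conjI ballI)
    show "0 < sqrt (C / \<delta>) / m" using C(1) \<delta>_pos m by simp
    fix f assume "f \<in> wL2 (jac_weight b a)"
    then have f: "square_integrable (jac_measure b a) f" by (simp add: square_integrable_jac_measure)
    obtain \<kappa> where \<kappa>: "square_integrable Mh (\<lambda>x. primitive f x - \<kappa>)"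
      "(LINT x|Mh. (primitive f x - \<kappa>)\<^sup>2) \<le> C * (LINT x|jac_measure b a. (f x)\<^sup>2)"
      using C(2)[OF f] by blast
    define h where "h B x = q x * primitive f x - B * q x" for B x
    obtain A where A: "square_integrable Mh (h A)" "(LINT x|Mh. h A x) = 0"
      "(LINT x|Mh. (h A x)\<^sup>2) \<le> (1 / m)\<^sup>2 * (LINT x|Mh. (primitive f x - \<kappa>)\<^sup>2)"
      "\<forall>B. (LINT x|Mh. h B x) = 0 \<longrightarrow> B = A"
      unfolding h_def by (rule weighted_mean_decomposition[OF \<kappa>(1) qm invM q])
    obtain d u where du: "solves (h A) d u" "\<delta> * (LINT x|Mu. (u x)\<^sup>2) \<le> (LINT x|Mh. (h A x)\<^sup>2)"
      by (rule solves_exists[OF A(1,2)])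
    have "is_solution (a + b) \<rho> b (rhs1 K f) (rhs2 K) u A"
      unfolding sol using du(1) unfolding h_def by blast
    moreover have "(AE x in lebesgue_on {0<..<1}. v x = u x) \<and> B = A"
      if s: "is_solution (a + b) \<rho> b (rhs1 K f) (rhs2 K) v B" for v B
    proof -
      obtain d' where d': "solves (h B) d' v" using s unfolding sol h_def by blast
      have "B = A" by (rule A(4)[rule_format, OF solves_coeff(1)[OF d']])
      then show ?thesis using solves_unique[OF du(1)] d' by blast
    qed
    moreover have "wnorm (jac_weight (- a) (- b)) u \<le> sqrt (C / \<delta>) / m * wnorm (jac_weight b a) f"
    proof -
      let ?F = "LINT x|jac_measure b a. (f x)\<^sup>2" and ?U = "LINT x|Mu. (u x)\<^sup>2"
      have u: "square_integrable Mu u" using du(1) by (simp add: wL2_tendsto_jac_measure)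
      have um: "u \<in> borel_measurable (lebesgue_on {0<..<1})" and fm: "f \<in> borel_measurable (lebesgue_on {0<..<1})"
        using u f by (simp_all add: square_integrable_def)
      have "\<delta> * ?U \<le> (1 / m)\<^sup>2 * (LINT x|Mh. (primitive f x - \<kappa>)\<^sup>2)"
        using du(2) A(3) by (rule order_trans)
      also have "\<dots> \<le> (1 / m)\<^sup>2 * (C * ?F)"
        by (intro mult_left_mono \<kappa>(2)) simp
      finally have "?U \<le> ((1 / m)\<^sup>2 * (C * ?F)) / \<delta>"
        using \<delta>_pos by (simp only: pos_le_divide_eq mult.commute)
      also have "\<dots> = (C / \<delta>) * (1 / m)\<^sup>2 * ?F"
        by simp
      finally have "?U \<le> (C / \<delta>) * (1 / m)\<^sup>2 * ?F" .
      then have "sqrt ?U \<le> sqrt ((C / \<delta>) * (1 / m)\<^sup>2 * ?F)"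
        by (rule real_sqrt_le_mono)
      also have "\<dots> = sqrt (C / \<delta>) / m * sqrt ?F"
        using m by (simp add: real_sqrt_mult real_sqrt_divide)
      finally show ?thesis by (simp add: wnorm_jac_measure um fm)
    qed
    ultimately show "?Q (sqrt (C / \<delta>) / m) f"
      by blast
  qed
qed

end

theorem theorem3p2:
  fixes \<alpha> \<beta> r K\<^sub>m K\<^sub>M :: real and K :: "real \<Rightarrow> real"
  assumes "1 < \<alpha>" and "\<alpha> < 2"
    and "0 \<le> r" and "r \<le> 1"
    and "\<alpha> - 1 \<le> \<beta>" and "\<beta> \<le> 1"
    and "r = sin (pi * \<beta>) / (sin (pi * (\<alpha> - \<beta>)) + sin (pi * \<beta>))"
    and "K \<in> borel_measurable (lebesgue_on {0<..<1})"
    and "0 < K\<^sub>m"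
    and "\<And>x. x \<in> {0<..<1} \<Longrightarrow> K\<^sub>m \<le> K x \<and> K x \<le> K\<^sub>M"
  shows "\<exists>C>0. \<forall>f \<in> wL2 (jac_weight \<beta> (\<alpha> - \<beta>)).
           \<exists>u A. is_solution \<alpha> r \<beta> (rhs1 K f) (rhs2 K) u A \<and>
             (\<forall>v B. is_solution \<alpha> r \<beta> (rhs1 K f) (rhs2 K) v B \<longrightarrow>
                (AE x in lebesgue_on {0<..<1}. v x = u x) \<and> B = A) \<and>
             wnorm (jac_weight (- (\<alpha> - \<beta>)) (- \<beta>)) u \<le> C * wnorm (jac_weight \<beta> (\<alpha> - \<beta>)) f"
proof -
  have sa: "0 \<le> sin (pi * (\<alpha> - \<beta>))" and sb: "0 \<le> sin (pi * \<beta>)"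
    using assms by (auto intro!: sin_ge_zero)
  have "0 < sin (pi * (\<alpha> - \<beta>)) + sin (pi * \<beta>)"
  proof (cases "\<beta> < 1")
    case True
    then have "0 < sin (pi * \<beta>)" using assms by (intro sin_gt_zero) auto
    with sa show ?thesis by simp
  next
    case False
    then have "0 < sin (pi * (\<alpha> - \<beta>))" using assms by (intro sin_gt_zero) auto
    with sb show ?thesis by simp
  qed
  then have "r * sin (pi * (\<alpha> - \<beta>)) = (1 - r) * sin (pi * \<beta>)"
    unfolding assms(7) by (simp add: field_simps)
  then interpret normalized_kernel "\<alpha> - \<beta>" \<beta> r "1 - r"
    using assms(1-6) by unfold_locales auto
  show ?thesis
    using stability[OF assms(8-10)] by simp
qed

end
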